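(* Let $E$ be a locally compact Polish space, $\mathbb{M}$ the space of finite Borel measures on $E$ with the weak topology, $\nu\in\mathbb{M}$ with $\nu(E)>0$, and $\mathcal{G}$ the Gamma distribution on $\mathbb{M}$ with intensity measure $\nu$. Let $(\mathcal{E}_{\mathbf{1},0},\mathcal{D}(\mathcal{E}_{\mathbf{1},0}))$ be the closure in $L^2(\mathcal{G})$ of the form $$\mathcal{E}_{\mathbf{1},0}(F,G)=\int_{\mathbb{M}}\langle \nabla^{ext}F(\eta),\nabla^{ext}G(\eta)\rangle_{L^2(\eta)}\,\mathcal{G}(d\eta),\qquad F,G\in\mathcal{F}C_0^\infty,$$ with generator $\mathcal{L}_{\mathbf{1},0}$. Then: (1) $\mathrm{gap}(\mathcal{L}_{\mathbf{1},0})=1$, i.e. $\lambda=1$ is the largest constant such that $\mathcal{G}(F^2)\le \frac1\lambda\mathcal{E}_{\mathbf{1},0}(F,F)+\mathcal{G}(F)^2$ for all $F\in\mathcal{D}(\mathcal{E}_{\mathbf{1},0})$. (2) If $\mathrm{supp}\,\nu$ contains infinitely many points, then $\mathcal{E}_{\mathbf{1},0}$ does not satisfy the super Poincaré inequality, i.e. there is no function $\beta:(0,\infty)\to(0,\infty)$ such that $\mathcal{G}(F^2)\le r\,\mathcal{E}_{\mathbf{1},0}(F,F)+\beta(r)\mathcal{G}(|F|)^2$ for all $r>0$ and $F\in\mathcal{D}(\mathcal{E}_{\mathbf{1},0})$. (3) There exists a constant $c_0>0$ (independent of $\nu$) such that whenever $\mathrm{supp}\,\nu$ is a finite set, $$\mathcal{G}(F^2\log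 F^2)\le \frac{c_0}{1\wedge\delta}\,\mathcal{E}_{\mathbf{1},0}(F,F),\qquad F\in\mathcal{D}(\mathcal{E}_{\mathbf{1},0}),\ \mathcal{G}(F^2)=1,$$ where $\delta:=\min\{\nu(\{x\}):x\in\mathrm{supp}\,\nu\}$.
   Context: For a measure $\eta$ and $f\in L^1(\eta)$ write $\eta(f)=\int f\,d\eta$. The Gamma distribution $\mathcal{G}$ with intensity $\nu$ is the unique probability measure on $\mathbb{M}$ such that for any disjoint measurable $A_1,\dots,A_n\subset E$, the variables $\eta\mapsto\eta(A_i)$, $1\le i\le n$, are independent under $\mathcal{G}$ and $\eta(A_i)$ has law $\gamma_{\nu(A_i)}$, where $\gamma_r(ds)=1_{[0,\infty)}(s)\frac{s^{r-1}e^{-s}}{\Gamma(r)}ds$ for $r>0$ and $\gamma_0=\delta_0$. A measurable $F:\mathbb{M}\to\mathbb{R}$ is extrinsically differentiable at $\eta$ if $\nabla^{ext}F(\eta)(x):=\frac{d}{ds}F(\eta+s\delta_x)|_{s=0}$ exists for all $x\in E$ and $\|\nabla^{ext}F(\eta)\|_{L^2(\eta)}<\infty$. $\mathcal{F}C_0^\infty$ is the class of functions $F(\eta)=f(\eta(A_1),\dots,\eta(A_n))$ with $n\ge1$, $f\in C_0^\infty(\mathbb{R}^n)$ and $\{A_i\}_{1\le i\le n}$ a measurable partition of $E$. The form above is closable in $L^2(\mathcal{G})$; $\mathcal{D}(\mathcal{E}_{\mathbf{1},0})$ denotes the domain of the closure. $\mathrm{gap}(\mathcal{L}_{\mathbf{1},0})$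 is the largest $\lambda>0$ for which the stated Poincaré inequality holds (and $0$ if none exists). *)

theory Defs
  imports "HOL-Probability.Probability"
begin

definition Mset :: "'a::topological_space measure set" where
  "Mset = {\<eta>. sets \<eta> = sets borel \<and> finite_measure \<eta>}"

definition M_alg :: "'a::topological_space measure measure" where
  "M_alg = sigma Mset
     (\<Union>A\<in>sets borel. {{\<eta>\<in>Mset. measure \<eta> A \<in> B} | B. B \<in> sets (borel :: real measure)})"

definition gamma_law :: "real \<Rightarrow> real measure" where
  "gamma_law r = (if r = 0 then return borel 0
     else density lborel (\<lambda>s. ennreal (indicator {0..} s * s powr (r - 1) * exp (- s) / Gamma r)))"

definition is_gamma_dist :: "'a::topological_space measure \<Rightarrow> 'a measure measure \<Rightarrow> bool" where
  "is_gamma_dist \<nu> G \<longleftrightarrow> prob_space G \<and> space G = Mset \<and> sets G = sets M_alg \<and>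
     (\<forall>(n::nat) (A::nat \<Rightarrow> 'a set).
        (\<forall>i<n. A i \<in> sets borel) \<and> disjoint_family_on A {..<n} \<longrightarrow>
          prob_space.indep_vars G (\<lambda>_. borel) (\<lambda>i \<eta>. measure \<eta> (A i)) {..<n} \<and>
          (\<forall>i<n. distr G borel (\<lambda>\<eta>. measure \<eta> (A i)) = gamma_law (measure \<nu> (A i))))"

definition supp :: "'a::topological_space measure \<Rightarrow> 'a set" where
  "supp \<nu> = {x. \<forall>U. open U \<and> x \<in> U \<longrightarrow> emeasure \<nu> U > 0}"

definition add_pt :: "'a::topological_space measure \<Rightarrow> real \<Rightarrow> 'a \<Rightarrow> 'a measure" where
  "add_pt \<eta> s x = measure_of UNIV (sets borel) (\<lambda>B. emeasure \<eta> B + ennreal s * indicator B x)"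

text \<open>Extrinsic derivative: derivative of s |-> F(eta + s delta_x) at s = 0
  (taken along s >= 0, where eta + s delta_x is a measure).\<close>
definition grad_ext :: "('a::topological_space measure \<Rightarrow> real) \<Rightarrow> 'a measure \<Rightarrow> 'a \<Rightarrow> real" where
  "grad_ext F \<eta> x = (THE D. ((\<lambda>s. F (add_pt \<eta> s x)) has_real_derivative D) (at 0 within {0..}))"

section \<open>Smooth compactly supported functions on R^n, R^n encoded in nat => real\<close>

definition trunc_vec :: "nat \<Rightarrow> (nat \<Rightarrow> real) \<Rightarrow> (nat \<Rightarrow> real)" where
  "trunc_vec n y = (\<lambda>i. if i < n then y i else 0)"

definition partial_d :: "nat \<Rightarrow> ((nat \<Rightarrow> real) \<Rightarrow> real) \<Rightarrow> (nat \<Rightarrow> real) \<Rightarrow> real" where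
  "partial_d i g y = deriv (\<lambda>t. g (y(i := t))) (y i)"

fun iter_partial :: "nat list \<Rightarrow> ((nat \<Rightarrow> real) \<Rightarrow> real) \<Rightarrow> (nat \<Rightarrow> real) \<Rightarrow> real" where
  "iter_partial [] g = g"
| "iter_partial (i # is) g = partial_d i (iter_partial is g)"

definition C0_infty :: "nat \<Rightarrow> ((nat \<Rightarrow> real) \<Rightarrow> real) \<Rightarrow> bool" where
  "C0_infty n f \<longleftrightarrow>
     (let g = (\<lambda>y. f (trunc_vec n y)) in
       (\<forall>is. set is \<subseteq> {..<n} \<longrightarrow>
          continuous_on UNIV (iter_partial is g) \<and>
          (\<forall>i<n. \<forall>y. (\<lambda>t. iter_partial is g (y(i := t))) differentiable (at (y i)))) \<and>
       (\<exists>B. \<forall>y. (\<exists>i<n. \<bar>y i\<bar> > B) \<longrightarrow> g y = 0))"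

definition FC0 :: "('a::topological_space measure \<Rightarrow> real) set" where
  "FC0 = {F. \<exists>n\<ge>1. \<exists>f A. C0_infty n f \<and> (\<forall>i<n. A i \<in> sets borel) \<and>
              disjoint_family_on A {..<n} \<and> (\<Union>i<n. A i) = UNIV \<and>
              (\<forall>\<eta>\<in>Mset. F \<eta> = f (\<lambda>i. if i < n then measure \<eta> (A i) else 0))}"

definition Eform :: "'a::topological_space measure measure \<Rightarrow> ('a measure \<Rightarrow> real) \<Rightarrow> real" where
  "Eform G F = (\<integral>\<eta>. (\<integral>x. (grad_ext F \<eta> x)\<^sup>2 \<partial>\<eta>) \<partial>G)"

definition approx_seq :: "'a::topological_space measure measure \<Rightarrow> ('a measure \<Rightarrow> real)
    \<Rightarrow> (nat \<Rightarrow> 'a measure \<Rightarrow> real) \<Rightarrow> bool" where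
  "approx_seq G F Fn \<longleftrightarrow> (\<forall>n. Fn n \<in> FC0) \<and>
     (\<lambda>n. \<integral>\<eta>. (Fn n \<eta> - F \<eta>)\<^sup>2 \<partial>G) \<longlonglongrightarrow> 0 \<and>
     (\<forall>e>0. \<exists>N. \<forall>m\<ge>N. \<forall>n\<ge>N. Eform G (\<lambda>\<eta>. Fn n \<eta> - Fn m \<eta>) < e)"

definition dom_closure :: "'a::topological_space measure measure \<Rightarrow> ('a measure \<Rightarrow> real) set" where
  "dom_closure G = {F. F \<in> borel_measurable G \<and> integrable G (\<lambda>\<eta>. (F \<eta>)\<^sup>2) \<and>
                       (\<exists>Fn. approx_seq G F Fn)}"

text \<open>Value of the closed form on the diagonal (well defined by closability).\<close>
definition Ebar :: "'a::topological_space measure measure \<Rightarrow> ('a measure \<Rightarrow> real) \<Rightarrow> real" where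
  "Ebar G F = (THE e. \<forall>Fn. approx_seq G F Fn \<longrightarrow> (\<lambda>n. Eform G (Fn n)) \<longlonglongrightarrow> e)"

definition poincare :: "'a::topological_space measure measure \<Rightarrow> real \<Rightarrow> bool" where
  "poincare G lam \<longleftrightarrow> (\<forall>F\<in>dom_closure G.
     (\<integral>\<eta>. (F \<eta>)\<^sup>2 \<partial>G) \<le> Ebar G F / lam + (\<integral>\<eta>. F \<eta> \<partial>G)\<^sup>2)"

definition spectral_gap :: "'a::topological_space measure measure \<Rightarrow> real" where
  "spectral_gap G = (if \<exists>lam>0. poincare G lam then Sup {lam. lam > 0 \<and> poincare G lam} else 0)"

definition super_poincare :: "'a::topological_space measure measure \<Rightarrow> bool" where
  "super_poincare G \<longleftrightarrow> (\<exists>\<beta>::real \<Rightarrow> real. (\<forall>r>0. \<beta> r > 0) \<and>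
     (\<forall>r>0. \<forall>F\<in>dom_closure G.
        (\<integral>\<eta>. (F \<eta>)\<^sup>2 \<partial>G) \<le> r * Ebar G F + \<beta> r * (\<integral>\<eta>. \<bar>F \<eta>\<bar> \<partial>G)\<^sup>2))"

end

theory Submission
  imports Defs "HOL-Real_Asymp.Real_Asymp"
begin

text \<open>On a measurable partition \<open>A\<^sub>1, \<dots>, A\<^sub>n\<close> the masses \<open>\<eta>(A\<^sub>i)\<close> are independent gamma variables, and the
  form of \<open>f(\<eta>(A\<^sub>1), \<dots>, \<eta>(A\<^sub>n))\<close> is the integral of \<open>\<Sum>i. x\<^sub>i (\<partial>\<^sub>i f)\<^sup>2\<close> against their joint law. Variance and
  entropy are subadditive on product spaces, so the Poincare inequality (constant \<open>1\<close>) and the logarithmic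
  Sobolev inequality (constant of order \<open>1 / min 1 r\<close>) reduce to the single law \<open>\<gamma>\<^sub>r\<close>. There the integrand of
  the difference of both sides is bounded by the derivative of a function vanishing at \<open>0\<close> and \<open>\<infinity>\<close>; for
  \<open>r > 1\<close> the logarithmic Sobolev inequality is inherited from \<open>\<gamma>\<^bsub>r/2\<^esub>\<close> through
  \<open>\<gamma>\<^sub>r = \<gamma>\<^bsub>r/2\<^esub> * \<gamma>\<^bsub>r/2\<^esub>\<close>. Integration by parts on the common refinement of two partitions gives closability.
  The functions \<open>\<eta> \<mapsto> \<eta>(A)\<close> have mean, variance and energy all equal to \<open>\<nu>(A)\<close>: they attain the gap, and they
  violate the super Poincare inequality when \<open>\<nu>(A)\<close> can be arbitrarily small and positive.\<close>

section \<open>Gamma densities on the line\<close>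

text \<open>The weight \<open>x\<close> in the energy is linear, and the argument rests on this.
  Energies of cells add up to the energy of their block, so refining a partition changes nothing;
  and in the step from \<open>r / 2\<close> to \<open>r\<close> the two partial energies of
  \<open>g (x + y)\<close> combine to the weight \<open>x + y\<close>, so the constant does not
  grow. Halving can therefore stop in the interval \<open>(1/2, 1]\<close>, where
  \<open>4 / r\<close> is below 8. Using \<open>F^2\<close> as the density costs another factor 4,
  hence the 32. One obstacle is that \<open>Ebar\<close> is a definite description: nothing can be
  said about its value before closability shows that all approximating sequences give the same one.
  Another is that masses are unbounded and far from compactly supported, so they enter the domain
  only through cutoffs whose energies converge. Since integrals of non-integrable functions are 0 by
  convention, bounds accompany every function until the passage to the closure. There the entropy is
  not continuous, and Fatou's lemma takes over; it yields integrability of the limit at the same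
  time.\<close>

definition gdens :: "real \<Rightarrow> real \<Rightarrow> real" where
  "gdens r s = indicator {0..} s * s powr (r - 1) * exp (- s) / Gamma r"

lemma gdens_measurable [measurable]: "gdens r \<in> borel_measurable borel"
  unfolding gdens_def by measurable

lemma gdens_nonneg: "r > 0 \<Longrightarrow> gdens r s \<ge> 0"
  by (simp add: gdens_def)

lemma gdens_eq: "x > 0 \<Longrightarrow> gdens r x = x powr (r - 1) * exp (- x) / Gamma r"
  by (simp add: gdens_def)

lemma gdens_pos: "r > 0 \<Longrightarrow> x > 0 \<Longrightarrow> gdens r x > 0"
  by (simp add: gdens_eq)

text \<open>At \<open>x = 0\<close> this rests on the convention \<open>0 powr a = 0\<close>; all
  computations with the density can then be confined to \<open>x > 0\<close>.\<close>

lemma gdens_zero: "x \<le> 0 \<Longrightarrow> gdens r x = 0"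
  by (auto simp: gdens_def indicator_def)

lemma nn_integral_gdens:
  assumes "r > 0" shows "(\<integral>\<^sup>+x. ennreal (gdens r x) \<partial>lborel) = 1"
proof -
  have G: "Gamma r > 0" using assms by simp
  have "(\<integral>\<^sup>+x. ennreal (gdens r x) \<partial>lborel)
      = (\<integral>\<^sup>+x. ennreal (1 / Gamma r) * ennreal (indicator {0..} x * x powr (r - 1) / exp x) \<partial>lborel)"
    using G by (intro nn_integral_cong)
      (simp add: gdens_def exp_minus field_simps flip: ennreal_mult')
  also have "\<dots> = ennreal (1 / Gamma r) * ennreal (Gamma r)"
    using Gamma_conv_nn_integral_real[OF assms] by (simp add: nn_integral_cmult)
  also have "\<dots> = 1" using G by (simp flip: ennreal_mult')
  finally show ?thesis .
qed

lemma has_bochner_integral_gdens: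
  assumes "r > 0" shows "has_bochner_integral lborel (gdens r) 1"
  using nn_integral_gdens[OF assms] gdens_nonneg[OF assms]
  by (intro has_bochner_integral_nn_integral) auto

lemma integrable_gdens: "r > 0 \<Longrightarrow> integrable lborel (gdens r)"
  and integral_gdens: "r > 0 \<Longrightarrow> integral\<^sup>L lborel (gdens r) = 1"
  using has_bochner_integral_gdens by (auto simp: has_bochner_integral_iff)

text \<open>Weighting by \<open>x\<close> raises the shape parameter by one, because
  \<open>Gamma (r + 1) = r * Gamma r\<close>. Every moment thereby becomes a multiple of a total
  mass.\<close>

lemma mult_gdens:
  assumes "r > 0" shows "x * gdens r x = r * gdens (r + 1) x"
proof (cases "x > 0")
  case True
  have "Gamma (r + 1) = r * Gamma r" using assms Gamma_plus1[of r] by (auto simp: nonpos_Ints_def)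
  then show ?thesis using True assms by (simp add: gdens_eq powr_diff field_simps)
qed (simp add: gdens_zero)

lemma gamma_law_eq: "r \<noteq> 0 \<Longrightarrow> gamma_law r = density lborel (\<lambda>x. ennreal (gdens r x))"
  by (simp add: gamma_law_def gdens_def)

lemma sets_gamma_law [simp, measurable_cong]: "sets (gamma_law r) = sets borel"
  by (simp add: gamma_law_def)

lemma space_gamma_law [simp]: "space (gamma_law r) = UNIV"
  by (simp add: gamma_law_def)

lemma prob_space_gamma_law: assumes "r \<ge> 0" shows "prob_space (gamma_law r)"
proof (cases "r = 0")
  case True then show ?thesis by (simp add: gamma_law_def prob_space_return)
next
  case False
  then show ?thesis using assms nn_integral_gdens[of r]
    by (intro prob_spaceI) (simp add: gamma_law_eq emeasure_density)
qed

lemma AE_gamma_law_nonneg: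
  assumes "r \<ge> 0" shows "AE x in gamma_law r. x \<ge> 0"
proof (cases "r = 0")
  case True
  have "AE x in return borel (0::real). x \<ge> 0" by (subst AE_return) auto
  with True show ?thesis by (simp only: gamma_law_def simp_thms if_True)
next
  case False
  have "gdens r x > 0 \<Longrightarrow> x \<ge> 0" for x using gdens_zero[of x r] by force
  then show ?thesis unfolding gamma_law_eq[OF False] by (subst AE_density) auto
qed

lemma integral_gamma_law:
  fixes f :: "real \<Rightarrow> real"
  assumes "r > 0" "f \<in> borel_measurable borel"
  shows "(\<integral>x. f x \<partial>gamma_law r) = (\<integral>x. gdens r x * f x \<partial>lborel)"
  using assms gdens_nonneg[OF assms(1)] by (simp add: gamma_law_eq integral_density)

lemma integrable_gamma_law:
  fixes f :: "real \<Rightarrow> real"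
  assumes "r > 0" "f \<in> borel_measurable borel"
  shows "integrable (gamma_law r) f \<longleftrightarrow> integrable lborel (\<lambda>x. gdens r x * f x)"
  using assms gdens_nonneg[OF assms(1)] by (simp add: gamma_law_eq integrable_density)

lemma gamma_law_0: "gamma_law 0 = return borel 0"
  by (simp add: gamma_law_def)

lemma integral_gamma_law_0:
  fixes f :: "real \<Rightarrow> real"
  assumes "f \<in> borel_measurable borel"
  shows "(\<integral>x. f x \<partial>gamma_law 0) = f 0"
  using assms by (simp add: gamma_law_0 integral_return)

lemma integrable_gamma_law_0:
  fixes f :: "real \<Rightarrow> real"
  assumes "f \<in> borel_measurable borel"
  shows "integrable (gamma_law 0) f"
  using assms by (simp add: gamma_law_0 integrable_iff_bounded nn_integral_return)

lemma gamma_law_moments: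
  assumes "r \<ge> 0"
  shows "integrable (gamma_law r) (\<lambda>x. x)" "(\<integral>x. x \<partial>gamma_law r) = r"
    "integrable (gamma_law r) (\<lambda>x. x\<^sup>2)" "(\<integral>x. x\<^sup>2 \<partial>gamma_law r) = r * (r + 1)"
proof -
  have eq: "gdens r x * x = r * gdens (r + 1) x"
      "gdens r x * x\<^sup>2 = r * (r + 1) * gdens (r + 2) x" if "r > 0" for x
    using that mult_gdens[of r x] mult_gdens[of "r + 1" x]
    by (auto simp: power2_eq_square algebra_simps)
  show "integrable (gamma_law r) (\<lambda>x. x)" "(\<integral>x. x \<partial>gamma_law r) = r"
    "integrable (gamma_law r) (\<lambda>x. x\<^sup>2)" "(\<integral>x. x\<^sup>2 \<partial>gamma_law r) = r * (r + 1)"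
    using assms
    by (cases "r = 0"; simp add: integral_gamma_law_0 integrable_gamma_law_0 integral_gamma_law
        integrable_gamma_law eq integrable_gdens integral_gdens)+
qed

section \<open>Integration by parts on the half line\<close>

text \<open>The comparison is made on compact subintervals of the open half line, where the gauge
  integral of a derivative is given by the end points; only \<open>L\<close> has to be integrable as
  a whole. Dominated convergence then exhausts the half line. An inequality between integrals is
  thus reduced to a pointwise one and two limits.\<close>

lemma integral_le_0_if_le_deriv:
  fixes L Q Q' :: "real \<Rightarrow> real"
  assumes int: "integrable lborel L" and zero: "\<And>x. x \<le> 0 \<Longrightarrow> L x = 0"
    and deriv: "\<And>x. x > 0 \<Longrightarrow> (Q has_real_derivative Q' x) (at x)"
    and le: "\<And>x. x > 0 \<Longrightarrow> L x \<le> Q' x"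
    and lim: "(Q \<longlongrightarrow> 0) (at_right 0)" "(Q \<longlongrightarrow> 0) at_top"
  shows "integral\<^sup>L lborel L \<le> 0"
proof -
  define a b where "a n = 1 / (real n + 1)" and "b n = real n + 2" for n
  have ab: "0 < a n" "a n \<le> b n" for n by (auto simp: a_def b_def field_simps)
  have le_n: "(\<integral>x. indicator {a n..b n} x * L x \<partial>lborel) \<le> Q (b n) - Q (a n)" for n
  proof -
    have si: "set_integrable lborel {a n..b n} L"
      using int unfolding set_integrable_def by (intro integrable_mult_indicator) auto
    have "((\<lambda>x. L x) has_integral (\<integral>x. indicator {a n..b n} x * L x \<partial>lborel)) {a n..b n}"
      using set_borel_integral_eq_integral[OF si]
      by (simp add: set_lebesgue_integral_def has_integral_integral)
    moreover have "(Q' has_integral Q (b n) - Q (a n)) {a n..b n}"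
      using ab deriv
      by (intro fundamental_theorem_of_calculus)
        (auto simp: has_real_derivative_iff_has_vector_derivative[symmetric]
          intro!: has_field_derivative_at_within deriv intro: less_le_trans)
    ultimately show ?thesis
      by (rule has_integral_le) (use ab[of n] le in force)
  qed
  have "(\<lambda>n. \<integral>x. indicator {a n..b n} x * L x \<partial>lborel) \<longlonglongrightarrow> integral\<^sup>L lborel L"
  proof (rule integral_dominated_convergence[where w = "\<lambda>x. \<bar>L x\<bar>"])
    show "AE x in lborel. (\<lambda>n. indicator {a n..b n} x * L x) \<longlonglongrightarrow> L x"
    proof (intro AE_I2)
      fix x :: real
      show "(\<lambda>n. indicator {a n..b n} x * L x) \<longlonglongrightarrow> L x"
      proof (cases "x > 0")
        case True
        have "\<forall>\<^sub>F n in sequentially. a n < x" unfolding a_def using True by real_asymp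
        moreover have "\<forall>\<^sub>F n in sequentially. x < b n" unfolding b_def by real_asymp
        ultimately have "\<forall>\<^sub>F n in sequentially. indicator {a n..b n} x * L x = L x"
          by eventually_elim auto
        then show ?thesis by (rule tendsto_eventually)
      qed (simp add: zero)
    qed
  qed (use int in \<open>auto simp: indicator_def\<close>)
  moreover have "(\<lambda>n. Q (b n) - Q (a n)) \<longlonglongrightarrow> 0 - 0"
  proof (intro tendsto_diff)
    have "filterlim b at_top sequentially" unfolding b_def by real_asymp
    then show "(\<lambda>n. Q (b n)) \<longlonglongrightarrow> 0" using lim(2) filterlim_compose by blast
    have "filterlim a (at_right 0) sequentially" unfolding a_def by real_asymp
    then show "(\<lambda>n. Q (a n)) \<longlonglongrightarrow> 0" using lim(1) filterlim_compose by blast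
  qed
  ultimately show ?thesis using le_n by (auto intro: LIMSEQ_le)
qed

lemma integral_eq_0_if_eq_deriv:
  fixes L Q :: "real \<Rightarrow> real"
  assumes "integrable lborel L" "\<And>x. x \<le> 0 \<Longrightarrow> L x = 0"
    and "\<And>x. x > 0 \<Longrightarrow> (Q has_real_derivative L x) (at x)"
    and "(Q \<longlongrightarrow> 0) (at_right 0)" "(Q \<longlongrightarrow> 0) at_top"
  shows "integral\<^sup>L lborel L = 0"
proof (rule antisym)
  show "integral\<^sup>L lborel L \<le> 0" by (rule integral_le_0_if_le_deriv) (use assms in auto)
  have "integral\<^sup>L lborel (\<lambda>x. - L x) \<le> 0"
    by (rule integral_le_0_if_le_deriv[where Q = "\<lambda>x. - Q x" and Q' = "\<lambda>x. - L x"])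
      (use assms in \<open>auto intro!: derivative_intros tendsto_eq_intros\<close>)
  then show "0 \<le> integral\<^sup>L lborel L" by simp
qed

section \<open>Primitives of integrable functions and their limits\<close>

definition lint :: "(real \<Rightarrow> real) \<Rightarrow> real \<Rightarrow> real" where
  "lint h x = (\<integral>t. indicator {..x} t * h t \<partial>lborel)"

text \<open>Continuity is available on the open half line only, since gamma densities with
  \<open>r < 1\<close> explode at 0. The primitive is therefore split at \<open>x / 2\<close>, and
  only the part beyond that point is differentiated.\<close>

lemma lint_deriv:
  assumes int: "integrable lborel h" and cont: "continuous_on {0<..} h" and x: "x > 0"
  shows "(lint h has_real_derivative h x) (at x)"
proof -
  define a b where "a = x / 2" and "b = x + 1"
  have ab: "0 < a" "a < x" "x < b" using x by (auto simp: a_def b_def)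
  have si: "set_integrable lborel A h" if "A \<in> sets borel" for A
    using int that unfolding set_integrable_def by (intro integrable_mult_indicator) auto
  have eq: "lint h a + integral {a..y} h = lint h y" if "y \<in> {a<..<b}" for y
  proof -
    have "lint h y = (\<integral>t. indicator {..a} t * h t + indicator {a<..y} t * h t \<partial>lborel)"
      unfolding lint_def using that by (intro Bochner_Integration.integral_cong) (auto simp: indicator_def)
    also have "\<dots> = lint h a + (LINT t:{a<..y}|lborel. h t)"
      using si[of "{..a}"] si[of "{a<..y}"]
      by (simp add: lint_def set_lebesgue_integral_def set_integrable_def)
    also have "(LINT t:{a<..y}|lborel. h t) = (LINT t:{a..y}|lborel. h t)"
      unfolding set_lebesgue_integral_def
      by (intro integral_cong_AE AE_I'[of "{a}"])
        (use int in \<open>auto simp: null_sets_def indicator_def\<close>)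
    also have "\<dots> = integral {a..y} h" using si by (intro set_borel_integral_eq_integral) auto
    finally show ?thesis by simp
  qed
  have "((\<lambda>y. integral {a..y} h) has_real_derivative h x) (at x within {a..b})"
    by (rule integral_has_real_derivative) (use ab cont in \<open>auto intro: continuous_on_subset\<close>)
  then have "((\<lambda>y. integral {a..y} h) has_real_derivative h x) (at x)"
    using ab by (simp add: at_within_Icc_at)
  then have "((\<lambda>y. lint h a + integral {a..y} h) has_real_derivative h x) (at x)"
    by (auto intro!: derivative_eq_intros)
  then show ?thesis
    by (rule DERIV_cong_ev[THEN iffD1, rotated -1])
      (use ab eq in \<open>auto intro!: eventually_nhds_in_open[THEN eventually_mono, of "{a<..<b}"]\<close>)
qed

lemma lint_at_0:
  assumes int: "integrable lborel h" and zero: "\<And>x. x \<le> 0 \<Longrightarrow> h x = 0"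
  shows "(lint h \<longlongrightarrow> 0) (at_right 0)"
proof (rule tendsto_at_right_sequentially[of 0 1])
  fix S :: "nat \<Rightarrow> real" assume S: "\<And>n. 0 < S n" "S \<longlonglongrightarrow> 0"
  have "(\<lambda>n. lint h (S n)) \<longlonglongrightarrow> (\<integral>t. 0 \<partial>(lborel :: real measure))"
    unfolding lint_def
  proof (rule integral_dominated_convergence[where w = "\<lambda>x. \<bar>h x\<bar>"])
    show "AE t in lborel. (\<lambda>n. indicator {..S n} t * h t) \<longlonglongrightarrow> 0"
    proof (intro AE_I2)
      fix t :: real
      show "(\<lambda>n. indicator {..S n} t * h t) \<longlonglongrightarrow> 0"
      proof (cases "t > 0")
        case True
        have "\<forall>\<^sub>F n in sequentially. S n < t" using S(2) True by (auto simp: order_tendsto_iff)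
        then have "\<forall>\<^sub>F n in sequentially. indicator {..S n} t * h t = 0"
          by eventually_elim auto
        then show ?thesis by (rule tendsto_eventually)
      qed (simp add: zero)
    qed
  qed (use int in \<open>auto simp: indicator_def\<close>)
  then show "(\<lambda>n. lint h (S n)) \<longlonglongrightarrow> 0" by simp
qed simp

lemma lint_at_top:
  assumes int: "integrable lborel h"
  shows "(lint h \<longlongrightarrow> integral\<^sup>L lborel h) at_top"
  unfolding lint_def
proof (rule integral_dominated_convergence_at_top[where w = "\<lambda>x. \<bar>h x\<bar>"])
  show "AE t in lborel. ((\<lambda>x. indicator {..x} t * h t) \<longlongrightarrow> h t) at_top"
  proof (intro AE_I2)
    fix t :: real
    have "\<forall>\<^sub>F x in at_top. x \<ge> t" by (rule eventually_ge_at_top)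
    then have "\<forall>\<^sub>F x in at_top. indicator {..x} t * h t = h t"
      by eventually_elim auto
    then show "((\<lambda>x. indicator {..x} t * h t) \<longlongrightarrow> h t) at_top" by (rule tendsto_eventually)
  qed
qed (use int in \<open>auto simp: indicator_def\<close>)

lemma lint_mono:
  assumes "integrable lborel h" "integrable lborel k" "\<And>x. h x \<le> k x"
  shows "lint h x \<le> lint k x"
  unfolding lint_def
  by (intro integral_mono) (use assms in \<open>auto intro: integrable_real_mult_indicator simp: mult.commute
     intro!: mult_right_mono\<close>)

text \<open>The difference of the two sides is the integral of \<open>k - h\<close>, which is
  nonnegative, beyond \<open>x\<close>. Together with \<open>lint_mono\<close> this controls a
  primitive at both ends of the half line.\<close>

lemma lint_tail_mono:
  assumes "integrable lborel h" "integrable lborel k" "\<And>x. h x \<le> k x"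
  shows "integral\<^sup>L lborel h - lint h x \<le> integral\<^sup>L lborel k - lint k x"
proof -
  have "lint (\<lambda>x. k x - h x) x \<le> integral\<^sup>L lborel (\<lambda>x. k x - h x)"
    unfolding lint_def using integrable_real_mult_indicator[of "{..x}" lborel "\<lambda>x. k x - h x"] assms
    by (intro integral_mono) (auto simp: mult.commute split: split_indicator)
  moreover have "lint (\<lambda>x. k x - h x) x = lint k x - lint h x"
    unfolding lint_def
    using integrable_real_mult_indicator[OF _ assms(1), of "{..x}"] integrable_real_mult_indicator[OF _ assms(2), of "{..x}"]
    by (simp add: right_diff_distrib mult.commute)
  ultimately show ?thesis using assms by simp
qed

lemma lint_cmult: "lint (\<lambda>x. c * h x) x = c * lint h x"
  unfolding lint_def by (simp add: mult.left_commute)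

section \<open>The gamma density: derivative and boundary behaviour\<close>

lemma gdens_deriv:
  assumes "x > 0"
  shows "(gdens r has_real_derivative gdens r x * ((r - 1) / x - 1)) (at x)"
proof -
  have "((\<lambda>x. x powr (r - 1)) has_real_derivative (r - 1) * x powr (r - 1 - 1)) (at x)"
    using assms by (rule has_real_derivative_powr)
  moreover have "((\<lambda>x. exp (- x)) has_real_derivative - exp (- x)) (at x)"
    by (auto intro!: derivative_eq_intros)
  ultimately have "((\<lambda>x. x powr (r - 1) * exp (- x) / Gamma r) has_real_derivative
    ((r - 1) * x powr (r - 1 - 1) * exp (- x) + - exp (- x) * x powr (r - 1)) / Gamma r) (at x)"
    by (intro DERIV_cdivide DERIV_mult)
  moreover have "((r - 1) * x powr (r - 1 - 1) * exp (- x) + - exp (- x) * x powr (r - 1)) / Gamma r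
     = gdens r x * ((r - 1) / x - 1)"
  proof -
    have "(k * (p / x) * e + - e * p) / G = p * e / G * (k / x - 1)" for k p e G :: real
      by (simp add: algebra_simps diff_divide_distrib)
    moreover have "x powr (r - 1 - 1) = x powr (r - 1) / x" using assms by (subst powr_diff) simp
    ultimately show ?thesis using assms by (simp add: gdens_eq)
  qed
  ultimately have "((\<lambda>x. x powr (r - 1) * exp (- x) / Gamma r) has_real_derivative
    gdens r x * ((r - 1) / x - 1)) (at x)" by simp
  then show ?thesis
    by (rule DERIV_cong_ev[THEN iffD1, rotated -1])
      (use assms gdens_eq in \<open>auto intro!: eventually_nhds_in_open[THEN eventually_mono, of "{0<..}"]\<close>)
qed

lemma gdens_continuous: "continuous_on {0<..} (gdens r)"
  by (auto intro!: continuous_at_imp_continuous_on DERIV_isCont gdens_deriv)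

lemma gdens_at_top: "(gdens r \<longlongrightarrow> 0) at_top" "((\<lambda>x. x * gdens r x) \<longlongrightarrow> 0) at_top"
proof -
  have ev: "\<forall>\<^sub>F x in at_top. gdens r x = x powr (r - 1) * exp (- x) / Gamma r"
    using eventually_gt_at_top[of 0] by eventually_elim (rule gdens_eq)
  have "((\<lambda>x. x powr (r - 1) * exp (- x)) \<longlongrightarrow> 0) at_top"
    "((\<lambda>x. x * (x powr (r - 1) * exp (- x))) \<longlongrightarrow> 0) at_top"
    by (real_asymp, real_asymp)
  from this[THEN tendsto_divide_zero[where c = "Gamma r"]]
  have "((\<lambda>x. x powr (r - 1) * exp (- x) / Gamma r) \<longlongrightarrow> 0) at_top"
    "((\<lambda>x. x * (x powr (r - 1) * exp (- x) / Gamma r)) \<longlongrightarrow> 0) at_top"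
    by simp_all
  moreover have "\<forall>\<^sub>F x in at_top. x * gdens r x = x * (x powr (r - 1) * exp (- x) / Gamma r)"
    using ev by eventually_elim simp
  ultimately show "(gdens r \<longlongrightarrow> 0) at_top" "((\<lambda>x. x * gdens r x) \<longlongrightarrow> 0) at_top"
    using ev by (simp_all add: tendsto_cong)
qed

text \<open>The product behaves like \<open>x powr r\<close>. The factor \<open>x\<close> comes from
  the weight of the energy and tames the density, which is unbounded at 0 for
  \<open>r < 1\<close>.\<close>

lemma gdens_at_0:
  assumes "r > 0" shows "((\<lambda>x. x * gdens r x) \<longlongrightarrow> 0) (at_right 0)"
proof -
  have "((\<lambda>x. x powr r) \<longlongrightarrow> 0) (at_right 0)" using assms by real_asymp
  moreover have "((\<lambda>x::real. exp (- x)) \<longlongrightarrow> 1) (at_right 0)" by real_asymp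
  ultimately have "((\<lambda>x. x powr r * exp (- x) / Gamma r) \<longlongrightarrow> 0 * 1 / Gamma r) (at_right 0)"
    using Gamma_real_pos[OF assms] by (intro tendsto_intros) auto
  moreover have "\<forall>\<^sub>F x in at_right 0. x * gdens r x = x powr r * exp (- x) / Gamma r"
    using eventually_at_right_less[of 0]
    by eventually_elim (simp add: gdens_eq powr_diff)
  ultimately show ?thesis by (simp add: tendsto_cong)
qed

section \<open>Distribution function and tail of a gamma law\<close>

abbreviation gcdf :: "real \<Rightarrow> real \<Rightarrow> real" where "gcdf r \<equiv> lint (gdens r)"

lemma gcdf_deriv: "r > 0 \<Longrightarrow> x > 0 \<Longrightarrow> (gcdf r has_real_derivative gdens r x) (at x)"
  by (intro lint_deriv integrable_gdens gdens_continuous)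

lemma gcdf_at_0: "r > 0 \<Longrightarrow> (gcdf r \<longlongrightarrow> 0) (at_right 0)"
  by (intro lint_at_0 integrable_gdens gdens_zero)

lemma gcdf_at_top: "r > 0 \<Longrightarrow> (gcdf r \<longlongrightarrow> 1) at_top"
  using lint_at_top[OF integrable_gdens] by (simp add: integral_gdens)

lemma mono_limit_at_0:
  fixes F :: "real \<Rightarrow> real"
  assumes "\<And>x. x > 0 \<Longrightarrow> (F has_real_derivative F' x) (at x)"
    and "\<And>x. x > 0 \<Longrightarrow> F' x \<ge> 0" and "(F \<longlongrightarrow> l) (at_right 0)" and "x > 0"
  shows "l \<le> F x"
proof (rule tendsto_upperbound[OF assms(3)])
  show "\<forall>\<^sub>F y in at_right 0. F y \<le> F x"
  proof (rule eventually_mono[OF eventually_at_right_real[OF \<open>x > 0\<close>]])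
    fix y assume y: "y \<in> {0<..<x}"
    show "F y \<le> F x"
    proof (rule DERIV_nonneg_imp_nondecreasing[where f = F])
      show "y \<le> x" using y by simp
      fix z assume "y \<le> z"
      then show "\<exists>d. (F has_real_derivative d) (at z) \<and> d \<ge> 0" using assms(1,2)[of z] y by auto
    qed
  qed
qed simp

lemma mono_limit_at_top:
  fixes F :: "real \<Rightarrow> real"
  assumes "\<And>y. y \<ge> x \<Longrightarrow> (F has_real_derivative F' y) (at y)"
    and "\<And>y. y \<ge> x \<Longrightarrow> F' y \<le> 0" and "(F \<longlongrightarrow> l) at_top"
  shows "l \<le> F x"
proof (rule tendsto_upperbound[OF assms(3)])
  show "\<forall>\<^sub>F y in at_top. F y \<le> F x"
  proof (rule eventually_mono[OF eventually_ge_at_top[of x]])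
    fix y assume "x \<le> y"
    then show "F y \<le> F x"
    proof (rule DERIV_nonpos_imp_nonincreasing[where f = F])
      fix z assume "x \<le> z"
      then show "\<exists>d. (F has_real_derivative d) (at z) \<and> d \<le> 0" using assms(1,2)[of z] by blast
    qed
  qed
qed simp

lemma gcdf_strict_mono:
  assumes "r > 0" "0 < x" "x < y" shows "gcdf r x < gcdf r y"
proof (rule DERIV_pos_imp_increasing[OF \<open>x < y\<close>])
  fix z assume "x \<le> z" "z \<le> y"
  then show "\<exists>d. (gcdf r has_real_derivative d) (at z) \<and> 0 < d"
    using gcdf_deriv[of r z] gdens_pos[of r z] assms by (intro exI[of _ "gdens r z"]) auto
qed

text \<open>Strict growth on the positive half line gives strictness here. It keeps the tail
  positive, so that its logarithm is meaningful.\<close>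

lemma gcdf_less_1: assumes "r > 0" shows "gcdf r x < 1"
proof -
  have "gcdf r y < gcdf r (y + 1)" if "y > 0" for y
    using assms that by (intro gcdf_strict_mono) auto
  moreover have le: "gcdf r y \<le> 1" for y
    using lint_tail_mono[of "\<lambda>_. 0" "gdens r" y] assms integrable_gdens gdens_nonneg
    by (simp add: integral_gdens lint_def)
  moreover have "gcdf r x \<le> gcdf r (max x 1)"
    unfolding lint_def using integrable_gdens[OF assms] gdens_nonneg[OF assms]
    by (intro integral_mono) (auto intro: integrable_real_mult_indicator simp: mult.commute split: split_indicator)
  ultimately show ?thesis by (smt (verit) max_def)
qed

lemma gcdf_pos: assumes "r > 0" "x > 0" shows "gcdf r x > 0"
proof -
  have "gcdf r (x/2) < gcdf r x"
    using assms by (intro gcdf_strict_mono) auto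
  moreover have "gcdf r (x/2) \<ge> 0"
    unfolding lint_def using gdens_nonneg[OF assms(1)] by (intro Bochner_Integration.integral_nonneg) auto
  ultimately show ?thesis by simp
qed

text \<open>Estimating \<open>exp (- x)\<close> by 1 in the density leaves a power with an explicit
  primitive. The difference of both sides is monotone and tends to 0 at 0.\<close>

lemma gcdf_upper:
  assumes "r > 0" "x > 0"
  shows "gcdf r x \<le> x powr r / (r * Gamma r)"
proof -
  have "0 \<le> x powr r / (r * Gamma r) - gcdf r x"
  proof (rule mono_limit_at_0[where F = "\<lambda>x. x powr r / (r * Gamma r) - gcdf r x" and F' = "\<lambda>x. x powr (r - 1) / Gamma r - gdens r x"])
    have "((\<lambda>x. x powr r) \<longlongrightarrow> 0) (at_right 0)" using assms by real_asymp
    from tendsto_divide_zero[OF this]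
    have "((\<lambda>x. x powr r / (r * Gamma r)) \<longlongrightarrow> 0) (at_right 0)" .
    then show "((\<lambda>x. x powr r / (r * Gamma r) - gcdf r x) \<longlongrightarrow> 0) (at_right 0)"
      using tendsto_diff gcdf_at_0[OF assms(1)] by fastforce
    show "((\<lambda>x. x powr r / (r * Gamma r) - gcdf r x) has_real_derivative
       x powr (r - 1) / Gamma r - gdens r x) (at x)" if "x > 0" for x
    proof -
      from has_real_derivative_powr[OF that, of r]
      have "((\<lambda>x. x powr r / (r * Gamma r)) has_real_derivative r * x powr (r - 1) / (r * Gamma r)) (at x)"
        by (rule DERIV_cdivide)
      with gcdf_deriv[OF assms(1) that] show ?thesis using assms by (auto intro: DERIV_diff)
    qed
    show "x powr (r - 1) / Gamma r - gdens r x \<ge> 0" if "x > 0" for x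
      using that assms by (auto simp: gdens_eq intro!: divide_right_mono mult_left_le)
  qed (rule assms)
  then show ?thesis by simp
qed

text \<open>The logarithmic derivative of the density is \<open>(r - 1) / y - 1\<close>, so the
  hypothesis on \<open>c\<close> says that \<open>c * gdens r y + gcdf r y\<close> decreases for
  \<open>y \<ge> x\<close>. Its limit at infinity is 1.\<close>

lemma gamma_tail_le:
  assumes r: "r > 0" and x: "x > 0"
    and c: "\<And>y. y \<ge> x \<Longrightarrow> c * (1 - (r - 1) / y) \<ge> 1"
  shows "1 - gcdf r x \<le> c * gdens r x"
proof -
  have "1 \<le> c * gdens r x + gcdf r x"
  proof (rule mono_limit_at_top[where F = "\<lambda>x. c * gdens r x + gcdf r x" and F' = "\<lambda>x. c * (gdens r x * ((r - 1) / x - 1)) + gdens r x"])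
    show "c * (gdens r y * ((r - 1) / y - 1)) + gdens r y \<le> 0" if "y \<ge> x" for y
    proof -
      have "gdens r y * 1 \<le> gdens r y * (c * (1 - (r - 1) / y))"
        using c[OF that] gdens_nonneg[OF r] by (intro mult_left_mono)
      then show ?thesis by (simp add: algebra_simps)
    qed
    show "((\<lambda>x. c * gdens r x + gcdf r x) \<longlongrightarrow> 1) at_top"
      using tendsto_add[OF tendsto_mult_left[OF gdens_at_top(1), of c] gcdf_at_top[OF r]] by simp
  qed (use r x in \<open>auto intro!: derivative_eq_intros gcdf_deriv gdens_deriv\<close>)
  then show ?thesis by simp
qed

lemma gamma_tail_le_small: "0 < r \<Longrightarrow> r \<le> 1 \<Longrightarrow> x > 0 \<Longrightarrow> 1 - gcdf r x \<le> gdens r x"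
  using gamma_tail_le[of r x 1] by (simp add: divide_nonpos_pos)

text \<open>Beyond \<open>2 * r\<close> the quotient \<open>(r - 1) / y\<close> is at most 1/2,
  which the constant 2 absorbs.\<close>

lemma gamma_tail_le_large: "0 < r \<Longrightarrow> x \<ge> 2 * r \<Longrightarrow> 1 - gcdf r x \<le> 2 * gdens r x"
proof (rule gamma_tail_le)
  show "1 \<le> 2 * (1 - (r - 1) / y)" if "0 < r" "x \<ge> 2 * r" "x \<le> y" for y
    using that by (simp add: field_simps)
qed auto

text \<open>A lower bound of Mills ratio type. With the factor \<open>x / (x + 1)\<close> the
  difference of both sides is decreasing with limit 0 at infinity; for \<open>x \<ge> 1\<close>, the
  range in which the bound will be applied, this factor is at least 1/2.\<close>

lemma gamma_tail_ge:
  assumes r: "0 < r" "r \<le> 1" and x: "x > 0"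
  shows "gdens r x * (x / (x + 1)) \<le> 1 - gcdf r x"
proof -
  have "0 \<le> 1 - gdens r x * (x / (x + 1)) - gcdf r x"
  proof (rule mono_limit_at_top[where F = "\<lambda>x. 1 - gdens r x * (x / (x + 1)) - gcdf r x"
      and F' = "\<lambda>y. - gdens r y * (r / (y + 1) + 1 / (y + 1)\<^sup>2)"])
    show "((\<lambda>x. 1 - gdens r x * (x / (x + 1)) - gcdf r x) has_real_derivative
       - gdens r y * (r / (y + 1) + 1 / (y + 1)\<^sup>2)) (at y)" if "y \<ge> x" for y
    proof -
      have y: "y > 0" using that x by simp
      have alg: "- (g * p * q + g * s) - g = - g * (p * q + s + 1)" for g p q s :: real
        by (simp add: algebra_simps)
      have "((\<lambda>x::real. x / (x + 1)) has_real_derivative (y + 1 - y) / (y + 1)\<^sup>2) (at y)"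
        using y by (auto intro!: derivative_eq_intros simp: power2_eq_square)
      from DERIV_diff[OF DERIV_diff[OF DERIV_const DERIV_mult[OF gdens_deriv[OF y] this]] gcdf_deriv[OF r(1) y]]
      have "((\<lambda>x. 1 - gdens r x * (x / (x + 1)) - gcdf r x) has_real_derivative
        - (gdens r y * ((r - 1) / y - 1) * (y / (y + 1)) + gdens r y * ((y + 1 - y) / (y + 1)\<^sup>2)) - gdens r y) (at y)"
        by (simp add: algebra_simps)
      moreover have "- (gdens r y * ((r - 1) / y - 1) * (y / (y + 1)) + gdens r y * ((y + 1 - y) / (y + 1)\<^sup>2)) - gdens r y
          = - gdens r y * (((r - 1) / y - 1) * (y / (y + 1)) + (y + 1 - y) / (y + 1)\<^sup>2 + 1)"
        by (rule alg)
      moreover have "((r - 1) / y - 1) * (y / (y + 1)) + (y + 1 - y) / (y + 1)\<^sup>2 + 1 = r / (y + 1) + 1 / (y + 1)\<^sup>2"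
      proof -
        have "(r - 1) / y - 1 = (r - 1 - y) / y" using y by (simp add: diff_divide_distrib)
        then have h1: "((r - 1) / y - 1) * (y / (y + 1)) = (r - 1 - y) / (y + 1)" using y by simp
        have h2: "(r - 1 - y) / (y + 1) + 1 = r / (y + 1)" using y by (simp add: field_simps)
        show ?thesis unfolding h1 using h2 by simp
      qed
      ultimately show ?thesis by (simp only:)
    qed
    show "- gdens r y * (r / (y + 1) + 1 / (y + 1)\<^sup>2) \<le> 0" if "y \<ge> x" for y
      using r x that gdens_nonneg[of r y] by simp
    have "((\<lambda>x::real. x / (x + 1)) \<longlongrightarrow> 1) at_top" by real_asymp
    from tendsto_diff[OF tendsto_diff[OF tendsto_const tendsto_mult[OF gdens_at_top(1)[of r] this]]
        gcdf_at_top[OF r(1)], of 1]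
    show "((\<lambda>x. 1 - gdens r x * (x / (x + 1)) - gcdf r x) \<longlongrightarrow> 0) at_top" by simp
  qed
  then show ?thesis by simp
qed

text \<open>The logarithm of \<open>Gamma\<close> is convex and vanishes at 1 and at 2, hence is
  nonpositive at \<open>1 + r\<close>.\<close>

lemma Gamma_le_inverse:
  fixes r :: real
  assumes "0 < r" "r \<le> 1" shows "Gamma r \<le> 1 / r"
proof -
  have "(ln \<circ> Gamma) ((1 - r) *\<^sub>R 1 + r *\<^sub>R 2) \<le> (1 - r) * (ln \<circ> Gamma) 1 + r * (ln \<circ> Gamma) (2::real)"
    using assms by (intro convex_onD[OF log_convex_Gamma_real]) auto
  moreover have "Gamma (2::real) = 1" using Gamma_fact[of 1, where 'a=real] by simp
  ultimately have "ln (Gamma (1 + r)) \<le> 0" by (simp add: add.commute)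
  then have "Gamma (1 + r) \<le> 1" using assms by (simp add: ln_le_zero_iff)
  moreover have "Gamma (1 + r) = r * Gamma r"
    using assms Gamma_plus1[of r] by (auto simp: nonpos_Ints_def add.commute)
  ultimately show ?thesis using assms by (simp add: field_simps)
qed

text \<open>The function \<open>Y = - ln s\<close> is the coordinate in which the gamma law becomes
  the exponential law, and the left side equals \<open>Y / Y'^2\<close>: it is the weight
  \<open>y\<close> of the energy of the exponential law, pulled back along \<open>Y\<close>. The
  claim is that this weight is dominated by \<open>4 / r\<close> times the weight \<open>x\<close>.
  For \<open>x \<le> 1\<close> the bound \<open>- ln s * s \<le> gcdf r x\<close> compensates the
  factor \<open>1 / gdens r x\<close>, leaving \<open>x * exp x / r\<close>; for larger
  \<open>x\<close> the quotient \<open>s / gdens r x\<close> is at most 1 and \<open>- ln s\<close>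
  grows linearly.\<close>

lemma gamma_tail_entropy_bound:
  assumes r: "0 < r" "r \<le> 1" and x: "x > 0"
  defines "s \<equiv> 1 - gcdf r x"
  shows "- ln s * (s / gdens r x)\<^sup>2 \<le> 4 / r * x"
proof -
  let ?\<rho> = "gdens r x"
  have s: "0 < s" "s < 1" using gcdf_less_1[OF r(1), of x] gcdf_pos[OF r(1) x] by (auto simp: s_def)
  have \<rho>: "?\<rho> > 0" using gdens_pos r x by auto
  have s\<rho>: "s / ?\<rho> \<le> 1" using gamma_tail_le_small[OF r x] \<rho> by (simp add: s_def)
  have ls: "- ln s \<ge> 0" using s by simp
  show ?thesis
  proof (cases "x \<le> 1")
    case True
    have "ln (1 / s) \<le> 1 / s - 1" using s by (intro ln_le_minus_one) auto
    then have "- ln s * s \<le> (1 / s - 1) * s" using s by (intro mult_right_mono) (auto simp: ln_div)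
    also have "\<dots> = gcdf r x" using s by (simp add: field_simps s_def)
    also have "\<dots> \<le> x powr r / (r * Gamma r)" by (rule gcdf_upper[OF r(1) x])
    finally have 1: "- ln s * s \<le> x powr r / (r * Gamma r)" .
    have "- ln s * (s / ?\<rho>)\<^sup>2 = (- ln s * s) * (s / ?\<rho>) * (1 / ?\<rho>)"
      by (simp add: power2_eq_square)
    also have "\<dots> \<le> (- ln s * s) * 1 * (1 / ?\<rho>)"
      using s \<rho> s\<rho> mult_nonneg_nonneg[OF ls, of s] by (intro mult_right_mono mult_left_mono) auto
    also have "\<dots> \<le> x powr r / (r * Gamma r) * (1 / ?\<rho>)"
      using 1 \<rho> by (intro mult_right_mono) auto
    also have "\<dots> = x * exp x / r"
      using x r Gamma_real_pos[OF r(1), THEN less_imp_neq, symmetric]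
      by (simp add: gdens_eq powr_diff exp_minus divide_simps del: Gamma_real_pos)
    also have "\<dots> \<le> x * 4 / r"
    proof -
      have "exp x \<le> exp 1" using True by simp
      also have "\<dots> \<le> (4::real)" using exp_le by linarith
      finally show ?thesis using r x by (intro divide_right_mono mult_left_mono) auto
    qed
    finally show ?thesis by (simp add: mult.commute)
  next
    case False
    \<comment> \<open>Here \<open>x > 1\<close>, so \<open>x / (x + 1)\<close> is at least 1/2.
      Replacing \<open>s\<close> by half the density makes the logarithm explicit.\<close>
    have "s \<ge> ?\<rho> / 2"
    proof -
      have "?\<rho> * (1/2) \<le> ?\<rho> * (x / (x + 1))"
        using \<rho> False by (intro mult_left_mono) (auto simp: field_simps)
      then show ?thesis using gamma_tail_ge[OF r x] unfolding s_def by linarith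
    qed
    then have "ln s \<ge> ln (?\<rho> / 2)" using \<rho> s by simp
    moreover have "ln (?\<rho> / 2) = (r - 1) * ln x - x - ln (Gamma r) - ln 2"
      using x r Gamma_real_pos[OF r(1), THEN less_imp_neq, symmetric]
      by (simp add: gdens_eq ln_div ln_mult ln_powr del: Gamma_real_pos)
    moreover have "ln (Gamma r) \<le> 1 / r - 1"
    proof -
      have "ln (Gamma r) \<le> ln (1 / r)" using Gamma_le_inverse[OF r] r by simp
      also have "\<dots> \<le> 1 / r - 1" using r by (intro ln_le_minus_one) auto
      finally show ?thesis .
    qed
    moreover have "ln (2::real) \<le> 1" using ln_le_minus_one[of "2::real"] by simp
    moreover have "(1 - r) * ln x \<le> x - 1"
    proof -
      have "(1 - r) * ln x \<le> 1 * ln x" using r False by (intro mult_right_mono) auto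
      also have "\<dots> \<le> x - 1" using ln_le_minus_one[of x] x by simp
      finally show ?thesis .
    qed
    ultimately have "- ln s \<le> 2 * x + 1 / r" by (simp add: algebra_simps)
    also have "\<dots> \<le> 4 / r * x"
    proof -
      have "2 * x * 1 \<le> 2 * x * (1 / r)" using r x by (intro mult_left_mono) auto
      moreover have "1 * (1 / r) \<le> 2 * x * (1 / r)" using r False by (intro mult_right_mono) auto
      ultimately have "2 * x + 1 / r \<le> 2 * x * (1 / r) + 2 * x * (1 / r)" by simp
      also have "\<dots> = 4 / r * x" using r by (simp add: field_simps)
      finally show ?thesis .
    qed
    finally have "- ln s \<le> 4 / r * x" .
    moreover have "- ln s * (s / ?\<rho>)\<^sup>2 \<le> - ln s * 1"
      using ls s \<rho> s\<rho> by (intro mult_left_mono) (auto intro: power_le_one)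
    ultimately show ?thesis by simp
  qed
qed

lemma measurable_gamma_law: "borel_measurable (gamma_law r) = borel_measurable borel"
  by (rule measurable_cong_sets) simp_all

section \<open>Inequalities for one gamma law\<close>

text \<open>Since \<open>x * gdens r x\<close> has derivative \<open>(r - x) * gdens r x\<close>,
  the two integrands add up to the derivative of \<open>v * u * (x * gdens r x)\<close>, and
  boundedness of \<open>u\<close> and \<open>v\<close> removes the boundary terms. When
  \<open>u\<close> is itself a derivative, the second factor on the right is the Laguerre
  operator.\<close>

lemma gamma_ibp:
  fixes u u' v v' :: "real \<Rightarrow> real"
  assumes r: "r \<ge> 0"
    and [measurable]: "u \<in> borel_measurable borel" "u' \<in> borel_measurable borel"
      "v \<in> borel_measurable borel" "v' \<in> borel_measurable borel"
    and bound: "\<And>x. \<bar>u x\<bar> \<le> K" "\<And>x. \<bar>u' x\<bar> \<le> K" "\<And>x. \<bar>v x\<bar> \<le> K" "\<And>x. \<bar>v' x\<bar> \<le> K"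
    and deriv: "\<And>x. x > 0 \<Longrightarrow> (u has_real_derivative u' x) (at x)"
      "\<And>x. x > 0 \<Longrightarrow> (v has_real_derivative v' x) (at x)"
  shows "(\<integral>x. x * u x * v' x \<partial>gamma_law r) = - (\<integral>x. v x * (x * u' x + (r - x) * u x) \<partial>gamma_law r)"
proof (cases "r = 0")
  \<comment> \<open>The law is the atom at 0, where the weight \<open>x\<close> and the drift
    \<open>r - x\<close> both vanish.\<close>
  case True then show ?thesis by (simp add: integral_gamma_law_0)
next
  case False
  then have r: "r > 0" using assms by simp
  have K: "K \<ge> 0" using bound(1)[of 0] by linarith
  interpret prob_space "gamma_law r" using r by (intro prob_space_gamma_law) simp
  have bnd2: "\<bar>p x * q x\<bar> \<le> K * K" if "\<And>x. \<bar>p x\<bar> \<le> K" "\<And>x. \<bar>q x\<bar> \<le> K" for p q :: "real \<Rightarrow> real" and x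
    using that K by (auto simp: abs_mult intro!: mult_mono)
  have I1: "integrable (gamma_law r) (\<lambda>x. p x * q x)"
    if "p \<in> borel_measurable borel" "q \<in> borel_measurable borel"
      "\<And>x. \<bar>p x\<bar> \<le> K" "\<And>x. \<bar>q x\<bar> \<le> K" for p q :: "real \<Rightarrow> real"
    using that bnd2[of p q] by (intro integrable_const_bound[of _ "K * K"]) (auto simp: measurable_gamma_law)
  have I2: "integrable (gamma_law r) (\<lambda>x. x * (p x * q x))"
    if [measurable]: "p \<in> borel_measurable borel" "q \<in> borel_measurable borel"
      and b: "\<And>x. \<bar>p x\<bar> \<le> K" "\<And>x. \<bar>q x\<bar> \<le> K" for p q :: "real \<Rightarrow> real"
  proof (rule Bochner_Integration.integrable_bound)
    show "integrable (gamma_law r) (\<lambda>x. K * K * x)"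
      using gamma_law_moments(1)[of r] r by auto
    have "\<bar>x\<bar> * \<bar>p x * q x\<bar> \<le> \<bar>x\<bar> * (K * K)" for x
      using bnd2[OF b] by (intro mult_left_mono) auto
    then show "AE x in gamma_law r. norm (x * (p x * q x)) \<le> norm (K * K * x)"
      using K by (auto simp: abs_mult mult.commute)
  qed auto
  let ?R = "\<lambda>x. v x * (x * u' x + (r - x) * u x)" and ?L = "\<lambda>x. x * u x * v' x"
  have IL: "integrable (gamma_law r) ?L"
    using I2[of u v'] bound by (simp add: mult.assoc)
  have IR: "integrable (gamma_law r) ?R"
  proof -
    have "?R = (\<lambda>x. x * (v x * u' x) + r * (v x * u x) - x * (v x * u x))" by (auto simp: algebra_simps)
    then show ?thesis using I2[of v u'] I2[of v u] I1[of v u] bound by simp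
  qed
  have "(\<integral>x. gdens r x * (?L x + ?R x) \<partial>lborel) = 0"
  proof (rule integral_eq_0_if_eq_deriv[where Q = "\<lambda>x. v x * u x * (x * gdens r x)"])
    show "integrable lborel (\<lambda>x. gdens r x * (?L x + ?R x))"
      using IL IR r by (subst integrable_gamma_law[symmetric]) auto
    show "((\<lambda>x. v x * u x * (x * gdens r x)) has_real_derivative gdens r x * (?L x + ?R x)) (at x)" if x: "x > 0" for x
    proof -
      have "((\<lambda>x. v x * u x * (x * gdens r x)) has_real_derivative
         (v' x * u x + u' x * v x) * (x * gdens r x) + (1 * gdens r x + gdens r x * ((r - 1) / x - 1) * x) * (v x * u x)) (at x)"
        by (intro DERIV_mult deriv gdens_deriv DERIV_ident x)
      moreover have "gdens r x * ((r - 1) / x - 1) * x = gdens r x * (r - 1 - x)"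
        using x by (simp add: field_simps)
      then have "(v' x * u x + u' x * v x) * (x * gdens r x)
          + (1 * gdens r x + gdens r x * ((r - 1) / x - 1) * x) * (v x * u x) = gdens r x * (?L x + ?R x)"
        by (simp only:) (simp add: algebra_simps)
      ultimately show ?thesis by (simp only:)
    qed
    have lim: "((\<lambda>x. v x * u x * (x * gdens r x)) \<longlongrightarrow> 0) F"
      if "((\<lambda>x. x * gdens r x) \<longlongrightarrow> 0) F" for F
    proof (rule Lim_null_comparison[where g = "\<lambda>x. K * K * \<bar>x * gdens r x\<bar>"])
      show "\<forall>\<^sub>F x in F. norm (v x * u x * (x * gdens r x)) \<le> K * K * \<bar>x * gdens r x\<bar>"
      proof (intro always_eventually allI)
        fix x
        show "norm (v x * u x * (x * gdens r x)) \<le> K * K * \<bar>x * gdens r x\<bar>"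
          using mult_right_mono[OF bnd2[OF bound(3,1)], where c = "\<bar>x * gdens r x\<bar>"] by (simp add: abs_mult)
      qed
      show "((\<lambda>x. K * K * \<bar>x * gdens r x\<bar>) \<longlongrightarrow> 0) F"
        using that by (auto intro!: tendsto_mult_right_zero tendsto_rabs_zero)
    qed
    show "((\<lambda>x. v x * u x * (x * gdens r x)) \<longlongrightarrow> 0) (at_right 0)" "((\<lambda>x. v x * u x * (x * gdens r x)) \<longlongrightarrow> 0) at_top"
      using lim gdens_at_0[OF r] gdens_at_top by auto
  qed (simp add: gdens_zero)
  then have "(\<integral>x. ?L x + ?R x \<partial>gamma_law r) = 0" using r by (subst integral_gamma_law) auto
  then show ?thesis using IL IR by simp
qed

text \<open>This is the Bakry-Emery argument in pointwise form. Write \<open>\<rho>\<close> for the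
  density, \<open>q = f - m\<close>, and \<open>w\<close> for the primitive of
  \<open>\<rho> * q\<close>. Then \<open>h' = - w / (x * \<rho>)\<close> is the derivative of a
  solution of the Poisson equation \<open>x * h'' + (r - x) * h' = - q\<close>. The two squares
  separating \<open>Q'\<close> from the integrand are \<open>x * \<rho> * (f' - h')^2\<close> and
  \<open>x^2 * \<rho> * h''^2\<close>. Neither involves \<open>r\<close>, which is why the constant
  is 1 for every gamma law.\<close>

lemma gamma_poincare:
  fixes f f' :: "real \<Rightarrow> real"
  assumes r: "r \<ge> 0"
    and [measurable]: "f \<in> borel_measurable borel" "f' \<in> borel_measurable borel"
    and bound: "\<And>x. \<bar>f x\<bar> \<le> K" "\<And>x. \<bar>f' x\<bar> \<le> K"
    and deriv: "\<And>x. x > 0 \<Longrightarrow> (f has_real_derivative f' x) (at x)"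
  shows "(\<integral>x. (f x)\<^sup>2 \<partial>gamma_law r) - (\<integral>x. f x \<partial>gamma_law r)\<^sup>2 \<le> (\<integral>x. x * (f' x)\<^sup>2 \<partial>gamma_law r)"
proof (cases "r = 0")
  case True then show ?thesis by (simp add: integral_gamma_law_0)
next
  case False
  then have r: "r > 0" using assms by simp
  have K: "K \<ge> 0" using bound(1)[of 0] by linarith
  interpret prob_space "gamma_law r" using r by (intro prob_space_gamma_law) simp
  define m where "m = (\<integral>x. f x \<partial>gamma_law r)"
  define q where "q x = f x - m" for x
  define K2 where "K2 = K + \<bar>m\<bar>"
  have q: "\<bar>q x\<bar> \<le> K2" for x using bound(1)[of x] by (auto simp: q_def K2_def)
  have K2: "K2 \<ge> 0" using K by (simp add: K2_def)
  have [measurable]: "q \<in> borel_measurable borel" unfolding q_def by measurable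
  have f2: "(f x)\<^sup>2 \<le> K\<^sup>2" for x
    using power_mono[OF bound(1)[of x], of 2] by simp
  have intf: "integrable (gamma_law r) f" "integrable (gamma_law r) (\<lambda>x. (f x)\<^sup>2)"
    using bound f2
    by (auto intro!: integrable_const_bound[of f K] integrable_const_bound[of "\<lambda>x. (f x)\<^sup>2" "K\<^sup>2"]
        simp: measurable_gamma_law)
  have intq: "integrable (gamma_law r) q" "(\<integral>x. q x \<partial>gamma_law r) = 0"
     "integrable (gamma_law r) (\<lambda>x. (q x)\<^sup>2)" "(\<integral>x. (q x)\<^sup>2 \<partial>gamma_law r) = (\<integral>x. (f x)\<^sup>2 \<partial>gamma_law r) - m\<^sup>2"
  proof -
    have P1: "measure (gamma_law r) UNIV = 1" using prob_space by simp
    have eq: "q = (\<lambda>x. f x - m)" "(\<lambda>x. (q x)\<^sup>2) = (\<lambda>x. (f x)\<^sup>2 - 2 * m * f x + m\<^sup>2)"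
      by (auto simp: q_def power2_eq_square algebra_simps diff_divide_distrib add_divide_distrib)
    show "integrable (gamma_law r) q" "(\<integral>x. q x \<partial>gamma_law r) = 0"
      unfolding eq(1) using intf P1 by (auto simp: m_def[symmetric])
    show "integrable (gamma_law r) (\<lambda>x. (q x)\<^sup>2)"
      by (subst eq(2)) (use intf in auto)
    show "(\<integral>x. (q x)\<^sup>2 \<partial>gamma_law r) = (\<integral>x. (f x)\<^sup>2 \<partial>gamma_law r) - m\<^sup>2"
      by (subst eq(2)) (use intf P1 in \<open>simp add: m_def[symmetric] power2_eq_square\<close>)
  qed
  have inte: "integrable (gamma_law r) (\<lambda>x. x * (f' x)\<^sup>2)"
  proof (rule Bochner_Integration.integrable_bound)
    show "integrable (gamma_law r) (\<lambda>x. K\<^sup>2 * x)" using gamma_law_moments(1)[of r] r by auto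
    have "\<bar>x\<bar> * (f' x)\<^sup>2 \<le> \<bar>x\<bar> * K\<^sup>2" for x
      using power_mono[OF bound(2)[of x], of 2] by (intro mult_left_mono) auto
    then show "AE x in gamma_law r. norm (x * (f' x)\<^sup>2) \<le> norm (K\<^sup>2 * x)"
      by (auto simp: abs_mult mult.commute)
  qed auto
  define h where "h x = gdens r x * q x" for x
  have inth: "integrable lborel h" "integral\<^sup>L lborel h = 0"
    using intq r unfolding h_def by (auto simp: integrable_gamma_law integral_gamma_law)
  define w where "w = lint h"
  have habs: "h x \<le> K2 * gdens r x" "- (K2 * gdens r x) \<le> h x" for x
    using q[of x] gdens_nonneg[OF r, of x] mult_left_mono[of "q x" K2 "gdens r x"] mult_left_mono[of "- q x" K2 "gdens r x"]
    by (auto simp: h_def abs_le_iff mult.commute)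
  have igd: "integrable lborel (\<lambda>x. c * gdens r x)" for c using integrable_gdens[OF r] by simp
  have w1: "\<bar>w x\<bar> \<le> K2 * gcdf r x" for x
    using lint_mono[OF inth(1) igd habs(1), of x] lint_mono[OF igd inth(1), of "-K2" x] habs(2)
    unfolding w_def by (auto simp: lint_cmult abs_le_iff lint_cmult[of "-K2", simplified])
  \<comment> \<open>As \<open>h\<close> has integral 0, \<open>- w x\<close> is also its integral
    over the tail. This gives decay at infinity, which the bound by \<open>gcdf\<close> cannot
    give.\<close>
  have w2: "\<bar>w x\<bar> \<le> K2 * (1 - gcdf r x)" for x
    using lint_tail_mono[OF inth(1) igd habs(1), of x] lint_tail_mono[OF igd inth(1), of "-K2" x] habs(2)
    unfolding w_def by (auto simp: lint_cmult abs_le_iff inth integral_gdens[OF r] algebra_simps lint_cmult[of "-K2", simplified])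
  have cont: "continuous_on {0<..} f" by (auto intro!: continuous_at_imp_continuous_on DERIV_isCont deriv)
  have wd: "(w has_real_derivative gdens r x * q x) (at x)" if "x > 0" for x
  proof -
    have "continuous_on {0<..} h"
      unfolding h_def q_def by (intro continuous_intros cont gdens_continuous)
    from lint_deriv[OF inth(1) this that] show ?thesis by (simp add: w_def h_def)
  qed
  \<comment> \<open>This is \<open>1 / (x * gdens r x)\<close> for positive \<open>x\<close>,
    spelled out so that it can be differentiated directly.\<close>
  define z where "z x = Gamma r * (x powr (- r) * exp x)" for x
  have zpos: "z x > 0" if "x > 0" for x using that r by (simp add: z_def)
  have \<rho>z: "gdens r x * z x = 1 / x" if "x > 0" for x
    using that r Gamma_real_pos[OF r, THEN less_imp_neq, symmetric]
    by (simp add: z_def gdens_eq exp_minus powr_diff powr_minus field_simps del: Gamma_real_pos)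
  have zd: "(z has_real_derivative z x * (1 - r / x)) (at x)" if "x > 0" for x
  proof -
    have "(z has_real_derivative Gamma r * ((- r) * x powr (- r - 1) * exp x + exp x * x powr (- r))) (at x)"
      unfolding z_def by (intro DERIV_cmult DERIV_mult has_real_derivative_powr that DERIV_exp)
    moreover have "x powr (- r - 1) = x powr (- r) / x" using that by (subst powr_diff) simp
    ultimately show ?thesis by (simp add: z_def algebra_simps)
  qed
  define Q where "Q x = 2 * q x * w x - (r - x) * ((w x)\<^sup>2 * z x)" for x
  define Q' where "Q' x = 2 * f' x * w x + 2 * q x * (gdens r x * q x)
      + (w x)\<^sup>2 * z x - (r - x) * (2 * w x * (gdens r x * q x) * z x + (w x)\<^sup>2 * (z x * (1 - r / x)))" for x
  have "(\<integral>x. gdens r x * ((q x)\<^sup>2 - x * (f' x)\<^sup>2) \<partial>lborel) \<le> 0"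
  proof (rule integral_le_0_if_le_deriv[where Q = Q and Q' = Q'])
    show "integrable lborel (\<lambda>x. gdens r x * ((q x)\<^sup>2 - x * (f' x)\<^sup>2))"
      using intq(3) inte r by (subst integrable_gamma_law[symmetric]) auto
    show "(Q has_real_derivative Q' x) (at x)" if "x > 0" for x
    proof -
      have qd: "(q has_real_derivative f' x) (at x)"
        unfolding q_def using deriv[OF that] by (auto intro!: derivative_eq_intros)
      have w2d: "((\<lambda>x. (w x)\<^sup>2) has_real_derivative 2 * w x * (gdens r x * q x)) (at x)"
        using wd[OF that] by (auto intro!: derivative_eq_intros)
      have rd: "((\<lambda>x. r - x) has_real_derivative - 1) (at x)"
        by (auto intro!: derivative_eq_intros)
      have "(Q has_real_derivative (2 * f' x * w x + gdens r x * q x * (2 * q x))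
         - (- 1 * ((w x)\<^sup>2 * z x) + (2 * w x * (gdens r x * q x) * z x + z x * (1 - r / x) * (w x)\<^sup>2) * (r - x))) (at x)"
        unfolding Q_def by (intro DERIV_diff DERIV_mult DERIV_cmult qd w2d wd zd rd that)
      moreover have "(2 * f' x * w x + gdens r x * q x * (2 * q x))
         - (- 1 * ((w x)\<^sup>2 * z x) + (2 * w x * (gdens r x * q x) * z x + z x * (1 - r / x) * (w x)\<^sup>2) * (r - x)) = Q' x"
        unfolding Q'_def by (simp only: ring_distribs mult_ac add_ac mult_1_left mult_minus_left)
      ultimately show ?thesis by (simp only:)
    qed
    show "gdens r x * ((q x)\<^sup>2 - x * (f' x)\<^sup>2) \<le> Q' x" if x: "x > 0" for x
    proof -
      define \<rho> where "\<rho> = gdens r x"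
      have zp: "z x = 1 / (x * \<rho>)" and \<rho>0: "\<rho> > 0"
        using \<rho>z[OF x] gdens_pos[OF r x] x by (auto simp: \<rho>_def field_simps)
      have "Q' x - \<rho> * ((q x)\<^sup>2 - x * (f' x)\<^sup>2) =
         (\<rho> * x * f' x + w x)\<^sup>2 / (x * \<rho>) + (\<rho> * x * q x - (r - x) * w x)\<^sup>2 / (x\<^sup>2 * \<rho>)"
        unfolding Q'_def zp \<rho>_def[symmetric] using x \<rho>0
        by (simp add: divide_simps) (simp add: power2_eq_square algebra_simps)
      also have "\<dots> \<ge> 0" using x \<rho>0 by simp
      finally show ?thesis by (simp add: \<rho>_def)
    qed
    have bQ: "\<bar>Q x\<bar> \<le> 2 * K2 * \<bar>w x\<bar> + \<bar>r - x\<bar> * ((w x)\<^sup>2 * z x)" if "x > 0" for x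
    proof -
      have "\<bar>Q x\<bar> \<le> \<bar>2 * q x * w x\<bar> + \<bar>(r - x) * ((w x)\<^sup>2 * z x)\<bar>" unfolding Q_def by linarith
      moreover have "\<bar>2 * q x * w x\<bar> \<le> 2 * K2 * \<bar>w x\<bar>"
        using q[of x] by (auto simp: abs_mult intro!: mult_right_mono)
      moreover have "\<bar>(r - x) * ((w x)\<^sup>2 * z x)\<bar> = \<bar>r - x\<bar> * ((w x)\<^sup>2 * z x)"
        using zpos[OF that] by (simp add: abs_mult)
      ultimately show ?thesis by simp
    qed
    \<comment> \<open>Near 0, \<open>w\<close> is of order \<open>x powr r\<close> and
      \<open>z\<close> of order \<open>x powr (- r)\<close>, so \<open>w^2 * z\<close> still
      vanishes like \<open>x powr r\<close>.\<close>
    show "(Q \<longlongrightarrow> 0) (at_right 0)"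
    proof (rule Lim_null_comparison)
      let ?g = "\<lambda>x. 2 * K2 * (K2 * gcdf r x) + \<bar>r - x\<bar> * (K2\<^sup>2 * (x powr r * exp x) / (r\<^sup>2 * Gamma r))"
      show "\<forall>\<^sub>F x in at_right 0. norm (Q x) \<le> ?g x"
        using eventually_at_right_less[of 0]
      proof eventually_elim
        fix x :: real assume x: "0 < x"
        have "\<bar>w x\<bar> \<le> K2 * (x powr r / (r * Gamma r))"
          using w1[of x] gcdf_upper[OF r x] K2 by (meson mult_left_mono order_trans)
        from power_mono[OF this, of 2]
        have "(w x)\<^sup>2 \<le> K2\<^sup>2 * (x powr r)\<^sup>2 / (r * Gamma r)\<^sup>2"
          by (simp add: power_mult_distrib power_divide)
        then have "(w x)\<^sup>2 * z x \<le> K2\<^sup>2 * (x powr r)\<^sup>2 / (r * Gamma r)\<^sup>2 * z x"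
          using zpos[OF x] by (intro mult_right_mono) auto
        also have "\<dots> = K2\<^sup>2 * (x powr r * exp x) / (r\<^sup>2 * Gamma r)"
          using x r Gamma_real_pos[OF r, THEN less_imp_neq, symmetric]
          by (simp add: z_def powr_minus field_simps power2_eq_square del: Gamma_real_pos)
        finally have "\<bar>r - x\<bar> * ((w x)\<^sup>2 * z x) \<le> \<bar>r - x\<bar> * (K2\<^sup>2 * (x powr r * exp x) / (r\<^sup>2 * Gamma r))"
          by (rule mult_left_mono) simp
        moreover have "2 * K2 * \<bar>w x\<bar> \<le> 2 * K2 * (K2 * gcdf r x)"
          using w1[of x] K2 by (intro mult_left_mono) auto
        ultimately show "norm (Q x) \<le> ?g x" using bQ[OF x] by simp
      qed
      have l1: "((\<lambda>x. \<bar>r - x\<bar>) \<longlongrightarrow> \<bar>r - 0\<bar>) (at_right 0)" by (intro tendsto_intros)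
      have l2: "((\<lambda>x. x powr r * exp x) \<longlongrightarrow> 0) (at_right 0)" using r by real_asymp
      have "(?g \<longlongrightarrow> 2 * K2 * (K2 * 0) + \<bar>r - 0\<bar> * (K2\<^sup>2 * 0 / (r\<^sup>2 * Gamma r))) (at_right 0)"
        using r Gamma_real_pos[OF r, THEN less_imp_neq, symmetric]
        by (intro tendsto_add tendsto_mult tendsto_divide tendsto_const gcdf_at_0 l1 l2) (auto simp del: Gamma_real_pos)
      then show "(?g \<longlongrightarrow> 0) (at_right 0)" by simp
    qed
    \<comment> \<open>Near infinity the tail estimate bounds \<open>w\<close> by a multiple of the
      density, so \<open>w^2 * z\<close> is at most of order \<open>gdens r x / x\<close>; the
      denominator absorbs the factor \<open>r - x\<close>.\<close>
    show "(Q \<longlongrightarrow> 0) at_top"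
    proof (rule Lim_null_comparison)
      let ?g = "\<lambda>x. 2 * K2 * (K2 * (1 - gcdf r x)) + \<bar>r / x - 1\<bar> * (4 * K2\<^sup>2 * gdens r x)"
      show "\<forall>\<^sub>F x in at_top. norm (Q x) \<le> ?g x"
        using eventually_gt_at_top[of 0] eventually_ge_at_top[of "2 * r"]
      proof eventually_elim
        fix x :: real assume x: "0 < x" "2 * r \<le> x"
        have \<rho>: "gdens r x > 0" using gdens_pos[OF r x(1)] .
        have "\<bar>w x\<bar> \<le> K2 * (2 * gdens r x)"
          using w2[of x] gamma_tail_le_large[OF r x(2)] K2 by (meson mult_left_mono order_trans)
        from power_mono[OF this, of 2]
        have "(w x)\<^sup>2 \<le> 4 * K2\<^sup>2 * (gdens r x)\<^sup>2" by (simp add: power_mult_distrib)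
        then have "(w x)\<^sup>2 * z x \<le> 4 * K2\<^sup>2 * (gdens r x)\<^sup>2 * z x"
          using zpos[OF x(1)] by (intro mult_right_mono) auto
        also have "\<dots> = 4 * K2\<^sup>2 * gdens r x * (gdens r x * z x)" by (simp add: power2_eq_square)
        also have "\<dots> = 4 * K2\<^sup>2 * gdens r x / x" using \<rho>z[OF x(1)] by simp
        finally have "\<bar>r - x\<bar> * ((w x)\<^sup>2 * z x) \<le> \<bar>r - x\<bar> * (4 * K2\<^sup>2 * gdens r x / x)"
          by (rule mult_left_mono) simp
        also have "\<dots> = \<bar>r - x\<bar> / x * (4 * K2\<^sup>2 * gdens r x)" by simp
        also have "\<bar>r - x\<bar> / x = \<bar>r / x - 1\<bar>" using x by (simp add: abs_if field_simps)
        finally have "\<bar>r - x\<bar> * ((w x)\<^sup>2 * z x) \<le> \<bar>r / x - 1\<bar> * (4 * K2\<^sup>2 * gdens r x)" .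
        moreover have "2 * K2 * \<bar>w x\<bar> \<le> 2 * K2 * (K2 * (1 - gcdf r x))"
          using w2[of x] K2 by (intro mult_left_mono) auto
        ultimately show "norm (Q x) \<le> ?g x" using bQ[OF x(1)] by simp
      qed
      have l1: "((\<lambda>x. r / x - 1) \<longlongrightarrow> - 1) at_top" by real_asymp
      have "(?g \<longlongrightarrow> 2 * K2 * (K2 * (1 - 1)) + \<bar>- 1\<bar> * (4 * K2\<^sup>2 * 0)) at_top"
        using r by (intro tendsto_add tendsto_mult tendsto_diff tendsto_rabs tendsto_const gcdf_at_top gdens_at_top l1) auto
      then show "(?g \<longlongrightarrow> 0) at_top" by simp
    qed
  qed (simp add: gdens_zero)
  then have "(\<integral>x. (q x)\<^sup>2 - x * (f' x)\<^sup>2 \<partial>gamma_law r) \<le> 0" using r by (subst integral_gamma_law) auto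
  then show ?thesis using intq inte by (simp add: m_def)
qed

text \<open>For \<open>\<Phi> x = x^2\<close> this is the variance and for \<open>xlnx\<close> the
  entropy; one subadditivity theorem covers both.\<close>

definition jensen_gap :: "(real \<Rightarrow> real) \<Rightarrow> 'a measure \<Rightarrow> ('a \<Rightarrow> real) \<Rightarrow> real" where
  "jensen_gap \<Phi> M g = (\<integral>x. \<Phi> (g x) \<partial>M) - \<Phi> (\<integral>x. g x \<partial>M)"

abbreviation (input) xlnx :: "real \<Rightarrow> real" where "xlnx x \<equiv> x * ln x"

text \<open>The proof compares \<open>- ln\<close> of the tails of the gamma law and of the law with density \<open>g\<close>
  with respect to it: this is the monotone transport of both laws to the exponential law.\<close>

lemma gamma_lsi_normalized:
  fixes g g' :: "real \<Rightarrow> real"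
  assumes r: "0 < r" "r \<le> 1"
    and [measurable]: "g \<in> borel_measurable borel" "g' \<in> borel_measurable borel"
    and l: "0 < l" and bound: "\<And>x. l \<le> g x" "\<And>x. g x \<le> u" "\<And>x. \<bar>g' x\<bar> \<le> K"
    and deriv: "\<And>x. x > 0 \<Longrightarrow> (g has_real_derivative g' x) (at x)"
    and one: "(\<integral>x. g x \<partial>gamma_law r) = 1"
  shows "(\<integral>x. xlnx (g x) \<partial>gamma_law r) \<le> 4 / r * (\<integral>x. x * (g' x)\<^sup>2 / g x \<partial>gamma_law r)"
proof -
  interpret prob_space "gamma_law r" using r by (intro prob_space_gamma_law) simp
  have gpos: "g x > 0" for x using l bound(1)[of x] by linarith
  have lu: "l \<le> u" using bound(1,2)[of 0] by linarith
  have lng: "\<bar>ln (g x)\<bar> \<le> \<bar>ln l\<bar> + \<bar>ln u\<bar>" for x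
  proof -
    have "ln l \<le> ln (g x)" "ln (g x) \<le> ln u" using bound[of x] gpos[of x] l by auto
    then show ?thesis by linarith
  qed
  have intg: "integrable (gamma_law r) g"
    using bound(2) gpos by (intro integrable_const_bound[of g u]) (auto simp: measurable_gamma_law less_imp_le)
  have intl: "integrable (gamma_law r) (\<lambda>x. xlnx (g x))"
  proof (rule integrable_const_bound[of _ "u * (\<bar>ln l\<bar> + \<bar>ln u\<bar>)"])
    show "AE x in gamma_law r. norm (xlnx (g x)) \<le> u * (\<bar>ln l\<bar> + \<bar>ln u\<bar>)"
      using lng bound(2) gpos[THEN less_imp_le] order_trans[OF gpos[THEN less_imp_le] bound(2)]
      by (auto simp: abs_mult intro!: mult_mono)
  qed (simp add: measurable_gamma_law)
  have inte: "integrable (gamma_law r) (\<lambda>x. x * (g' x)\<^sup>2 / g x)"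
  proof (rule Bochner_Integration.integrable_bound)
    show "integrable (gamma_law r) (\<lambda>x. K\<^sup>2 / l * x)" using gamma_law_moments(1)[of r] r by auto
    have "\<bar>x\<bar> * ((g' x)\<^sup>2 / g x) \<le> \<bar>x\<bar> * (K\<^sup>2 / l)" for x
      using power_mono[OF bound(3)[of x], of 2] bound(1)[of x] l
      by (intro mult_left_mono frac_le) auto
    then show "AE x in gamma_law r. norm (x * (g' x)\<^sup>2 / g x) \<le> norm (K\<^sup>2 / l * x)"
      using gpos l by (auto simp: abs_mult mult.commute less_imp_le)
  qed (simp add: measurable_gamma_law)
  define h where "h x = gdens r x * g x" for x
  have inth: "integrable lborel h" "integral\<^sup>L lborel h = 1"
    using intg one r unfolding h_def by (auto simp: integrable_gamma_law integral_gamma_law)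
  have igd: "integrable lborel (\<lambda>x. c * gdens r x)" for c using integrable_gdens[OF r(1)] by simp
  have hle: "l * gdens r x \<le> h x" "h x \<le> u * gdens r x" for x
    using mult_right_mono[OF bound(1)[of x] gdens_nonneg[OF r(1), of x]]
      mult_right_mono[OF bound(2)[of x] gdens_nonneg[OF r(1), of x]]
    by (auto simp: h_def mult.commute)
  define S0 S where "S0 x = 1 - gcdf r x" and "S x = 1 - lint h x" for x
  have S0: "S0 x > 0" for x using gcdf_less_1[OF r(1)] by (simp add: S0_def)
  have SS: "l * S0 x \<le> S x" "S x \<le> u * S0 x" for x
    using lint_tail_mono[OF igd inth(1) hle(1), of x] lint_tail_mono[OF inth(1) igd hle(2), of x]
    by (auto simp: S_def S0_def inth lint_cmult integral_gdens[OF r(1)] algebra_simps)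
  have S: "S x > 0" for x using SS(1)[of x] S0[of x] l by (smt (verit) mult_pos_pos)
  have lt1: "S0 x < 1" "S x < 1" if "x > 0" for x
  proof -
    show "S0 x < 1" using gcdf_pos[OF r(1) that] by (simp add: S0_def)
    have "0 < l * gcdf r x" using gcdf_pos[OF r(1) that] l by simp
    also have "\<dots> \<le> lint h x" using lint_mono[OF igd inth(1) hle(1), of x] by (simp add: lint_cmult)
    finally show "S x < 1" by (simp add: S_def)
  qed
  define Y T where "Y x = - ln (S0 x)" and "T x = - ln (S x)" for x
  have YT: "Y x > 0" "T x > 0" if "x > 0" for x
    using lt1[OF that] S[of x] S0[of x] by (auto simp: Y_def T_def)
  have cont: "continuous_on {0<..} g" by (auto intro!: continuous_at_imp_continuous_on DERIV_isCont deriv)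
  have S0d: "(S0 has_real_derivative - gdens r x) (at x)" if "x > 0" for x
    unfolding S0_def using gcdf_deriv[OF r(1) that] by (auto intro!: derivative_eq_intros)
  have Sd: "(S has_real_derivative - (gdens r x * g x)) (at x)" if "x > 0" for x
  proof -
    have "continuous_on {0<..} h" unfolding h_def by (intro continuous_intros cont gdens_continuous)
    from lint_deriv[OF inth(1) this that] show ?thesis
      unfolding S_def by (auto intro!: derivative_eq_intros simp: h_def)
  qed
  define Y' T' where "Y' x = gdens r x / S0 x" and "T' x = gdens r x * g x / S x" for x
  have Yd: "(Y has_real_derivative Y' x) (at x)" if "x > 0" for x
    unfolding Y_def Y'_def using S0[of x]
    by (auto intro!: derivative_eq_intros S0d[OF that])
  have Td: "(T has_real_derivative T' x) (at x)" if "x > 0" for x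
    unfolding T_def T'_def using S[of x]
    by (auto intro!: derivative_eq_intros Sd[OF that])
  \<comment> \<open>With \<open>a = sqrt Y\<close> and \<open>b = sqrt T\<close> this is
    \<open>2 * a * (b - a)\<close>: the displacement from \<open>Y\<close> to \<open>T\<close>,
    measured in the square root coordinate that suits the weight \<open>y\<close> of the exponential
    law, and read as a vector in the coordinate \<open>Y\<close>.\<close>
  define \<psi> where "\<psi> x = 2 * (sqrt (Y x) * sqrt (T x) - Y x)" for x
  define \<psi>' where "\<psi>' x = Y' x * (sqrt (T x) / sqrt (Y x)) + T' x * (sqrt (Y x) / sqrt (T x)) - 2 * Y' x" for x
  have \<psi>d: "(\<psi> has_real_derivative \<psi>' x) (at x)" if "x > 0" for x
  proof -
    have sy: "((\<lambda>x. sqrt (Y x)) has_real_derivative inverse (sqrt (Y x)) / 2 * Y' x) (at x)"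
      using DERIV_chain2[OF DERIV_real_sqrt[OF YT(1)[OF that]] Yd[OF that]] .
    have st: "((\<lambda>x. sqrt (T x)) has_real_derivative inverse (sqrt (T x)) / 2 * T' x) (at x)"
      using DERIV_chain2[OF DERIV_real_sqrt[OF YT(2)[OF that]] Td[OF that]] .
    have "(\<psi> has_real_derivative 2 * (inverse (sqrt (Y x)) / 2 * Y' x * sqrt (T x)
        + inverse (sqrt (T x)) / 2 * T' x * sqrt (Y x) - Y' x)) (at x)"
      unfolding \<psi>_def by (intro DERIV_cmult DERIV_diff DERIV_mult sy st Yd that)
    moreover have "2 * (i / 2 * p * b + j / 2 * q * a - p) = p * (b * i) + q * (a * j) - 2 * p"
      for i j p q a b :: real by (simp add: algebra_simps)
    ultimately show ?thesis unfolding \<psi>'_def divide_inverse[of "sqrt _" "sqrt _"] by (simp only:)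
  qed
  define Q where "Q x = g x * \<psi> x * S0 x" for x
  define Q' where "Q' x = (g' x * \<psi> x + \<psi>' x * g x) * S0 x + - gdens r x * (g x * \<psi> x)" for x
  \<comment> \<open>The displacement is at most \<open>2 * \<bar>T x - Y x\<bar>\<close>, and
    \<open>T - Y = ln (S0 / S)\<close> is bounded because \<open>S\<close> lies between
    \<open>l * S0\<close> and \<open>u * S0\<close>. Hence the boundary term at infinity vanishes
    together with \<open>S0\<close>.\<close>
  have \<psi>b: "\<bar>\<psi> x\<bar> \<le> 2 * (\<bar>ln l\<bar> + \<bar>ln u\<bar>)" if "x > 0" for x
  proof -
    let ?a = "sqrt (Y x)" and ?b = "sqrt (T x)"
    have ab: "?a > 0" "?b > 0" "?a\<^sup>2 = Y x" "?b\<^sup>2 = T x" using YT[OF that] by (auto simp: less_imp_le)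
    have "\<psi> x = 2 * ?a * (?b - ?a)" using ab by (simp add: \<psi>_def algebra_simps power2_eq_square)
    also have "\<bar>\<dots>\<bar> \<le> 2 * ((?a + ?b) * \<bar>?b - ?a\<bar>)"
      using ab by (auto simp: abs_mult intro!: mult_right_mono)
    also have "(?a + ?b) * \<bar>?b - ?a\<bar> = \<bar>(?a + ?b) * (?b - ?a)\<bar>" using ab by (simp add: abs_mult)
    also have "(?a + ?b) * (?b - ?a) = T x - Y x" using ab by (simp add: algebra_simps power2_eq_square)
    also have "T x - Y x = ln (S0 x) - ln (S x)" by (simp add: T_def Y_def)
    also have "\<bar>ln (S0 x) - ln (S x)\<bar> \<le> \<bar>ln l\<bar> + \<bar>ln u\<bar>"
    proof -
      have "ln (l * S0 x) \<le> ln (S x)" "ln (S x) \<le> ln (u * S0 x)"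
        using SS[of x] S[of x] S0[of x] l lu by (auto intro!: ln_mono)
      then show ?thesis using l lu S0[of x] by (simp add: ln_mult)
    qed
    finally show ?thesis by simp
  qed
  have bQ: "\<bar>Q x\<bar> \<le> u * (\<bar>\<psi> x\<bar> * S0 x)" for x
    using bound(2)[of x] gpos[of x] S0[of x]
    unfolding Q_def by (auto simp: abs_mult mult.assoc intro!: mult_right_mono)
  have "(\<integral>x. gdens r x * (xlnx (g x) - 4 / r * (x * (g' x)\<^sup>2 / g x)) \<partial>lborel) \<le> 0"
  proof (rule integral_le_0_if_le_deriv[where Q = Q and Q' = Q'])
    show "integrable lborel (\<lambda>x. gdens r x * (xlnx (g x) - 4 / r * (x * (g' x)\<^sup>2 / g x)))"
      by (subst integrable_gamma_law[OF r(1), symmetric])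
        (measurable, intro Bochner_Integration.integrable_diff intl integrable_mult_right inte)
    show "(Q has_real_derivative Q' x) (at x)" if "x > 0" for x
      unfolding Q_def Q'_def by (intro DERIV_mult deriv S0d \<psi>d that)
    show "gdens r x * (xlnx (g x) - 4 / r * (x * (g' x)\<^sup>2 / g x)) \<le> Q' x" if x: "x > 0" for x
    proof -
      define a b \<rho> where "a = sqrt (Y x)" and "b = sqrt (T x)" and "\<rho> = gdens r x"
      have ab: "a > 0" "b > 0" "a\<^sup>2 = Y x" "b\<^sup>2 = T x" using YT[OF x] by (auto simp: a_def b_def less_imp_le)
      have \<rho>: "\<rho> > 0" using gdens_pos[OF r(1) x] by (simp add: \<rho>_def)
      define k where "k = g x * S0 x / S x"
      have k: "k > 0" using gpos S S0 by (simp add: k_def)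
      \<comment> \<open>The number \<open>k\<close> is the quotient \<open>T' / Y'\<close> of the
        hazard rates, and \<open>k * (a / b)\<close> is the derivative of \<open>sqrt T\<close> with
        respect to \<open>sqrt Y\<close>. Splitting off \<open>b / a\<close> and linearising both
        logarithms produces exactly the terms that occur in \<open>\<psi>'\<close>.\<close>
      have "ln (g x) = ln k + Y x - T x"
        using gpos[of x] S[of x] S0[of x] by (simp add: k_def Y_def T_def ln_mult ln_div)
      also have "ln k = ln (k * (a / b)) + ln (b / a)" using k ab by (simp add: ln_mult ln_div)
      also have "ln (k * (a / b)) \<le> k * (a / b) - 1" using k ab by (intro ln_le_minus_one) auto
      also have "ln (b / a) \<le> b / a - 1" using ab by (intro ln_le_minus_one) auto
      finally have lg: "ln (g x) \<le> k * (a / b) + b / a - 2 + a\<^sup>2 - b\<^sup>2" using ab by simp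
      have e1: "\<psi>' x * S0 x = \<rho> * (b / a + k * (a / b) - 2)"
        using S0[of x] by (simp add: \<psi>'_def Y'_def T'_def a_def[symmetric] b_def[symmetric] \<rho>_def[symmetric] k_def algebra_simps)
      have e2: "\<psi> x = 2 * a * (b - a)"
        using ab by (simp add: \<psi>_def a_def[symmetric] b_def[symmetric] algebra_simps power2_eq_square)
      have "Q' x = g' x * \<psi> x * S0 x + (\<psi>' x * S0 x) * g x - \<rho> * (g x * \<psi> x)"
        by (simp add: Q'_def \<rho>_def[symmetric] algebra_simps)
      then have Q'_eq: "Q' x = g' x * (2 * a * (b - a)) * S0 x
          + g x * \<rho> * (b / a + k * (a / b) - 2 - 2 * a * (b - a))"
        unfolding e1 e2 by (simp add: algebra_simps)
      have "g x * \<rho> * ln (g x) \<le> g x * \<rho> * (k * (a / b) + b / a - 2 + a\<^sup>2 - b\<^sup>2)"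
        using lg gpos[of x] \<rho> by (intro mult_left_mono) auto
      also have "\<dots> = Q' x - (g' x * (2 * a * (b - a)) * S0 x + g x * \<rho> * (b - a)\<^sup>2)"
        unfolding Q'_eq by (simp add: algebra_simps power2_eq_square)
      finally have le1: "g x * \<rho> * ln (g x) \<le> Q' x - (g' x * (2 * a * (b - a)) * S0 x + g x * \<rho> * (b - a)\<^sup>2)" .
      \<comment> \<open>Completing the square eliminates the displacement \<open>b - a\<close>. The
        price is the term with \<open>(g' x)\<^sup>2\<close>; its coefficient contains
        \<open>Y * (S0 / \<rho>)^2\<close>, which \<open>gamma_tail_entropy_bound\<close>
        estimates.\<close>
      have sq: "g' x * (2 * a * (b - a)) * S0 x + g x * \<rho> * (b - a)\<^sup>2
          = (g x * \<rho> * (b - a) + g' x * a * S0 x)\<^sup>2 / (g x * \<rho>) - (g' x)\<^sup>2 * a\<^sup>2 * (S0 x)\<^sup>2 / (g x * \<rho>)"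
        using gpos[of x] \<rho> by (simp add: divide_simps) (simp add: algebra_simps power2_eq_square)
      have "(g x * \<rho> * (b - a) + g' x * a * S0 x)\<^sup>2 / (g x * \<rho>) \<ge> 0"
        using gpos[of x] \<rho> by simp
      with le1 sq have "g x * \<rho> * ln (g x) \<le> Q' x + (g' x)\<^sup>2 * a\<^sup>2 * (S0 x)\<^sup>2 / (g x * \<rho>)" by linarith
      also have "(g' x)\<^sup>2 * a\<^sup>2 * (S0 x)\<^sup>2 / (g x * \<rho>) = (g' x)\<^sup>2 * \<rho> / g x * (Y x * (S0 x / \<rho>)\<^sup>2)"
        using \<rho> ab by (simp add: power2_eq_square)
      also have "\<dots> \<le> (g' x)\<^sup>2 * \<rho> / g x * (4 / r * x)"
        using gamma_tail_entropy_bound[OF r x] \<rho> gpos[of x]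
        by (intro mult_left_mono) (auto simp: Y_def S0_def \<rho>_def)
      finally show ?thesis by (simp add: \<rho>_def[symmetric] algebra_simps)
    qed
    show "(Q \<longlongrightarrow> 0) (at_right 0)"
    proof (rule Lim_null_comparison)
      show "\<forall>\<^sub>F x in at_right 0. norm (Q x) \<le> u * (\<bar>\<psi> x\<bar> * S0 x)" using bQ by simp
      have "((\<lambda>x. S0 x) \<longlongrightarrow> 1 - 0) (at_right 0)" unfolding S0_def
        using r by (intro tendsto_intros gcdf_at_0)
      moreover have "((\<lambda>x. S x) \<longlongrightarrow> 1 - 0) (at_right 0)" unfolding S_def
        by (intro tendsto_intros lint_at_0 inth(1)) (auto simp: h_def gdens_zero)
      ultimately have "((\<lambda>x. u * (\<bar>\<psi> x\<bar> * S0 x)) \<longlongrightarrow>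
          u * (\<bar>2 * (sqrt (- ln (1 - 0)) * sqrt (- ln (1 - 0)) - - ln (1 - 0))\<bar> * (1 - 0))) (at_right 0)"
        unfolding \<psi>_def Y_def T_def
        by (intro tendsto_mult tendsto_const tendsto_rabs tendsto_diff tendsto_real_sqrt tendsto_minus tendsto_ln) auto
      then show "((\<lambda>x. u * (\<bar>\<psi> x\<bar> * S0 x)) \<longlongrightarrow> 0) (at_right 0)" by simp
    qed
    show "(Q \<longlongrightarrow> 0) at_top"
    proof (rule Lim_null_comparison)
      show "\<forall>\<^sub>F x in at_top. norm (Q x) \<le> u * (2 * (\<bar>ln l\<bar> + \<bar>ln u\<bar>) * S0 x)"
        using eventually_gt_at_top[of 0]
      proof eventually_elim
        fix x :: real assume x: "0 < x"
        have "u * (\<bar>\<psi> x\<bar> * S0 x) \<le> u * (2 * (\<bar>ln l\<bar> + \<bar>ln u\<bar>) * S0 x)"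
          using \<psi>b[OF x] S0[of x] l lu by (intro mult_left_mono mult_right_mono) auto
        then show "norm (Q x) \<le> u * (2 * (\<bar>ln l\<bar> + \<bar>ln u\<bar>) * S0 x)" using bQ[of x] by simp
      qed
      have "((\<lambda>x. S0 x) \<longlongrightarrow> 1 - 1) at_top" unfolding S0_def
        using r by (intro tendsto_intros gcdf_at_top)
      then have "((\<lambda>x. u * (2 * (\<bar>ln l\<bar> + \<bar>ln u\<bar>) * S0 x)) \<longlongrightarrow> u * (2 * (\<bar>ln l\<bar> + \<bar>ln u\<bar>) * (1 - 1))) at_top"
        by (intro tendsto_mult tendsto_const)
      then show "((\<lambda>x. u * (2 * (\<bar>ln l\<bar> + \<bar>ln u\<bar>) * S0 x)) \<longlongrightarrow> 0) at_top" by simp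
    qed
  qed (simp add: gdens_zero)
  then have "(\<integral>x. xlnx (g x) - 4 / r * (x * (g' x)\<^sup>2 / g x) \<partial>gamma_law r) \<le> 0"
    using r by (subst integral_gamma_law) auto
  also have "(\<integral>x. xlnx (g x) - 4 / r * (x * (g' x)\<^sup>2 / g x) \<partial>gamma_law r) =
      (\<integral>x. xlnx (g x) \<partial>gamma_law r) - (\<integral>x. 4 / r * (x * (g' x)\<^sup>2 / g x) \<partial>gamma_law r)"
    by (intro Bochner_Integration.integral_diff intl integrable_mult_right inte)
  also have "(\<integral>x. 4 / r * (x * (g' x)\<^sup>2 / g x) \<partial>gamma_law r) = 4 / r * (\<integral>x. x * (g' x)\<^sup>2 / g x \<partial>gamma_law r)"
    by (rule integral_mult_right_zero)
  finally show ?thesis by simp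
qed

text \<open>Formulated for a density \<open>g\<close> and its Fisher information, without squares
  and without normalisation, so that the shifted functions \<open>\<lambda>x. g (x + y)\<close> stay
  in the class. The bounds \<open>l\<close>, \<open>u\<close> and \<open>K\<close> make every
  integral finite.\<close>

definition gamma_lsi :: "real \<Rightarrow> real \<Rightarrow> bool" where
  "gamma_lsi r C \<longleftrightarrow> (\<forall>g g' l u K. g \<in> borel_measurable borel \<and> g' \<in> borel_measurable borel \<and> 0 < l \<and>
     (\<forall>x. l \<le> g x \<and> g x \<le> u \<and> \<bar>g' x\<bar> \<le> K) \<and> (\<forall>x>0. (g has_real_derivative g' x) (at x)) \<longrightarrow>
     jensen_gap xlnx (gamma_law r) g \<le> C * (\<integral>x. x * (g' x)\<^sup>2 / g x \<partial>gamma_law r))"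

text \<open>Both sides are homogeneous of degree 1 in \<open>g\<close>, so division by the mean
  leads back to the normalised case.\<close>

lemma gamma_lsi_small:
  assumes r: "0 < r" "r \<le> 1"
  shows "gamma_lsi r (4 / r)"
  unfolding gamma_lsi_def
proof (intro allI impI, elim conjE)
  fix g g' :: "real \<Rightarrow> real" and l u K :: real
  assume [measurable]: "g \<in> borel_measurable borel" "g' \<in> borel_measurable borel"
    and l: "0 < l" and b: "\<forall>x. l \<le> g x \<and> g x \<le> u \<and> \<bar>g' x\<bar> \<le> K"
    and d: "\<forall>x>0. (g has_real_derivative g' x) (at x)"
  interpret prob_space "gamma_law r" using r by (intro prob_space_gamma_law) simp
  have P1: "measure (gamma_law r) UNIV = 1" using prob_space by simp
  have gpos: "g x > 0" for x using l b by (meson less_le_trans)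
  have intg: "integrable (gamma_law r) g"
    using b gpos by (intro integrable_const_bound[of g u]) (auto simp: measurable_gamma_law less_imp_le)
  define m where "m = (\<integral>x. g x \<partial>gamma_law r)"
  have "(\<integral>x. l \<partial>gamma_law r) \<le> m" unfolding m_def using intg b by (intro integral_mono) auto
  then have m: "m > 0" using l P1 by simp
  have lng: "\<bar>ln (g x)\<bar> \<le> \<bar>ln l\<bar> + \<bar>ln u\<bar>" for x
  proof -
    have "l \<le> g x" "g x \<le> u" using b by auto
    then have "ln l \<le> ln (g x)" "ln (g x) \<le> ln u" using gpos[of x] l by auto
    then show ?thesis by linarith
  qed
  have intl: "integrable (gamma_law r) (\<lambda>x. xlnx (g x))"
  proof (rule integrable_const_bound[of _ "u * (\<bar>ln l\<bar> + \<bar>ln u\<bar>)"])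
    have "norm (xlnx (g x)) \<le> u * (\<bar>ln l\<bar> + \<bar>ln u\<bar>)" for x
    proof -
      have "g x \<le> u" "\<bar>g x\<bar> = g x" using b gpos[of x] by auto
      then show ?thesis unfolding real_norm_def abs_mult
        using lng[of x] gpos[of x] by (intro mult_mono) auto
    qed
    then show "AE x in gamma_law r. norm (xlnx (g x)) \<le> u * (\<bar>ln l\<bar> + \<bar>ln u\<bar>)" by simp
  qed (simp add: measurable_gamma_law)
  have "(\<integral>x. xlnx (g x / m) \<partial>gamma_law r) \<le> 4 / r * (\<integral>x. x * (g' x / m)\<^sup>2 / (g x / m) \<partial>gamma_law r)"
  proof (rule gamma_lsi_normalized[OF r, where l = "l / m" and u = "u / m" and K = "K / m"])
    show "(\<integral>x. g x / m \<partial>gamma_law r) = 1" using m by (simp add: m_def[symmetric])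
    show "((\<lambda>x. g x / m) has_real_derivative g' x / m) (at x)" if "x > 0" for x
      using d that by (intro DERIV_cdivide) auto
  qed (use m l b in \<open>auto simp: divide_right_mono\<close>)
  also have "(\<lambda>x. x * (g' x / m)\<^sup>2 / (g x / m)) = (\<lambda>x. x * (g' x)\<^sup>2 / g x / m)"
    using m by (simp add: fun_eq_iff power2_eq_square)
  also have "(\<lambda>x. xlnx (g x / m)) = (\<lambda>x. xlnx (g x) / m - g x / m * ln m)"
    using m gpos by (simp add: fun_eq_iff ln_div algebra_simps diff_divide_distrib less_imp_neq[symmetric])
  also have "(\<integral>x. x * (g' x)\<^sup>2 / g x / m \<partial>gamma_law r) = (\<integral>x. x * (g' x)\<^sup>2 / g x \<partial>gamma_law r) / m"
    by (rule integral_divide_zero)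
  also have "(\<integral>x. xlnx (g x) / m - g x / m * ln m \<partial>gamma_law r) = (\<integral>x. xlnx (g x) \<partial>gamma_law r) / m - m / m * ln m"
    using intl intg by (simp add: m_def[symmetric])
  finally have "(\<integral>x. xlnx (g x) \<partial>gamma_law r) / m - m / m * ln m \<le> 4 / r * (\<integral>x. x * (g' x)\<^sup>2 / g x \<partial>gamma_law r) / m"
    by simp
  then have "((\<integral>x. xlnx (g x) \<partial>gamma_law r) - m * ln m) / m \<le> 4 / r * (\<integral>x. x * (g' x)\<^sup>2 / g x \<partial>gamma_law r) / m"
    using m by (simp add: diff_divide_distrib)
  then show "jensen_gap xlnx (gamma_law r) g \<le> 4 / r * (\<integral>x. x * (g' x)\<^sup>2 / g x \<partial>gamma_law r)"
    using m unfolding jensen_gap_def m_def[symmetric] by (simp only: divide_le_cancel)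
qed

section \<open>Subadditivity of variance and entropy on product spaces\<close>

text \<open>The assumption \<open>gap_convex\<close> is the tangent inequality at \<open>h\<close>
  of the functional \<open>jensen_gap \<Phi> M\<close>, that is, its convexity; this property is
  what makes the gap subadditive on products. In the instances \<open>\<psi>\<close> is the
  derivative of \<open>\<Phi>\<close> up to an additive constant, which cancels in the difference.
  Confining all functions to \<open>{l..u}\<close> settles integrability once and for all.\<close>

locale tensor_fun =
  fixes \<Phi> \<psi> :: "real \<Rightarrow> real" and l u B :: real
  assumes lu: "l \<le> u"
    and \<Phi>_meas [measurable]: "\<Phi> \<in> borel_measurable borel"
    and \<psi>_meas [measurable]: "\<psi> \<in> borel_measurable borel"
    and \<Phi>_bound: "\<And>x. l \<le> x \<Longrightarrow> x \<le> u \<Longrightarrow> \<bar>\<Phi> x\<bar> \<le> B"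
    and \<psi>_bound: "\<And>x. l \<le> x \<Longrightarrow> x \<le> u \<Longrightarrow> \<bar>\<psi> x\<bar> \<le> B"
    and gap_convex: "\<And>(M :: real measure) g h. \<lbrakk>prob_space M; g \<in> borel_measurable M; h \<in> borel_measurable M;
      \<And>x. l \<le> g x \<and> g x \<le> u; \<And>x. l \<le> h x \<and> h x \<le> u\<rbrakk> \<Longrightarrow>
      jensen_gap \<Phi> M h + (\<integral>x. (\<psi> (h x) - \<psi> (\<integral>x. h x \<partial>M)) * (g x - h x) \<partial>M) \<le> jensen_gap \<Phi> M g"
begin

lemma B_nonneg: "B \<ge> 0" using \<Phi>_bound[OF order_refl lu] by linarith

lemma integrable_bounded:
  fixes g :: "'b \<Rightarrow> real"
  assumes "prob_space M" "g \<in> borel_measurable M" "\<And>x. \<bar>g x\<bar> \<le> K"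
  shows "integrable M g"
proof -
  interpret prob_space M by fact
  show ?thesis using assms by (intro integrable_const_bound[of _ K]) auto
qed

lemma integrable_range:
  fixes g :: "'b \<Rightarrow> real"
  assumes "prob_space M" "g \<in> borel_measurable M" "\<And>x. l \<le> g x \<and> g x \<le> u"
  shows "integrable M g" "integrable M (\<lambda>x. \<Phi> (g x))"
proof -
  have "\<bar>g x\<bar> \<le> \<bar>l\<bar> + \<bar>u\<bar>" for x using assms(3)[of x] by linarith
  then show "integrable M g" by (rule integrable_bounded[OF assms(1,2)])
  show "integrable M (\<lambda>x. \<Phi> (g x))"
    using assms \<Phi>_bound by (intro integrable_bounded[where K = B]) auto
qed

lemma integral_range:
  fixes g :: "'b \<Rightarrow> real"
  assumes "prob_space M" "g \<in> borel_measurable M" "\<And>x. l \<le> g x \<and> g x \<le> u"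
  shows "l \<le> (\<integral>x. g x \<partial>M)" "(\<integral>x. g x \<partial>M) \<le> u"
proof -
  interpret prob_space M by fact
  show "l \<le> (\<integral>x. g x \<partial>M)" "(\<integral>x. g x \<partial>M) \<le> u"
    using integrable_range(1)[OF assms] assms(3) by (auto intro!: integral_ge_const integral_le_const)
qed

lemma gap_bound:
  fixes g :: "'b \<Rightarrow> real"
  assumes "prob_space M" "g \<in> borel_measurable M" "\<And>x. l \<le> g x \<and> g x \<le> u"
  shows "\<bar>jensen_gap \<Phi> M g\<bar> \<le> 2 * B"
proof -
  interpret prob_space M by fact
  have "\<bar>\<integral>x. \<Phi> (g x) \<partial>M\<bar> \<le> (\<integral>x. \<bar>\<Phi> (g x)\<bar> \<partial>M)" by (rule integral_abs_bound)
  also have "\<dots> \<le> B" using integrable_range(2)[OF assms] assms(3) \<Phi>_bound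
    by (intro integral_le_const) auto
  moreover have "\<bar>\<Phi> (\<integral>x. g x \<partial>M)\<bar> \<le> B" using integral_range[OF assms] by (rule \<Phi>_bound)
  ultimately show ?thesis unfolding jensen_gap_def by linarith
qed

lemma gap_measurable:
  assumes N: "prob_space N" and f [measurable]: "(\<lambda>(x, y). f x y) \<in> borel_measurable (M \<Otimes>\<^sub>M N)"
  shows "(\<lambda>x. jensen_gap \<Phi> N (f x)) \<in> borel_measurable M"
proof -
  interpret prob_space N by fact
  show ?thesis unfolding jensen_gap_def by measurable
qed

text \<open>Averaging over the second factor splits the gap exactly into the mean gap along that
  factor and the gap of the average \<open>a\<close> under \<open>M\<close>. The latter is at most
  the mean over \<open>y\<close> of the gaps of the slices: apply the tangent inequality at
  \<open>a\<close> to each slice, and observe that the linear terms integrate to 0 by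
  Fubini.\<close>

lemma gap_pair:
  fixes M :: "real measure" and N :: "'b measure"
  assumes M: "prob_space M" and N: "prob_space N"
    and f [measurable]: "(\<lambda>(x, y). f x y) \<in> borel_measurable (M \<Otimes>\<^sub>M N)"
    and fb: "\<And>x y. l \<le> f x y \<and> f x y \<le> u"
  shows "jensen_gap \<Phi> (M \<Otimes>\<^sub>M N) (\<lambda>(x, y). f x y) \<le>
     (\<integral>x. jensen_gap \<Phi> N (f x) \<partial>M) + (\<integral>y. jensen_gap \<Phi> M (\<lambda>x. f x y) \<partial>N)"
proof -
  interpret M: prob_space M by fact
  interpret N: prob_space N by fact
  interpret P: pair_prob_space M N ..
  have f1 [measurable]: "f x \<in> borel_measurable N" if "x \<in> space M" for x
    using measurable_compose[OF measurable_Pair1'[OF that] f] by simp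
  have f2: "(\<lambda>x. f x y) \<in> borel_measurable M" if "y \<in> space N" for y
    using measurable_compose[OF measurable_Pair2'[OF that] f] by simp
  define a where "a x = (\<integral>y. f x y \<partial>N)" for x
  have [measurable]: "a \<in> borel_measurable M" unfolding a_def by measurable
  have a: "l \<le> a x \<and> a x \<le> u" if "x \<in> space M" for x
    using integral_range[OF N f1[OF that]] fb by (simp add: a_def)
  \<comment> \<open>The bounds in \<open>gap_convex\<close> range over all reals, so
    \<open>a\<close> receives the value \<open>l\<close> outside the space of
    \<open>M\<close>.\<close>
  define a' where "a' x = (if x \<in> space M then a x else l)" for x
  have [measurable]: "a' \<in> borel_measurable M" unfolding a'_def by measurable
  have a': "l \<le> a' x \<and> a' x \<le> u" for x using a lu by (auto simp: a'_def)
  have aa: "(\<integral>x. \<Phi> (a x) \<partial>M) = (\<integral>x. \<Phi> (a' x) \<partial>M)" "(\<integral>x. a x \<partial>M) = (\<integral>x. a' x \<partial>M)"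
    by (auto intro!: Bochner_Integration.integral_cong simp: a'_def)
  have PP: "prob_space (M \<Otimes>\<^sub>M N)" by (rule P.prob_space_axioms)
  have I\<Phi>: "integrable (M \<Otimes>\<^sub>M N) (\<lambda>(x, y). \<Phi> (f x y))"
    using fb \<Phi>_bound by (intro integrable_bounded[OF PP, where K = B]) auto
  have If: "integrable (M \<Otimes>\<^sub>M N) (\<lambda>(x, y). f x y)"
    using integrable_range(1)[OF PP f] fb by (auto simp: case_prod_unfold)
  define c where "c x = \<psi> (a' x) - \<psi> (\<integral>x. a' x \<partial>M)" for x
  have [measurable]: "c \<in> borel_measurable M" unfolding c_def by measurable
  have c: "\<bar>c x\<bar> \<le> 2 * B" for x
    using \<psi>_bound[of "a' x"] \<psi>_bound[OF integral_range[OF M \<open>a' \<in> borel_measurable M\<close> a']] a'[of x]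
    by (simp add: c_def)
  have Ic: "integrable (M \<Otimes>\<^sub>M N) (\<lambda>(x, y). c x * (f x y - a' x))"
  proof (rule integrable_bounded[OF PP, where K = "2 * B * (u - l)"])
    have "\<bar>c x * (f x y - a' x)\<bar> \<le> 2 * B * (u - l)" for x y
      unfolding abs_mult using c[of x] fb[of x y] a'[of x] B_nonneg by (intro mult_mono) auto
    then show "\<bar>case z of (x, y) \<Rightarrow> c x * (f x y - a' x)\<bar> \<le> 2 * B * (u - l)" for z by (cases z) auto
  qed measurable
  have Fub: "(\<integral>y. (\<integral>x. c x * (f x y - a' x) \<partial>M) \<partial>N) = 0"
  proof -
    have "(\<integral>y. (\<integral>x. c x * (f x y - a' x) \<partial>M) \<partial>N) = (\<integral>x. (\<integral>y. c x * (f x y - a' x) \<partial>N) \<partial>M)"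
      by (rule P.Fubini_integral[OF Ic])
    also have "\<dots> = (\<integral>x. 0 \<partial>M)"
    proof (intro Bochner_Integration.integral_cong refl)
      fix x assume x: "x \<in> space M"
      have "integrable N (f x)" using integrable_range(1)[OF N f1[OF x]] fb by auto
      then have "(\<integral>y. c x * (f x y - a' x) \<partial>N) = c x * (a x - a' x)"
        by (simp add: a_def N.prob_space)
      then show "(\<integral>y. c x * (f x y - a' x) \<partial>N) = 0" using x by (simp add: a'_def)
    qed
    finally show ?thesis by simp
  qed
  have gm [measurable]: "(\<lambda>y. jensen_gap \<Phi> M (\<lambda>x. f x y)) \<in> borel_measurable N"
    by (rule gap_measurable[OF M]) measurable
  have gmM [measurable]: "(\<lambda>x. jensen_gap \<Phi> N (f x)) \<in> borel_measurable M"
    by (rule gap_measurable[OF N f])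
  have gi: "integrable N (\<lambda>y. jensen_gap \<Phi> M (\<lambda>x. f x y))"
    using gap_bound[OF M f2] fb by (intro N.integrable_const_bound[of _ "2 * B"]) auto
  have gaM: "jensen_gap \<Phi> M a' \<le> (\<integral>y. jensen_gap \<Phi> M (\<lambda>x. f x y) \<partial>N)"
  proof -
    have "(\<integral>y. jensen_gap \<Phi> M a' + (\<integral>x. c x * (f x y - a' x) \<partial>M) \<partial>N) \<le> (\<integral>y. jensen_gap \<Phi> M (\<lambda>x. f x y) \<partial>N)"
    proof (rule integral_mono)
      show "integrable N (\<lambda>y. jensen_gap \<Phi> M a' + (\<integral>x. c x * (f x y - a' x) \<partial>M))"
        using P.integrable_snd[OF Ic] by simp
      fix y assume y: "y \<in> space N"
      show "jensen_gap \<Phi> M a' + (\<integral>x. c x * (f x y - a' x) \<partial>M) \<le> jensen_gap \<Phi> M (\<lambda>x. f x y)"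
        unfolding c_def using gap_convex[OF M f2[OF y] \<open>a' \<in> borel_measurable M\<close> fb a'] .
    qed (rule gi)
    also have "(\<integral>y. jensen_gap \<Phi> M a' + (\<integral>x. c x * (f x y - a' x) \<partial>M) \<partial>N) = jensen_gap \<Phi> M a'"
      using P.integrable_snd[OF Ic] by (simp add: Fub N.prob_space)
    finally show ?thesis .
  qed
  have "jensen_gap \<Phi> (M \<Otimes>\<^sub>M N) (\<lambda>(x, y). f x y) = (\<integral>x. (\<integral>y. \<Phi> (f x y) \<partial>N) \<partial>M) - \<Phi> (\<integral>x. a x \<partial>M)"
    using P.integral_fst'[OF I\<Phi>] P.integral_fst'[OF If] by (simp add: jensen_gap_def a_def case_prod_unfold)
  also have "(\<integral>x. (\<integral>y. \<Phi> (f x y) \<partial>N) \<partial>M) = (\<integral>x. jensen_gap \<Phi> N (f x) + \<Phi> (a x) \<partial>M)"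
    by (simp add: jensen_gap_def a_def)
  also have "\<dots> = (\<integral>x. jensen_gap \<Phi> N (f x) \<partial>M) + (\<integral>x. \<Phi> (a x) \<partial>M)"
  proof (rule Bochner_Integration.integral_add)
    show "integrable M (\<lambda>x. jensen_gap \<Phi> N (f x))"
      using gap_bound[OF N f1] fb by (intro M.integrable_const_bound[of _ "2 * B"]) auto
    show "integrable M (\<lambda>x. \<Phi> (a x))"
      using a \<Phi>_bound by (intro M.integrable_const_bound[of _ B]) auto
  qed
  also have "\<dots> - \<Phi> (\<integral>x. a x \<partial>M) = (\<integral>x. jensen_gap \<Phi> N (f x) \<partial>M) + jensen_gap \<Phi> M a'"
    by (simp add: jensen_gap_def aa)
  finally show ?thesis using gaM by linarith
qed

end

section \<open>Integrals over finite products and subadditivity there\<close>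

lemma PiM_integral_insert_bounded:
  fixes f :: "('i \<Rightarrow> 'a) \<Rightarrow> real" and M :: "'i \<Rightarrow> 'a measure"
  assumes M: "\<And>j. prob_space (M j)" and I: "finite I" "i \<notin> I" and f: "f \<in> borel_measurable (Pi\<^sub>M (insert i I) M)" and b: "\<And>y. \<bar>f y\<bar> \<le> K"
  shows "(\<integral>y. f y \<partial>Pi\<^sub>M (insert i I) M) = (\<integral>z. (case z of (x, y) \<Rightarrow> f (y(i := x))) \<partial>(M i \<Otimes>\<^sub>M Pi\<^sub>M I M))" (is ?A)
    "(\<integral>y. f y \<partial>Pi\<^sub>M (insert i I) M) = (\<integral>x. (\<integral>y. f (y(i := x)) \<partial>Pi\<^sub>M I M) \<partial>M i)" (is ?B)
    "(\<integral>y. f y \<partial>Pi\<^sub>M (insert i I) M) = (\<integral>y. (\<integral>x. f (y(i := x)) \<partial>M i) \<partial>Pi\<^sub>M I M)" (is ?C)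
proof -
  interpret M: prob_space "M j" for j by (rule M)
  interpret product_sigma_finite M by unfold_locales
  interpret J: prob_space "Pi\<^sub>M J M" for J by (rule prob_space_PiM) (rule M)
  interpret P: pair_prob_space "M i" "Pi\<^sub>M I M" ..
  have [measurable]: "(\<lambda>(x, y). f (y(i := x))) \<in> borel_measurable (M i \<Otimes>\<^sub>M Pi\<^sub>M I M)"
    using measurable_compose[OF measurable_pair_swap' measurable_compose[OF measurable_add_dim f]]
    by (simp add: case_prod_unfold)
  have int: "integrable (M i \<Otimes>\<^sub>M Pi\<^sub>M I M) (\<lambda>(x, y). f (y(i := x)))"
    using b by (intro P.integrable_const_bound[of _ K]) auto
  have int2: "integrable (Pi\<^sub>M (insert i I) M) f"
    using b f by (intro J.integrable_const_bound[where B = K]) auto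
  show ?C by (rule product_integral_insert[OF I int2])
  also have "\<dots> = (\<integral>x. (\<integral>y. f (y(i := x)) \<partial>Pi\<^sub>M I M) \<partial>M i)" by (rule P.Fubini_integral[OF int])
  finally show ?B .
  also have "\<dots> = (\<integral>z. (case z of (x, y) \<Rightarrow> f (y(i := x))) \<partial>(M i \<Otimes>\<^sub>M Pi\<^sub>M I M))"
    using P.integral_fst'[OF int] by simp
  finally show ?A .
qed

text \<open>The inner integral no longer depends on \<open>y i\<close>, and \<open>M i\<close> has
  mass 1. The identity lets one-dimensional inequalities in a frozen environment be integrated back
  to the full product.\<close>

lemma PiM_integral_resample:
  fixes f :: "('i \<Rightarrow> 'a) \<Rightarrow> real" and M :: "'i \<Rightarrow> 'a measure"
  assumes M: "\<And>j. prob_space (M j)" and I: "finite I" "i \<in> I" and f: "f \<in> borel_measurable (Pi\<^sub>M I M)" and b: "\<And>y. \<bar>f y\<bar> \<le> K"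
  shows "(\<integral>y. (\<integral>x. f (y(i := x)) \<partial>M i) \<partial>Pi\<^sub>M I M) = (\<integral>y. f y \<partial>Pi\<^sub>M I M)"
proof -
  interpret M: prob_space "M j" for j by (rule M)
  define J where "J = I - {i}"
  have J: "finite J" "i \<notin> J" "I = insert i J" using I unfolding J_def by blast+
  have fJ: "f \<in> borel_measurable (Pi\<^sub>M (insert i J) M)" using f J by simp
  have ii: "insert i (insert i J) = insert i J" by simp
  have "(\<lambda>(y, x). f (y(i := x))) \<in> borel_measurable (Pi\<^sub>M (insert i J) M \<Otimes>\<^sub>M M i)"
    using measurable_compose[OF measurable_add_dim[of i "insert i J" M, unfolded ii] fJ]
    by (simp add: case_prod_unfold)
  then have m: "(\<lambda>y. \<integral>x. f (y(i := x)) \<partial>M i) \<in> borel_measurable (Pi\<^sub>M (insert i J) M)"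
    by (intro M.borel_measurable_lebesgue_integral)
  have b': "\<bar>\<integral>x. f (y(i := x)) \<partial>M i\<bar> \<le> K" for y
  proof (cases "integrable (M i) (\<lambda>x. f (y(i := x)))")
    case True
    have "\<bar>\<integral>x. f (y(i := x)) \<partial>M i\<bar> \<le> (\<integral>x. \<bar>f (y(i := x))\<bar> \<partial>M i)" by (rule integral_abs_bound)
    also have "\<dots> \<le> K" using True b by (intro M.integral_le_const) auto
    finally show ?thesis .
  next
    case False
    \<comment> \<open>Without integrability the inner integral is 0 by convention, so the bound
      survives.\<close>
    have "K \<ge> 0" using b[of undefined] by linarith
    with False show ?thesis by (simp add: not_integrable_integral_eq)
  qed
  have "(\<integral>y. (\<integral>x. f (y(i := x)) \<partial>M i) \<partial>Pi\<^sub>M (insert i J) M)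
      = (\<integral>y. (\<integral>s. (\<integral>x. f (y(i := s, i := x)) \<partial>M i) \<partial>M i) \<partial>Pi\<^sub>M J M)"
    by (rule PiM_integral_insert_bounded(3)[OF M J(1,2) m b'])
  also have "\<dots> = (\<integral>y. (\<integral>x. f (y(i := x)) \<partial>M i) \<partial>Pi\<^sub>M J M)"
    by (simp add: M.prob_space)
  also have "\<dots> = (\<integral>y. f y \<partial>Pi\<^sub>M (insert i J) M)"
    by (rule PiM_integral_insert_bounded(3)[OF M J(1,2) fJ b, symmetric])
  finally show ?thesis using J by simp
qed

text \<open>Induction on the index set: \<open>gap_pair\<close> splits off coordinate
  \<open>i\<close>, and the induction hypothesis is applied to the remaining coordinates with
  \<open>y i\<close> frozen. Each summand is an integral over the whole product although its
  integrand ignores its own coordinate; in this form all summands live on the same space.\<close>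

lemma (in tensor_fun) gap_PiM:
  fixes M :: "'i \<Rightarrow> real measure"
  assumes M: "\<And>j. prob_space (M j)" and I: "finite I"
    and "f \<in> borel_measurable (Pi\<^sub>M I M)" "\<And>y. l \<le> f y \<and> f y \<le> u"
  shows "jensen_gap \<Phi> (Pi\<^sub>M I M) f \<le> (\<Sum>i\<in>I. \<integral>y. jensen_gap \<Phi> (M i) (\<lambda>x. f (y(i := x))) \<partial>Pi\<^sub>M I M)"
  using I assms(3,4)
proof (induction I arbitrary: f)
  case empty
  interpret prob_space "Pi\<^sub>M {} M" by (rule prob_space_PiM) (rule M)
  have "(\<integral>y. g (f y) \<partial>Pi\<^sub>M {} M) = g (f (\<lambda>_. undefined))" for g :: "real \<Rightarrow> real"
  proof -
    have "(\<integral>y. g (f y) \<partial>Pi\<^sub>M {} M) = (\<integral>y. g (f (\<lambda>_. undefined)) \<partial>Pi\<^sub>M {} M)"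
      by (intro Bochner_Integration.integral_cong) (auto simp: space_PiM)
    also have "\<dots> = g (f (\<lambda>_. undefined))" using prob_space by simp
    finally show ?thesis .
  qed
  from this[of \<Phi>] this[of "\<lambda>x. x"] show ?case by (simp add: jensen_gap_def)
next
  case (insert i I)
  interpret M: prob_space "M j" for j by (rule M)
  interpret J: prob_space "Pi\<^sub>M J M" for J by (rule prob_space_PiM) (rule M)
  note f [measurable] = insert.prems(1) and fb = insert.prems(2)
  have F: "(\<lambda>(x, y). f (y(i := x))) \<in> borel_measurable (M i \<Otimes>\<^sub>M Pi\<^sub>M I M)"
    using measurable_compose[OF measurable_pair_swap' measurable_compose[OF measurable_add_dim f]]
    by (simp add: case_prod_unfold)
  have fb': "\<bar>f y\<bar> \<le> \<bar>l\<bar> + \<bar>u\<bar>" for y using fb[of y] by linarith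
  have \<Phi>b: "\<bar>\<Phi> (f y)\<bar> \<le> B" for y using fb[of y] \<Phi>_bound by auto
  have \<Phi>m: "(\<lambda>y. \<Phi> (f y)) \<in> borel_measurable (Pi\<^sub>M (insert i I) M)" by measurable
  have upd: "(\<lambda>x. y(j := x)) \<in> measurable (M j) (Pi\<^sub>M (insert i I) M)"
    if "y \<in> space (Pi\<^sub>M (insert i I) M)" "j \<in> insert i I" for y j
    by (rule measurable_fun_upd[where J = "insert i I"]) (use that in auto)
  have gm: "(\<lambda>y. jensen_gap \<Phi> (M j) (\<lambda>x. f (y(j := x)))) \<in> borel_measurable (Pi\<^sub>M (insert i I) M)" if "j \<in> insert i I" for j
  proof (rule gap_measurable[OF M])
    have ij: "insert j (insert i I) = insert i I" using that by auto
    show "(\<lambda>(y, x). f (y(j := x))) \<in> borel_measurable (Pi\<^sub>M (insert i I) M \<Otimes>\<^sub>M M j)"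
      using measurable_compose[OF measurable_add_dim[of j "insert i I" M, unfolded ij] f] by (simp add: case_prod_unfold fun_upd_def)
  qed
  \<comment> \<open>The value 0 outside the product space makes the bound \<open>2 * B\<close> hold
    everywhere, as \<open>PiM_integral_insert_bounded\<close> requires.\<close>
  define g where "g j y = (if y \<in> space (Pi\<^sub>M (insert i I) M) then jensen_gap \<Phi> (M j) (\<lambda>x. f (y(j := x))) else 0)" for j y
  have gm' [measurable]: "g j \<in> borel_measurable (Pi\<^sub>M (insert i I) M)" if "j \<in> insert i I" for j
    unfolding g_def using gm[OF that] by measurable
  have gb: "\<bar>g j y\<bar> \<le> 2 * B" if "j \<in> insert i I" for j y
  proof (cases "y \<in> space (Pi\<^sub>M (insert i I) M)")
    case True
    have "(\<lambda>x. f (y(j := x))) \<in> borel_measurable (M j)"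
      using measurable_compose[OF upd[OF True that] f] .
    then show ?thesis using gap_bound[OF M] fb True by (simp add: g_def)
  qed (simp add: g_def B_nonneg)
  have g_int: "(\<integral>y. jensen_gap \<Phi> (M j) (\<lambda>x. f (y(j := x))) \<partial>Pi\<^sub>M (insert i I) M) = (\<integral>y. g j y \<partial>Pi\<^sub>M (insert i I) M)" for j
    by (intro Bochner_Integration.integral_cong) (auto simp: g_def)
  have sp: "y(i := x) \<in> space (Pi\<^sub>M (insert i I) M)" if "x \<in> space (M i)" "y \<in> space (Pi\<^sub>M I M)" for x y
    using that by (auto simp: space_PiM PiE_def extensional_def)
  have Fx: "(\<lambda>y. f (y(i := x))) \<in> borel_measurable (Pi\<^sub>M I M)" if "x \<in> space (M i)" for x
    using measurable_compose[OF measurable_Pair1'[OF that] F] by simp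
  have "jensen_gap \<Phi> (Pi\<^sub>M (insert i I) M) f = jensen_gap \<Phi> (M i \<Otimes>\<^sub>M Pi\<^sub>M I M) (\<lambda>(x, y). f (y(i := x)))"
    unfolding jensen_gap_def
    using PiM_integral_insert_bounded(1)[OF M insert.hyps f fb'] PiM_integral_insert_bounded(1)[OF M insert.hyps \<Phi>m \<Phi>b]
    by (simp add: case_prod_unfold fun_upd_def)
  also have "\<dots> \<le> (\<integral>x. jensen_gap \<Phi> (Pi\<^sub>M I M) (\<lambda>y. f (y(i := x))) \<partial>M i)
      + (\<integral>y. jensen_gap \<Phi> (M i) (\<lambda>x. f (y(i := x))) \<partial>Pi\<^sub>M I M)"
    by (rule gap_pair[OF M J.prob_space_axioms F fb])
  also have "(\<integral>y. jensen_gap \<Phi> (M i) (\<lambda>x. f (y(i := x))) \<partial>Pi\<^sub>M I M) = (\<integral>y. g i y \<partial>Pi\<^sub>M (insert i I) M)"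
  proof -
    have "(\<integral>y. g i y \<partial>Pi\<^sub>M (insert i I) M) = (\<integral>y. (\<integral>s. g i (y(i := s)) \<partial>M i) \<partial>Pi\<^sub>M I M)"
      by (rule PiM_integral_insert_bounded(3)[OF M insert.hyps gm' gb]) auto
    also have "\<dots> = (\<integral>y. (\<integral>s. jensen_gap \<Phi> (M i) (\<lambda>x. f (y(i := x))) \<partial>M i) \<partial>Pi\<^sub>M I M)"
      by (intro Bochner_Integration.integral_cong refl) (auto simp: g_def sp)
    finally show ?thesis by (simp add: M.prob_space)
  qed
  also have "(\<integral>x. jensen_gap \<Phi> (Pi\<^sub>M I M) (\<lambda>y. f (y(i := x))) \<partial>M i) \<le> (\<Sum>j\<in>I. \<integral>y. g j y \<partial>Pi\<^sub>M (insert i I) M)"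
  proof -
    have gx: "g j (y(i := x)) = jensen_gap \<Phi> (M j) (\<lambda>s. f (y(j := s, i := x)))"
      if "j \<in> I" "x \<in> space (M i)" "y \<in> space (Pi\<^sub>M I M)" for j x y
    proof -
      have "i \<noteq> j" using that insert.hyps by auto
      then show ?thesis using sp[OF that(2,3)] by (simp add: g_def fun_upd_twist)
    qed
    have gmx: "(\<lambda>(x, y). g j (y(i := x))) \<in> borel_measurable (M i \<Otimes>\<^sub>M Pi\<^sub>M I M)" if "j \<in> I" for j
      using measurable_compose[OF measurable_pair_swap' measurable_compose[OF measurable_add_dim gm'], of j] that
      by (simp add: case_prod_unfold)
    have gix: "integrable (M i) (\<lambda>x. \<integral>y. g j (y(i := x)) \<partial>Pi\<^sub>M I M)" if "j \<in> I" for j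
    proof (rule M.integrable_const_bound[where B = "2 * B"])
      show "(\<lambda>x. \<integral>y. g j (y(i := x)) \<partial>Pi\<^sub>M I M) \<in> borel_measurable (M i)"
        using J.borel_measurable_lebesgue_integral[OF gmx[OF that]] by simp
      have "\<bar>\<integral>y. g j (y(i := x)) \<partial>Pi\<^sub>M I M\<bar> \<le> 2 * B" if x: "x \<in> space (M i)" for x
      proof -
        have m: "(\<lambda>y. g j (y(i := x))) \<in> borel_measurable (Pi\<^sub>M I M)"
          using measurable_compose[OF measurable_Pair1'[OF x] gmx[OF \<open>j \<in> I\<close>]] by simp
        have "\<bar>\<integral>y. g j (y(i := x)) \<partial>Pi\<^sub>M I M\<bar> \<le> (\<integral>y. \<bar>g j (y(i := x))\<bar> \<partial>Pi\<^sub>M I M)" by (rule integral_abs_bound)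
        also have "\<dots> \<le> 2 * B" using m gb \<open>j \<in> I\<close>
          by (intro J.integral_le_const J.integrable_const_bound[where B = "2 * B"]) auto
        finally show ?thesis .
      qed
      then show "AE x in M i. norm (\<integral>y. g j (y(i := x)) \<partial>Pi\<^sub>M I M) \<le> 2 * B" by auto
    qed
    have "(\<integral>x. jensen_gap \<Phi> (Pi\<^sub>M I M) (\<lambda>y. f (y(i := x))) \<partial>M i)
        \<le> (\<integral>x. (\<Sum>j\<in>I. \<integral>y. g j (y(i := x)) \<partial>Pi\<^sub>M I M) \<partial>M i)"
    proof (rule integral_mono)
      show "integrable (M i) (\<lambda>x. jensen_gap \<Phi> (Pi\<^sub>M I M) (\<lambda>y. f (y(i := x))))"
        using gap_measurable[OF J.prob_space_axioms F] gap_bound[OF J.prob_space_axioms Fx] fb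
        by (intro M.integrable_const_bound[where B = "2 * B"]) auto
      show "integrable (M i) (\<lambda>x. \<Sum>j\<in>I. \<integral>y. g j (y(i := x)) \<partial>Pi\<^sub>M I M)"
        using gix by auto
      fix x assume x: "x \<in> space (M i)"
      have "jensen_gap \<Phi> (Pi\<^sub>M I M) (\<lambda>y. f (y(i := x))) \<le>
          (\<Sum>j\<in>I. \<integral>y. jensen_gap \<Phi> (M j) (\<lambda>s. f (y(j := s, i := x))) \<partial>Pi\<^sub>M I M)"
        by (rule insert.IH[OF Fx[OF x] fb])
      also have "\<dots> = (\<Sum>j\<in>I. \<integral>y. g j (y(i := x)) \<partial>Pi\<^sub>M I M)"
        by (intro sum.cong refl Bochner_Integration.integral_cong) (simp_all add: gx x)
      finally show "jensen_gap \<Phi> (Pi\<^sub>M I M) (\<lambda>y. f (y(i := x))) \<le> (\<Sum>j\<in>I. \<integral>y. g j (y(i := x)) \<partial>Pi\<^sub>M I M)" .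
    qed
    also have "\<dots> = (\<Sum>j\<in>I. \<integral>x. (\<integral>y. g j (y(i := x)) \<partial>Pi\<^sub>M I M) \<partial>M i)"
      using gix by (rule Bochner_Integration.integral_sum)
    also have "\<dots> = (\<Sum>j\<in>I. \<integral>y. g j y \<partial>Pi\<^sub>M (insert i I) M)"
      by (intro sum.cong refl PiM_integral_insert_bounded(2)[symmetric, OF M insert.hyps gm' gb]) auto
    finally show ?thesis .
  qed
  finally show ?case using insert.hyps unfolding g_int by (simp add: add.commute)
qed

text \<open>For the square, the defect in the tangent inequality is the variance of
  \<open>g - h\<close>.\<close>

lemma tensor_fun_square:
  assumes "l \<le> u"
  shows "tensor_fun (\<lambda>x. x\<^sup>2) (\<lambda>x. 2 * x) l u ((\<bar>l\<bar> + \<bar>u\<bar>)\<^sup>2 + 2 * (\<bar>l\<bar> + \<bar>u\<bar>))"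
proof
  have K: "\<bar>x\<bar> \<le> \<bar>l\<bar> + \<bar>u\<bar>" if "l \<le> x" "x \<le> u" for x using that by linarith
  show "\<bar>x\<^sup>2\<bar> \<le> (\<bar>l\<bar> + \<bar>u\<bar>)\<^sup>2 + 2 * (\<bar>l\<bar> + \<bar>u\<bar>)" if "l \<le> x" "x \<le> u" for x
    using power_mono[OF K[OF that], of 2] by simp
  show "\<bar>2 * x\<bar> \<le> (\<bar>l\<bar> + \<bar>u\<bar>)\<^sup>2 + 2 * (\<bar>l\<bar> + \<bar>u\<bar>)" if "l \<le> x" "x \<le> u" for x
  proof -
    have "\<bar>2 * x\<bar> = 2 * \<bar>x\<bar>" by (simp add: abs_mult)
    also have "\<dots> \<le> 0 + 2 * (\<bar>l\<bar> + \<bar>u\<bar>)" using K[OF that] by simp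
    also have "\<dots> \<le> (\<bar>l\<bar> + \<bar>u\<bar>)\<^sup>2 + 2 * (\<bar>l\<bar> + \<bar>u\<bar>)"
      by (intro add_right_mono zero_le_power2)
    finally show ?thesis .
  qed
  fix M :: "real measure" and g h :: "real \<Rightarrow> real"
  assume M: "prob_space M" and [measurable]: "g \<in> borel_measurable M" "h \<in> borel_measurable M"
    and b: "\<And>x. l \<le> g x \<and> g x \<le> u" "\<And>x. l \<le> h x \<and> h x \<le> u"
  interpret prob_space M by fact
  let ?K = "\<bar>l\<bar> + \<bar>u\<bar>"
  have Kg: "\<bar>g x\<bar> \<le> ?K" "\<bar>h x\<bar> \<le> ?K" for x using b K by auto
  have I2: "integrable M (\<lambda>x. p x * q x)"
    if [measurable]: "p \<in> borel_measurable M" "q \<in> borel_measurable M" and "\<And>x. \<bar>p x\<bar> \<le> ?K" "\<And>x. \<bar>q x\<bar> \<le> ?K" for p q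
  proof (rule integrable_const_bound[of _ "?K * ?K"])
    have "\<bar>p x * q x\<bar> \<le> ?K * ?K" for x unfolding abs_mult using that by (intro mult_mono) auto
    then show "AE x in M. norm (p x * q x) \<le> ?K * ?K" by simp
  qed measurable
  have I: "integrable M g" "integrable M h" "integrable M (\<lambda>x. g x * g x)" "integrable M (\<lambda>x. h x * h x)"
     "integrable M (\<lambda>x. g x * h x)"
    using Kg I2 by (auto intro!: integrable_const_bound[of _ ?K])
  define p q where "p = (\<integral>x. g x \<partial>M)" and "q = (\<integral>x. h x \<partial>M)"
  have "0 \<le> (\<integral>x. ((g x - h x) - (p - q))\<^sup>2 \<partial>M)" by (rule Bochner_Integration.integral_nonneg) simp
  also have "\<dots> = (\<integral>x. g x * g x + h x * h x + (p - q)\<^sup>2 - 2 * (g x * h x) - 2 * (p - q) * g x + 2 * (p - q) * h x \<partial>M)"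
    by (intro Bochner_Integration.integral_cong) (auto simp: power2_eq_square algebra_simps)
  also have "\<dots> = (\<integral>x. g x * g x \<partial>M) + (\<integral>x. h x * h x \<partial>M) + (p - q)\<^sup>2 - 2 * (\<integral>x. g x * h x \<partial>M)
      - 2 * (p - q) * p + 2 * (p - q) * q"
    using I by (simp add: prob_space p_def[symmetric] q_def[symmetric])
  finally have 1: "0 \<le> \<dots>" .
  have "(\<integral>x. (2 * h x - 2 * q) * (g x - h x) \<partial>M) =
      (\<integral>x. 2 * (g x * h x) - 2 * (h x * h x) - 2 * q * g x + 2 * q * h x \<partial>M)"
    by (intro Bochner_Integration.integral_cong) (auto simp: algebra_simps)
  also have "\<dots> = 2 * (\<integral>x. g x * h x \<partial>M) - 2 * (\<integral>x. h x * h x \<partial>M) - 2 * q * p + 2 * q * q"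
    using I by (simp add: p_def[symmetric] q_def[symmetric])
  finally show "jensen_gap (\<lambda>x. x\<^sup>2) M h + (\<integral>x. (2 * h x - 2 * (\<integral>x. h x \<partial>M)) * (g x - h x) \<partial>M)
       \<le> jensen_gap (\<lambda>x. x\<^sup>2) M g"
    using 1 unfolding jensen_gap_def p_def[symmetric] q_def[symmetric]
    by (simp add: power2_eq_square algebra_simps)
qed (use assms in auto)

lemma abs_xlnx_le:
  assumes "0 < l" "l \<le> x" "x \<le> u"
  shows "\<bar>ln x\<bar> \<le> \<bar>ln l\<bar> + \<bar>ln u\<bar>" "\<bar>xlnx x\<bar> \<le> u * (\<bar>ln l\<bar> + \<bar>ln u\<bar>)"
proof -
  have "ln l \<le> ln x" "ln x \<le> ln u" using assms by auto
  then show *: "\<bar>ln x\<bar> \<le> \<bar>ln l\<bar> + \<bar>ln u\<bar>" by linarith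
  show "\<bar>xlnx x\<bar> \<le> u * (\<bar>ln l\<bar> + \<bar>ln u\<bar>)"
    unfolding abs_mult using * assms by (intro mult_mono) auto
qed

text \<open>For the entropy, the defect in the tangent inequality is the mean \<open>p\<close> of
  \<open>g\<close> times the relative entropy of \<open>g / p\<close> with respect to
  \<open>h / q\<close>. Its nonnegativity comes from \<open>ln t \<le> t - 1\<close> at
  \<open>t = p / q * h / g\<close>.\<close>

lemma tensor_fun_xlnx:
  assumes "0 < l" "l \<le> u"
  shows "tensor_fun xlnx ln l u (u * (\<bar>ln l\<bar> + \<bar>ln u\<bar>) + (\<bar>ln l\<bar> + \<bar>ln u\<bar>))"
proof
  show "\<bar>xlnx x\<bar> \<le> u * (\<bar>ln l\<bar> + \<bar>ln u\<bar>) + (\<bar>ln l\<bar> + \<bar>ln u\<bar>)"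
    "\<bar>ln x\<bar> \<le> u * (\<bar>ln l\<bar> + \<bar>ln u\<bar>) + (\<bar>ln l\<bar> + \<bar>ln u\<bar>)" if "l \<le> x" "x \<le> u" for x
    using abs_xlnx_le[OF assms(1) that] assms that by (smt (verit) mult_nonneg_nonneg)+
  fix M :: "real measure" and g h :: "real \<Rightarrow> real"
  assume M: "prob_space M" and [measurable]: "g \<in> borel_measurable M" "h \<in> borel_measurable M"
    and b: "\<And>x. l \<le> g x \<and> g x \<le> u" "\<And>x. l \<le> h x \<and> h x \<le> u"
  interpret prob_space M by fact
  let ?L = "\<bar>ln l\<bar> + \<bar>ln u\<bar>"
  have pos: "g x > 0" "h x > 0" for x using b assms by (meson less_le_trans)+
  have I2: "integrable M p" if "p \<in> borel_measurable M" "\<And>x. l \<le> p x \<and> p x \<le> u" for p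
  proof (rule integrable_const_bound[of _ u])
    have "\<bar>p x\<bar> \<le> u" for x using that(2)[of x] assms by linarith
    then show "AE x in M. norm (p x) \<le> u" by simp
  qed (rule that)
  have I3: "integrable M (\<lambda>x. p x * ln (q x))"
    if [measurable]: "p \<in> borel_measurable M" "q \<in> borel_measurable M"
      and b: "\<And>x. l \<le> p x \<and> p x \<le> u" "\<And>x. l \<le> q x \<and> q x \<le> u" for p q
  proof (rule integrable_const_bound[of _ "u * ?L"])
    have "\<bar>p x * ln (q x)\<bar> \<le> u * ?L" for x
      unfolding abs_mult using abs_xlnx_le(1)[OF assms(1), of "q x" u] b[of x] assms by (intro mult_mono) auto
    then show "AE x in M. norm (p x * ln (q x)) \<le> u * ?L" by simp
  qed measurable
  define p q where "p = (\<integral>x. g x \<partial>M)" and "q = (\<integral>x. h x \<partial>M)"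
  have Ig: "integrable M g" "integrable M h" by (intro I2 b; measurable)+
  have "l \<le> p" "l \<le> q" unfolding p_def q_def using b by (intro integral_ge_const Ig; simp)+
  then have pq: "p > 0" "q > 0" using assms by auto
  have I: "integrable M g" "integrable M h" "integrable M (\<lambda>x. g x * ln (g x))" "integrable M (\<lambda>x. h x * ln (h x))"
     "integrable M (\<lambda>x. g x * ln (h x))"
    by (intro Ig I3 b; measurable)+
  have "(\<integral>x. g x - p / q * h x \<partial>M) \<le> (\<integral>x. g x * ln (g x) - g x * ln (h x) - ln (p / q) * g x \<partial>M)"
  proof (rule integral_mono)
    fix x
    have "ln (p / q * h x / g x) \<le> p / q * h x / g x - 1" using pos pq by (intro ln_le_minus_one) auto
    then have "g x * ln (p / q * h x / g x) \<le> g x * (p / q * h x / g x - 1)"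
      using pos by (intro mult_left_mono) (auto simp: less_imp_le)
    also have "\<dots> = p / q * h x - g x" using pos[of x] by (simp add: algebra_simps)
    also have "ln (p / q * h x / g x) = ln (p / q) + ln (h x) - ln (g x)" using pos[of x] pq by (simp add: ln_mult ln_div)
    finally show "g x - p / q * h x \<le> g x * ln (g x) - g x * ln (h x) - ln (p / q) * g x" by (simp add: algebra_simps)
  qed (use I in auto)
  moreover have "(\<integral>x. g x - p / q * h x \<partial>M) = p - p / q * q" using I by (simp add: p_def[symmetric] q_def[symmetric])
  ultimately have 1: "0 \<le> (\<integral>x. g x * ln (g x) \<partial>M) - (\<integral>x. g x * ln (h x) \<partial>M) - ln (p / q) * p"
    using I pq by (simp add: p_def[symmetric] q_def[symmetric])
  have "(\<integral>x. (ln (h x) - ln q) * (g x - h x) \<partial>M) = (\<integral>x. g x * ln (h x) - h x * ln (h x) - ln q * g x + ln q * h x \<partial>M)"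
    by (intro Bochner_Integration.integral_cong) (auto simp: algebra_simps)
  also have "\<dots> = (\<integral>x. g x * ln (h x) \<partial>M) - (\<integral>x. h x * ln (h x) \<partial>M) - ln q * p + ln q * q"
    using I by (simp add: p_def[symmetric] q_def[symmetric])
  finally show "jensen_gap xlnx M h + (\<integral>x. (ln (h x) - ln (\<integral>x. h x \<partial>M)) * (g x - h x) \<partial>M)
       \<le> jensen_gap xlnx M g"
    using 1 pq unfolding jensen_gap_def p_def[symmetric] q_def[symmetric]
    by (simp add: ln_div algebra_simps)
qed (use assms in auto)

section \<open>Logarithmic Sobolev inequality for all gamma laws\<close>

text \<open>The substitution \<open>y = x * t\<close> turns the convolution into the integral for
  \<open>Beta r r\<close>, whose value supplies the factor \<open>Gamma (2 * r)\<close>.\<close>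

lemma gdens_convolution:
  assumes "r > 0"
  shows "(\<integral>\<^sup>+y. ennreal (gdens r (x - y)) * ennreal (gdens r y) \<partial>lborel) = ennreal (gdens (2 * r) x)"
proof (cases "x > 0")
  case False
  have "gdens r (x - y) * gdens r y = 0" for y
    using False gdens_zero[of y r] gdens_zero[of "x - y" r] by (cases "y \<le> 0") auto
  then have "(\<lambda>y. ennreal (gdens r (x - y)) * ennreal (gdens r y)) = (\<lambda>_. 0)"
    using gdens_nonneg[OF assms] by (simp add: fun_eq_iff flip: ennreal_mult')
  then show ?thesis using False by (simp only:) (simp add: gdens_zero)
next
  case x: True
  define c where "c = x powr (2 * r - 2) * exp (- x) / (Gamma r)\<^sup>2"
  have c: "c \<ge> 0" by (simp add: c_def)
  have eq: "gdens r (x - x * t) * gdens r (x * t) = c * (indicator {0..1} t * (t powr (r - 1) * (1 - t) powr (r - 1)))" for t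
  proof (cases "0 < t \<and> t < 1")
    case True
    have e1: "x - x * t = x * (1 - t)" by (simp add: algebra_simps)
    have e2: "gdens r (x * (1 - t)) = x powr (r - 1) * (1 - t) powr (r - 1) * exp (- (x * (1 - t))) / Gamma r"
      using x True by (subst gdens_eq) (auto simp: powr_mult)
    have e3: "gdens r (x * t) = x powr (r - 1) * t powr (r - 1) * exp (- (x * t)) / Gamma r"
      using x True by (subst gdens_eq) (auto simp: powr_mult)
    have e4: "exp (- (x * (1 - t))) * exp (- (x * t)) = exp (- x)" by (simp add: algebra_simps flip: exp_add)
    have e5: "x powr (r - 1) * x powr (r - 1) = x powr (2 * r - 2)" using x by (simp flip: powr_add)
    have alg: "(a * b * e / G) * (a * d * f / G) = (a * a) * (e * f) / G\<^sup>2 * (d * b)" for a b d e f G :: real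
      by (simp add: power2_eq_square)
    have "gdens r (x - x * t) * gdens r (x * t) = c * (t powr (r - 1) * (1 - t) powr (r - 1))"
      unfolding e1 e2 e3 alg e4 e5 by (simp add: c_def)
    then show ?thesis using True by simp
  next
    case False
    then consider "t \<le> 0" | "t \<ge> 1" by linarith
    then show ?thesis
    proof cases
      case 1
      then have "x * t \<le> 0" using x by (simp add: mult_nonneg_nonpos)
      then show ?thesis using 1 by (auto simp: gdens_zero indicator_def)
    next
      case 2
      then have "x - x * t \<le> 0" using x by simp
      then show ?thesis using 2 by (auto simp: gdens_zero indicator_def)
    qed
  qed
  have "(\<integral>\<^sup>+y. ennreal (gdens r (x - y)) * ennreal (gdens r y) \<partial>lborel)
      = ennreal \<bar>x\<bar> * (\<integral>\<^sup>+t. ennreal (gdens r (x - (0 + x * t))) * ennreal (gdens r (0 + x * t)) \<partial>lborel)"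
    using x by (intro nn_integral_real_affine) auto
  also have "(\<integral>\<^sup>+t. ennreal (gdens r (x - (0 + x * t))) * ennreal (gdens r (0 + x * t)) \<partial>lborel)
      = (\<integral>\<^sup>+t. ennreal c * ennreal (indicator {0..1} t * (t powr (r - 1) * (1 - t) powr (r - 1))) \<partial>lborel)"
    using eq c gdens_nonneg[OF assms] by (intro nn_integral_cong) (simp flip: ennreal_mult')
  also have "\<dots> = ennreal c * (\<integral>\<^sup>+t. ennreal (indicator {0..1} t * (t powr (r - 1) * (1 - t) powr (r - 1))) \<partial>lborel)"
    by (rule nn_integral_cmult) measurable
  also have "(\<integral>\<^sup>+t. ennreal (indicator {0..1} t * (t powr (r - 1) * (1 - t) powr (r - 1))) \<partial>lborel) = ennreal (Beta r r)"
    using nn_integral_has_integral_lebesgue[OF _ has_integral_Beta_real[OF assms assms]] by simp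
  also have "ennreal \<bar>x\<bar> * (ennreal c * ennreal (Beta r r)) = ennreal (x * (c * Beta r r))"
    using x c by (simp add: ennreal_mult')
  also have "x * (c * Beta r r) = gdens (2 * r) x"
  proof -
    have "Gamma r \<noteq> 0" "Gamma (2 * r) \<noteq> 0" using Gamma_real_pos[of r] Gamma_real_pos[of "2 * r"] assms by linarith+
    moreover have "x * x powr (2 * r - 2) = x powr (2 * r - 1)"
      using x powr_mult_base[of x "2 * r - 2"] by (simp add: algebra_simps)
    ultimately show ?thesis using x
      by (simp add: c_def Beta_def gdens_eq power2_eq_square field_simps mult_2)
  qed
  finally show ?thesis .
qed

lemma gamma_law_convolution:
  assumes "r > 0"
  shows "distr (gamma_law r \<Otimes>\<^sub>M gamma_law r) borel (\<lambda>(x, y). x + y) = gamma_law (2 * r)"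
proof -
  have fm: "finite_measure (density lborel (\<lambda>x. ennreal (gdens r x)))"
    using prob_space.finite_measure[OF prob_space_gamma_law[of r]] assms by (simp add: gamma_law_eq)
  have "gamma_law r \<star> gamma_law r = gamma_law (2 * r)"
    using convolution_density[of "\<lambda>x. ennreal (gdens r x)" "\<lambda>x. ennreal (gdens r x)"] fm assms
    by (simp add: gamma_law_eq gdens_convolution)
  then show ?thesis by (simp add: convolution_def)
qed

text \<open>Apply subadditivity to \<open>g (x + y)\<close> under the product of two copies of
  \<open>gamma_law r\<close>. The two partial energies carry the weights \<open>x\<close> and
  \<open>y\<close> in front of the same function \<open>W (x + y)\<close>, so their sum has the
  weight \<open>x + y\<close> of the doubled law and the constant is preserved.\<close>

lemma gamma_lsi_double:
  assumes r: "r > 0" and C: "C \<ge> 0" and lsi: "gamma_lsi r C"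
  shows "gamma_lsi (2 * r) C"
  unfolding gamma_lsi_def
proof (intro allI impI, elim conjE)
  fix g g' :: "real \<Rightarrow> real" and l u K :: real
  assume [measurable]: "g \<in> borel_measurable borel" "g' \<in> borel_measurable borel"
    and l: "0 < l" and b: "\<forall>x. l \<le> g x \<and> g x \<le> u \<and> \<bar>g' x\<bar> \<le> K"
    and d: "\<forall>x>0. (g has_real_derivative g' x) (at x)"
  have lu: "l \<le> u" using b by (meson order_trans)
  interpret tensor_fun xlnx ln l u "u * (\<bar>ln l\<bar> + \<bar>ln u\<bar>) + (\<bar>ln l\<bar> + \<bar>ln u\<bar>)"
    by (rule tensor_fun_xlnx[OF l lu])
  define M where "M = gamma_law r"
  have sM [measurable_cong, simp]: "sets M = sets borel" and spM [simp]: "space M = UNIV" by (auto simp: M_def)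
  have pM: "prob_space M" unfolding M_def using r by (intro prob_space_gamma_law) simp
  interpret M: prob_space M by (rule pM)
  interpret P: pair_prob_space M M ..
  define W where "W x = (g' x)\<^sup>2 / g x" for x
  have [measurable]: "W \<in> borel_measurable borel" unfolding W_def by measurable
  have gpos: "g x > 0" for x using l b by (meson less_le_trans)
  have W: "0 \<le> W x" "W x \<le> K\<^sup>2 / l" for x
  proof -
    have "\<bar>g' x\<bar> \<le> K" "l \<le> g x" using b by auto
    then have "(g' x)\<^sup>2 \<le> K\<^sup>2" using power_mono[of "\<bar>g' x\<bar>" K 2] by simp
    then show "W x \<le> K\<^sup>2 / l" unfolding W_def using \<open>l \<le> g x\<close> l by (intro frac_le) auto
    show "0 \<le> W x" using gpos[of x] by (simp add: W_def)
  qed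
  have distr: "distr (M \<Otimes>\<^sub>M M) borel (\<lambda>(x, y). x + y) = gamma_law (2 * r)"
    using gamma_law_convolution[OF r] by (simp add: M_def)
  have tr: "(\<integral>x. f x \<partial>gamma_law (2 * r)) = (\<integral>z. f (fst z + snd z) \<partial>(M \<Otimes>\<^sub>M M))"
    if [measurable]: "f \<in> borel_measurable borel" for f :: "real \<Rightarrow> real"
    unfolding distr[symmetric] by (subst integral_distr) (auto simp: case_prod_unfold)
  have id: "integrable M (\<lambda>x. x)" unfolding M_def using r by (intro gamma_law_moments) simp
  have Iid: "integrable (M \<Otimes>\<^sub>M M) (\<lambda>z. fst z)" "integrable (M \<Otimes>\<^sub>M M) (\<lambda>z. snd z)"
  proof -
    show "integrable (M \<Otimes>\<^sub>M M) (\<lambda>z. fst z)"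
      using id by (intro P.Fubini_integrable) auto
    then have "integrable (M \<Otimes>\<^sub>M M) (\<lambda>(x, y). x)" by (simp add: case_prod_unfold)
    from P.integrable_product_swap[OF this] show "integrable (M \<Otimes>\<^sub>M M) (\<lambda>z. snd z)" by (simp add: case_prod_unfold)
  qed
  have IW: "integrable (M \<Otimes>\<^sub>M M) (\<lambda>z. p z * W (fst z + snd z))"
    if p: "integrable (M \<Otimes>\<^sub>M M) p" for p :: "real \<times> real \<Rightarrow> real"
  proof (rule Bochner_Integration.integrable_bound[OF integrable_mult_right[OF p, of "K\<^sup>2 / l"]])
    note [measurable] = borel_measurable_integrable[OF p]
    show "(\<lambda>z. p z * W (fst z + snd z)) \<in> borel_measurable (M \<Otimes>\<^sub>M M)" by measurable
    have "\<bar>p z * W (fst z + snd z)\<bar> \<le> \<bar>p z\<bar> * (K\<^sup>2 / l)" for z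
      unfolding abs_mult using W by (intro mult_mono) auto
    then show "AE z in M \<Otimes>\<^sub>M M. norm (p z * W (fst z + snd z)) \<le> norm (K\<^sup>2 / l * p z)"
      using l by (auto simp: abs_mult mult.commute)
  qed
  have I1: "integrable (M \<Otimes>\<^sub>M M) (\<lambda>(x, y). y * W (x + y))" and I2: "integrable (M \<Otimes>\<^sub>M M) (\<lambda>(x, y). x * W (x + y))"
    using IW[OF Iid(1)] IW[OF Iid(2)] by (auto simp: case_prod_unfold)
  \<comment> \<open>The derivative of \<open>g\<close> is given on the positive half line only, so
    the slice inequality is available for \<open>y \<ge> 0\<close>, that is, almost surely.\<close>
  have nn: "AE y in M. y \<ge> 0" unfolding M_def using r by (intro AE_gamma_law_nonneg) simp
  have slice: "jensen_gap xlnx M (\<lambda>x. g (x + y)) \<le> C * (\<integral>x. x * W (x + y) \<partial>M)" if "y \<ge> 0" for y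
  proof -
    have "((\<lambda>x. g (x + y)) has_real_derivative g' (x + y)) (at x)" if "x > 0" for x
      using d \<open>y \<ge> 0\<close> that DERIV_shift[of g "g' (x + y)" x y] by simp
    then have "jensen_gap xlnx M (\<lambda>x. g (x + y)) \<le> C * (\<integral>x. x * (g' (x + y))\<^sup>2 / g (x + y) \<partial>M)"
      using lsi[unfolded gamma_lsi_def, rule_format, of "\<lambda>x. g (x + y)" "\<lambda>x. g' (x + y)" l u K] b l
      by (simp add: M_def)
    then show ?thesis by (simp add: W_def)
  qed
  have fm: "(\<lambda>(x, y). g (x + y)) \<in> borel_measurable (M \<Otimes>\<^sub>M M)" by measurable
  have gi: "integrable M (\<lambda>y. jensen_gap xlnx M (\<lambda>x. g (x + y)))"
  proof (rule M.integrable_const_bound)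
    show "(\<lambda>y. jensen_gap xlnx M (\<lambda>x. g (x + y))) \<in> borel_measurable M"
      by (rule gap_measurable[OF pM]) measurable
    show "AE y in M. norm (jensen_gap xlnx M (\<lambda>x. g (x + y))) \<le> 2 * (u * (\<bar>ln l\<bar> + \<bar>ln u\<bar>) + (\<bar>ln l\<bar> + \<bar>ln u\<bar>))"
      using gap_bound[OF pM, of "\<lambda>x. g (x + y)" for y] b by (auto simp: M_def)
  qed
  have le: "(\<integral>y. jensen_gap xlnx M (\<lambda>x. g (x + y)) \<partial>M) \<le> (\<integral>y. C * (\<integral>x. x * W (x + y) \<partial>M) \<partial>M)"
    using nn slice P.integrable_snd[OF I2] by (intro integral_mono_AE gi) auto
  have e2: "(\<integral>y. (\<integral>x. x * W (x + y) \<partial>M) \<partial>M) = (\<integral>z. fst z * W (fst z + snd z) \<partial>(M \<Otimes>\<^sub>M M))"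
    using P.integral_snd[OF I2] by (simp add: case_prod_unfold)
  have e1: "(\<integral>x. (\<integral>y. y * W (x + y) \<partial>M) \<partial>M) = (\<integral>z. snd z * W (fst z + snd z) \<partial>(M \<Otimes>\<^sub>M M))"
    using P.integral_fst'[OF I1] by (simp add: case_prod_unfold)
  have sw: "(\<lambda>x. g (x + y)) = (\<lambda>x. g (y + x))" "(\<lambda>x. x * W (x + y)) = (\<lambda>x. x * W (y + x))" for y
    by (simp_all add: add.commute)
  have "jensen_gap xlnx (gamma_law (2 * r)) g = jensen_gap xlnx (M \<Otimes>\<^sub>M M) (\<lambda>(x, y). g (x + y))"
    unfolding jensen_gap_def by (simp add: tr case_prod_unfold)
  also have "\<dots> \<le> (\<integral>x. jensen_gap xlnx M (\<lambda>y. g (x + y)) \<partial>M) + (\<integral>y. jensen_gap xlnx M (\<lambda>x. g (x + y)) \<partial>M)"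
    by (rule gap_pair[OF pM pM fm]) (use b in auto)
  also have "\<dots> \<le> (\<integral>x. C * (\<integral>y. y * W (x + y) \<partial>M) \<partial>M) + (\<integral>y. C * (\<integral>x. x * W (x + y) \<partial>M) \<partial>M)"
    using le le[unfolded sw] by (intro add_mono) auto
  also have "\<dots> = C * ((\<integral>z. snd z * W (fst z + snd z) \<partial>(M \<Otimes>\<^sub>M M)) + (\<integral>z. fst z * W (fst z + snd z) \<partial>(M \<Otimes>\<^sub>M M)))"
    by (simp add: e1 e2 ring_distribs)
  also have "\<dots> = C * (\<integral>z. (fst z + snd z) * W (fst z + snd z) \<partial>(M \<Otimes>\<^sub>M M))"
    using IW[OF Iid(1)] IW[OF Iid(2)] by (simp add: ring_distribs)
  also have "(\<integral>z. (fst z + snd z) * W (fst z + snd z) \<partial>(M \<Otimes>\<^sub>M M)) = (\<integral>x. x * W x \<partial>gamma_law (2 * r))"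
    by (simp add: tr)
  finally show "jensen_gap xlnx (gamma_law (2 * r)) g \<le> C * (\<integral>x. x * (g' x)\<^sup>2 / g x \<partial>gamma_law (2 * r))"
    by (simp add: W_def)
qed

lemma gamma_lsi_mono:
  assumes r: "r \<ge> 0" and "gamma_lsi r C" "C \<le> D" shows "gamma_lsi r D"
  unfolding gamma_lsi_def
proof (intro allI impI)
  fix g g' :: "real \<Rightarrow> real" and l u K :: real
  assume a: "g \<in> borel_measurable borel \<and> g' \<in> borel_measurable borel \<and> 0 < l \<and>
     (\<forall>x. l \<le> g x \<and> g x \<le> u \<and> \<bar>g' x\<bar> \<le> K) \<and> (\<forall>x>0. (g has_real_derivative g' x) (at x))"
  then have "g x > 0" for x by (meson less_le_trans)
  then have "0 \<le> (\<integral>x. x * (g' x)\<^sup>2 / g x \<partial>gamma_law r)"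
    using AE_gamma_law_nonneg[OF r] by (intro integral_nonneg_AE) (auto simp: less_imp_le)
  then have "C * (\<integral>x. x * (g' x)\<^sup>2 / g x \<partial>gamma_law r) \<le> D * (\<integral>x. x * (g' x)\<^sup>2 / g x \<partial>gamma_law r)"
    using assms(3) by (rule mult_right_mono[rotated])
  moreover have "jensen_gap xlnx (gamma_law r) g \<le> C * (\<integral>x. x * (g' x)\<^sup>2 / g x \<partial>gamma_law r)"
    using assms(2) a unfolding gamma_lsi_def by blast
  ultimately show "jensen_gap xlnx (gamma_law r) g \<le> D * (\<integral>x. x * (g' x)\<^sup>2 / g x \<partial>gamma_law r)" by linarith
qed

text \<open>Halving brings a large \<open>r\<close> into \<open>(1/2, 1]\<close>, where
  \<open>4 / r\<close> is below 8, and \<open>gamma_lsi_double\<close> carries this 8 back up. For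
  \<open>r \<le> 1\<close> the constant \<open>4 / r\<close> is used directly.\<close>

lemma gamma_lsi:
  assumes "r > 0" shows "gamma_lsi r (8 / min 1 r)"
proof -
  obtain n where "r \<le> 2 ^ n" using real_arch_pow[of 2 r] by (auto intro: less_imp_le)
  then show ?thesis using assms
  proof (induction n arbitrary: r)
    case 0
    then show ?case
      by (intro gamma_lsi_mono[OF _ gamma_lsi_small]) (auto simp: min_def divide_right_mono)
  next
    case (Suc n)
    show ?case
    proof (cases "r \<le> 1")
      case True
      then show ?thesis using Suc.prems
        by (intro gamma_lsi_mono[OF _ gamma_lsi_small]) (auto simp: min_def divide_right_mono)
    next
      case False
      have "gamma_lsi (r / 2) 8"
      proof (cases "r / 2 \<le> 1")
        case True
        then have "gamma_lsi (r / 2) (4 / (r / 2))" using Suc.prems by (intro gamma_lsi_small) auto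
        then show ?thesis
          by (rule gamma_lsi_mono[rotated]) (use False in \<open>auto simp: field_simps\<close>)
      next
        case False
        then show ?thesis using Suc.IH[of "r / 2"] Suc.prems by auto
      qed
      from gamma_lsi_double[OF _ _ this] show ?thesis using False by (simp add: min_def)
    qed
  qed
qed

text \<open>Partitions may contain blocks of \<open>\<nu>\<close>-mass 0. Their law is the point
  mass at 0, for which entropy and energy are both 0.\<close>

lemma gamma_lsi_nonneg:
  assumes "C > 0" "r = 0 \<or> 8 / min 1 r \<le> C" "r \<ge> 0"
  shows "gamma_lsi r C"
proof (cases "r = 0")
  case True
  have z: "(\<integral>x. f x \<partial>gamma_law 0) = f 0" if "f \<in> borel_measurable borel" for f :: "real \<Rightarrow> real"
    using that by (rule integral_gamma_law_0)
  show ?thesis unfolding gamma_lsi_def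
  proof (intro allI impI, elim conjE)
    fix g g' :: "real \<Rightarrow> real"
    assume [measurable]: "g \<in> borel_measurable borel" "g' \<in> borel_measurable borel"
    show "jensen_gap xlnx (gamma_law r) g \<le> C * (\<integral>x. x * (g' x)\<^sup>2 / g x \<partial>gamma_law r)"
      unfolding jensen_gap_def True
      using z[of "\<lambda>x. xlnx (g x)"] z[of g] z[of "\<lambda>x. x * (g' x)\<^sup>2 / g x"] by simp
  qed
next
  case False
  then show ?thesis using assms gamma_lsi_mono[OF _ gamma_lsi] by simp
qed

section \<open>Cylinder functions\<close>

definition cvec :: "nat \<Rightarrow> (nat \<Rightarrow> 'a set) \<Rightarrow> 'a measure \<Rightarrow> nat \<Rightarrow> real" where
  "cvec n A \<eta> = (\<lambda>i. if i < n then measure \<eta> (A i) else 0)"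

text \<open>Points of the \<open>n\<close>-dimensional space are represented by sequences that may
  disagree beyond \<open>n\<close>: \<open>cvec\<close> continues with 0, the finite product measure
  with \<open>undefined\<close>. This condition makes the choice irrelevant.\<close>

definition depends_below :: "nat \<Rightarrow> ((nat \<Rightarrow> real) \<Rightarrow> real) \<Rightarrow> bool" where
  "depends_below n h \<longleftrightarrow> (\<forall>y z. (\<forall>i<n. y i = z i) \<longrightarrow> h y = h z)"

text \<open>The bounds on \<open>y i * d i y\<close> and \<open>y i * dd i y\<close> record what
  compact support gives beyond boundedness: masses are unbounded, but in the form and in the
  generator they occur as weights of derivatives.\<close>

definition smooth_cyl :: "nat \<Rightarrow> ((nat \<Rightarrow> real) \<Rightarrow> real) \<Rightarrow> (nat \<Rightarrow> (nat \<Rightarrow> real) \<Rightarrow> real)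
    \<Rightarrow> (nat \<Rightarrow> (nat \<Rightarrow> real) \<Rightarrow> real) \<Rightarrow> real \<Rightarrow> bool" where
  "smooth_cyl n g d dd K \<longleftrightarrow>
     g \<in> borel_measurable borel \<and> depends_below n g \<and> (\<forall>y. \<bar>g y\<bar> \<le> K) \<and>
     (\<forall>i<n. d i \<in> borel_measurable borel \<and> dd i \<in> borel_measurable borel \<and>
        depends_below n (d i) \<and> depends_below n (dd i) \<and>
        (\<forall>y. \<bar>d i y\<bar> \<le> K \<and> \<bar>dd i y\<bar> \<le> K \<and> \<bar>y i * d i y\<bar> \<le> K \<and> \<bar>y i * dd i y\<bar> \<le> K) \<and>
        (\<forall>y t. ((\<lambda>t. g (y(i := t))) has_real_derivative d i (y(i := t))) (at t)) \<and>
        (\<forall>y t. ((\<lambda>t. d i (y(i := t))) has_real_derivative dd i (y(i := t))) (at t)))"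

lemma smooth_cylD:
  assumes "smooth_cyl n g d dd K"
  shows "g \<in> borel_measurable borel" "depends_below n g" "\<bar>g y\<bar> \<le> K"
    "i < n \<Longrightarrow> d i \<in> borel_measurable borel" "i < n \<Longrightarrow> dd i \<in> borel_measurable borel"
    "i < n \<Longrightarrow> depends_below n (d i)" "i < n \<Longrightarrow> depends_below n (dd i)"
    "i < n \<Longrightarrow> \<bar>d i y\<bar> \<le> K" "i < n \<Longrightarrow> \<bar>dd i y\<bar> \<le> K" "i < n \<Longrightarrow> \<bar>y i * d i y\<bar> \<le> K" "i < n \<Longrightarrow> \<bar>y i * dd i y\<bar> \<le> K"
    "i < n \<Longrightarrow> ((\<lambda>t. g (y(i := t))) has_real_derivative d i (y(i := t))) (at t)"
    "i < n \<Longrightarrow> ((\<lambda>t. d i (y(i := t))) has_real_derivative dd i (y(i := t))) (at t)"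
  using assms unfolding smooth_cyl_def by blast+

lemma trunc_vec_upd: "i < n \<Longrightarrow> (trunc_vec n y)(i := t) = trunc_vec n (y(i := t))"
  by (auto simp: trunc_vec_def)

lemma trunc_vec_trunc_vec [simp]: "trunc_vec n (trunc_vec n y) = trunc_vec n y"
  by (auto simp: trunc_vec_def)

lemma iter_partial_trunc:
  assumes "\<And>y. h (trunc_vec n y) = h y" "set is \<subseteq> {..<n}"
  shows "iter_partial is h (trunc_vec n y) = iter_partial is h y"
  using assms(2)
proof (induction "is" arbitrary: y)
  case Nil then show ?case using assms(1) by simp
next
  case (Cons i "is")
  then have i: "i < n" and IH: "\<And>y. iter_partial is h (trunc_vec n y) = iter_partial is h y" by auto
  have "trunc_vec n y i = y i" using i by (simp add: trunc_vec_def)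
  then show ?case by (simp add: partial_d_def trunc_vec_upd[OF i] IH)
qed

text \<open>The region \<open>\<bar>y j\<bar> > B\<close> is open along every coordinate line, so a
  function that vanishes on it has vanishing partial derivatives there.\<close>

lemma iter_partial_support:
  assumes "\<And>y. \<bar>y j\<bar> > B \<Longrightarrow> h y = 0"
  shows "\<bar>y j\<bar> > B \<Longrightarrow> iter_partial is h y = 0"
proof (induction "is" arbitrary: y)
  case Nil then show ?case using assms by simp
next
  case (Cons i "is")
  have "\<forall>\<^sub>F t in nhds (y i). \<bar>(y(i := t)) j\<bar> > B"
  proof (cases "i = j")
    case True
    have "open {t::real. \<bar>t\<bar> > B}" by (intro open_Collect_less continuous_intros)
    then show ?thesis using eventually_nhds_in_open[of "{t. \<bar>t\<bar> > B}" "y i"] Cons.prems True by simp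
  qed (use Cons.prems in simp)
  then have "\<forall>\<^sub>F t in nhds (y i). iter_partial is h (y(i := t)) = 0"
    by eventually_elim (rule Cons.IH)
  then have "deriv (\<lambda>t. iter_partial is h (y(i := t))) (y i) = deriv (\<lambda>t. 0) (y i)"
    by (rule deriv_cong_ev) simp
  then show ?case by (simp add: partial_d_def)
qed

text \<open>Tychonoff's theorem: in the product topology the box is compact once the coordinates
  beyond \<open>n\<close> are pinned to 0.\<close>

lemma compact_box: "compact {y :: nat \<Rightarrow> real. \<forall>i. y i \<in> (if i < n then {- B..B} else {0})}"
proof -
  have "compactin (product_topology (\<lambda>_. euclidean) UNIV) (PiE UNIV (\<lambda>i. if i < n then {- B..B} else {0::real}))"
    unfolding compactin_PiE by auto
  moreover have "PiE UNIV (\<lambda>i. if i < n then {- B..B} else {0}) = {y :: nat \<Rightarrow> real. \<forall>i. y i \<in> (if i < n then {- B..B} else {0})}"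
    by (auto simp: PiE_def Pi_def)
  ultimately show ?thesis by (simp add: euclidean_product_topology)
qed

lemma bounded_if_compact_support:
  assumes cont: "continuous_on UNIV h" and tr: "\<And>y. h (trunc_vec n y) = h y"
    and supp: "\<And>y i. i < n \<Longrightarrow> \<bar>y i\<bar> > B \<Longrightarrow> h y = 0"
  shows "\<exists>K. \<forall>y. \<bar>h y\<bar> \<le> (K::real)"
proof -
  let ?S = "{y :: nat \<Rightarrow> real. \<forall>i. y i \<in> (if i < n then {- B..B} else {0})}"
  have "compact (h ` ?S)" by (rule compact_continuous_image[OF continuous_on_subset[OF cont] compact_box]) simp
  then have "bounded (h ` ?S)" by (rule compact_imp_bounded)
  then have "\<exists>K. \<forall>z\<in>h ` ?S. norm z \<le> K" by (simp only: bounded_iff)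
  then obtain K where K': "\<forall>z\<in>h ` ?S. norm z \<le> K" by (elim exE)
  have K: "\<bar>h y\<bar> \<le> K" if "y \<in> ?S" for y using bspec[OF K' imageI[OF that]] by simp
  have "\<bar>h y\<bar> \<le> \<bar>K\<bar>" for y
  proof (cases "\<exists>i<n. \<bar>y i\<bar> > B")
    case True then show ?thesis using supp by auto
  next
    case False
    then have "\<bar>y i\<bar> \<le> B" if "i < n" for i using that by (meson not_less)
    then have "- B \<le> y i \<and> y i \<le> B" if "i < n" for i using that by (simp add: abs_le_iff minus_le_iff)
    then have "trunc_vec n y \<in> ?S" by (simp add: trunc_vec_def)
    then show ?thesis using K[of "trunc_vec n y"] tr by simp
  qed
  then show ?thesis by blast
qed

lemma C0_infty_smooth_cyl:
  assumes "C0_infty n f"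
  shows "\<exists>K. smooth_cyl n (\<lambda>y. f (trunc_vec n y)) (\<lambda>i. partial_d i (\<lambda>y. f (trunc_vec n y)))
     (\<lambda>i. partial_d i (partial_d i (\<lambda>y. f (trunc_vec n y)))) K"
proof -
  define g where "g y = f (trunc_vec n y)" for y
  have cont: "continuous_on UNIV (iter_partial is g)"
    and diff: "\<And>i y. i < n \<Longrightarrow> (\<lambda>t. iter_partial is g (y(i := t))) differentiable (at (y i))"
    if "set is \<subseteq> {..<n}" for "is"
    using assms that unfolding C0_infty_def Let_def g_def[symmetric] by blast+
  obtain B where B: "\<And>y i. i < n \<Longrightarrow> \<bar>y i\<bar> > B \<Longrightarrow> g y = 0"
    using assms unfolding C0_infty_def Let_def g_def[symmetric] by blast
  have tr: "iter_partial is g (trunc_vec n y) = iter_partial is g y" if "set is \<subseteq> {..<n}" for "is" y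
    by (rule iter_partial_trunc[OF _ that]) (simp add: g_def)
  have supp: "iter_partial is g y = 0" if "i < n" "\<bar>y i\<bar> > B" for "is" y i
    using that by (intro iter_partial_support[where j = i and B = B]) (auto intro: B)
  have dep: "depends_below n (iter_partial is g)" if "set is \<subseteq> {..<n}" for "is"
    unfolding depends_below_def
  proof (intro allI impI)
    fix y z :: "nat \<Rightarrow> real" assume "\<forall>i<n. y i = z i"
    then have "trunc_vec n y = trunc_vec n z" by (auto simp: trunc_vec_def)
    then show "iter_partial is g y = iter_partial is g z" using tr[OF that] by metis
  qed
  have der: "((\<lambda>t. iter_partial is g (y(i := t))) has_real_derivative iter_partial (i # is) g (y(i := t))) (at t)"
    if "set is \<subseteq> {..<n}" "i < n" for "is" y i t
    using diff[OF that, of "y(i := t)"] by (simp add: partial_d_def DERIV_deriv_iff_real_differentiable)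
  have "\<exists>K. \<forall>y. \<bar>iter_partial is g y\<bar> \<le> K" if "set is \<subseteq> {..<n}" for "is"
    using cont[OF that] tr[OF that] supp by (rule bounded_if_compact_support)
  then obtain K where K: "\<And>is y. set is \<subseteq> {..<n} \<Longrightarrow> \<bar>iter_partial is g y\<bar> \<le> K is" by metis
  define L where "L = \<bar>K []\<bar> + (\<Sum>i<n. \<bar>K [i]\<bar> + \<bar>K [i, i]\<bar>)"
  have L0: "L \<ge> 0" by (auto simp: L_def intro!: add_nonneg_nonneg sum_nonneg)
  have sn: "0 \<le> (\<Sum>i<n. \<bar>K [i]\<bar> + \<bar>K [i, i]\<bar>)" by (auto intro!: sum_nonneg)
  have L1: "\<bar>g y\<bar> \<le> L" for y using K[of "[]" y] sn by (simp add: L_def)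
  have sm: "\<bar>K [i]\<bar> + \<bar>K [i, i]\<bar> \<le> (\<Sum>i<n. \<bar>K [i]\<bar> + \<bar>K [i, i]\<bar>)" if "i < n" for i
    using that by (intro member_le_sum) auto
  have L2: "\<bar>iter_partial [i] g y\<bar> \<le> L" "\<bar>iter_partial [i, i] g y\<bar> \<le> L" if "i < n" for i y
    using K[of "[i]" y] K[of "[i, i]" y] sm[OF that] that by (auto simp: L_def)
  \<comment> \<open>\<open>L\<close> bounds the function and its derivatives. On the support
    \<open>y i\<close> is at most \<open>\<bar>B\<bar>\<close>, so the factor
    \<open>1 + \<bar>B\<bar>\<close> also covers their products with \<open>y i\<close>.\<close>
  define M where "M = L * (1 + \<bar>B\<bar>)"
  have LM: "L \<le> M" "L * \<bar>B\<bar> \<le> M" using L0 by (auto simp: M_def algebra_simps)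
  have L3: "\<bar>y i * iter_partial is g y\<bar> \<le> M" if "i < n" "\<bar>iter_partial is g y\<bar> \<le> L" for i y "is"
  proof (cases "\<bar>y i\<bar> > B")
    case True then show ?thesis using supp[of i y "is"] that(1) True LM L0 by simp
  next
    case False
    then have "\<bar>iter_partial is g y\<bar> * \<bar>y i\<bar> \<le> L * \<bar>B\<bar>" using that L0 by (intro mult_mono) auto
    then show ?thesis using LM by (simp add: abs_mult mult.commute)
  qed
  have "smooth_cyl n (iter_partial [] g) (\<lambda>i. iter_partial [i] g) (\<lambda>i. iter_partial [i, i] g) M"
    unfolding smooth_cyl_def
  proof (intro conjI allI impI)
    show "iter_partial [] g \<in> borel_measurable borel"
      by (rule borel_measurable_continuous_onI, rule cont) simp
    show "depends_below n (iter_partial [] g)" by (rule dep) simp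
    show "\<bar>iter_partial [] g y\<bar> \<le> M" for y using L1[of y] LM by simp
    fix i assume i: "i < n"
    show "iter_partial [i] g \<in> borel_measurable borel" "iter_partial [i, i] g \<in> borel_measurable borel"
      by (rule borel_measurable_continuous_onI, rule cont, use i in simp)+
    show "depends_below n (iter_partial [i] g)" "depends_below n (iter_partial [i, i] g)"
      by (rule dep, use i in simp)+
    fix y
    show "\<bar>iter_partial [i] g y\<bar> \<le> M" "\<bar>iter_partial [i, i] g y\<bar> \<le> M"
      using L2[OF i, of y] LM by linarith+
    show "\<bar>y i * iter_partial [i] g y\<bar> \<le> M" "\<bar>y i * iter_partial [i, i] g y\<bar> \<le> M"
      by (rule L3[OF i L2(1)[OF i]], rule L3[OF i L2(2)[OF i]])
    fix t
    show "((\<lambda>t. iter_partial [] g (y(i := t))) has_real_derivative iter_partial [i] g (y(i := t))) (at t)"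
      by (rule der) (use i in simp_all)
    show "((\<lambda>t. iter_partial [i] g (y(i := t))) has_real_derivative iter_partial [i, i] g (y(i := t))) (at t)"
      by (rule der) (use i in simp_all)
  qed
  then show ?thesis unfolding g_def by (simp only: iter_partial.simps) blast
qed

lemma FC0_smooth_cyl:
  fixes F :: "'a::topological_space measure \<Rightarrow> real"
  assumes "F \<in> FC0"
  obtains n A g d dd K where "n \<ge> 1" "smooth_cyl n g d dd K" "\<And>i. i < n \<Longrightarrow> A i \<in> sets borel"
    "disjoint_family_on A {..<n}" "(\<Union>i<n. A i) = UNIV" "\<And>\<eta>. \<eta> \<in> Mset \<Longrightarrow> F \<eta> = g (cvec n A \<eta>)"
proof -
  obtain n f and A :: "nat \<Rightarrow> 'a set" where F: "n \<ge> 1" "C0_infty n f" "\<forall>i<n. A i \<in> sets borel"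
      "disjoint_family_on A {..<n}" "(\<Union>i<n. A i) = UNIV"
      "\<forall>\<eta>\<in>Mset. F \<eta> = f (\<lambda>i. if i < n then measure \<eta> (A i) else 0)"
    using assms unfolding FC0_def by blast
  obtain K where "smooth_cyl n (\<lambda>y. f (trunc_vec n y)) (\<lambda>i. partial_d i (\<lambda>y. f (trunc_vec n y)))
     (\<lambda>i. partial_d i (partial_d i (\<lambda>y. f (trunc_vec n y)))) K"
    using C0_infty_smooth_cyl[OF F(2)] by blast
  moreover have "F \<eta> = f (trunc_vec n (cvec n A \<eta>))" if "\<eta> \<in> Mset" for \<eta>
  proof -
    have "trunc_vec n (cvec n A \<eta>) = (\<lambda>i. if i < n then measure \<eta> (A i) else 0)"
      by (auto simp: trunc_vec_def cvec_def)
    then show ?thesis using F(6) that by simp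
  qed
  ultimately show thesis using F by (intro that[of n]) auto
qed

section \<open>The extrinsic derivative\<close>

lemma add_pt:
  fixes x :: "'a::t2_space"
  assumes \<eta>: "\<eta> \<in> Mset" and s: "s \<ge> 0"
  shows "add_pt \<eta> s x \<in> Mset"
    "A \<in> sets borel \<Longrightarrow> measure (add_pt \<eta> s x) A = measure \<eta> A + s * indicator A x"
proof -
  have se: "sets \<eta> = sets borel" and fin: "finite_measure \<eta>" using \<eta> by (auto simp: Mset_def)
  interpret finite_measure \<eta> by fact
  have S: "sets (add_pt \<eta> s x) = sets borel" unfolding add_pt_def by (simp add: sets.space_closed sets.sigma_sets_eq[of borel, simplified])
  have em: "emeasure (add_pt \<eta> s x) B = emeasure \<eta> B + ennreal s * indicator B x" if "B \<in> sets borel" for B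
  proof (rule emeasure_measure_of[OF add_pt_def])
    show "sets borel \<subseteq> Pow UNIV" by simp
    show "positive (sets (add_pt \<eta> s x)) (\<lambda>B. emeasure \<eta> B + ennreal s * indicator B x)"
      by (simp add: positive_def)
    show "countably_additive (sets (add_pt \<eta> s x)) (\<lambda>B. emeasure \<eta> B + ennreal s * indicator B x)"
      unfolding S
    proof (rule countably_additiveI)
      fix C :: "nat \<Rightarrow> 'a set" assume C: "range C \<subseteq> sets borel" "disjoint_family C"
      \<comment> \<open>Countable additivity of the added term is that of the Dirac measure at
        \<open>x\<close>.\<close>
      have "(\<Sum>i. emeasure (return borel x) (C i)) = emeasure (return borel x) (\<Union>i. C i)"
        using C by (intro suminf_emeasure) auto
      then have 1: "(\<Sum>i. indicator (C i) x) = (indicator (\<Union>i. C i) x :: ennreal)"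
        using C by (subst (asm) emeasure_return) (auto simp: range_subsetD)
      show "(\<Sum>i. emeasure \<eta> (C i) + ennreal s * indicator (C i) x)
          = emeasure \<eta> (\<Union>i. C i) + ennreal s * indicator (\<Union>i. C i) x"
        using C se by (subst suminf_add[symmetric]) (auto simp: suminf_emeasure 1)
    qed
    show "B \<in> sets (add_pt \<eta> s x)" using that S by simp
  qed
  have spc: "space (add_pt \<eta> s x) = UNIV" using sets_eq_imp_space_eq[OF S] by simp
  have "finite_measure (add_pt \<eta> s x)"
  proof
    show "emeasure (add_pt \<eta> s x) (space (add_pt \<eta> s x)) \<noteq> \<infinity>"
      unfolding spc using em[of UNIV] emeasure_finite[of UNIV] by (simp add: ennreal_add_eq_top)
  qed
  then show "add_pt \<eta> s x \<in> Mset" using S by (simp add: Mset_def)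
  show "measure (add_pt \<eta> s x) A = measure \<eta> A + s * indicator A x" if "A \<in> sets borel"
  proof -
    have "emeasure \<eta> A + ennreal s * indicator A x = ennreal (measure \<eta> A + s * indicator A x)"
      using s by (cases "x \<in> A") (auto simp: emeasure_eq_measure)
    with em[OF that] have "emeasure (add_pt \<eta> s x) A = ennreal (measure \<eta> A + s * indicator A x)" by simp
    then show ?thesis using s by (intro measure_eq_emeasure_eq_ennreal) auto
  qed
qed

text \<open>A definite description such as \<open>grad_ext\<close> carries no existence statement.
  This relation does, and therefore supports rules such as \<open>has_egrad_diff\<close>.\<close>

definition has_egrad :: "('a::topological_space measure \<Rightarrow> real) \<Rightarrow> ('a measure \<Rightarrow> 'a \<Rightarrow> real) \<Rightarrow> bool" where
  "has_egrad F D \<longleftrightarrow> (\<forall>\<eta>\<in>Mset. \<forall>x. ((\<lambda>s. F (add_pt \<eta> s x)) has_real_derivative D \<eta> x) (at 0 within {0..}))"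

lemma grad_ext_eq:
  assumes "has_egrad F D" "\<eta> \<in> Mset"
  shows "grad_ext F \<eta> x = D \<eta> x"
proof -
  have d: "((\<lambda>s. F (add_pt \<eta> s x)) has_real_derivative D \<eta> x) (at 0 within {0..})"
    using assms by (auto simp: has_egrad_def)
  have "at (0::real) within {0..} = at_right 0" by (rule at_within_Ici_at_right)
  then have nb: "at (0::real) within {0..} \<noteq> bot" by simp
  show ?thesis unfolding grad_ext_def
  proof (rule the_equality)
    show "((\<lambda>s. F (add_pt \<eta> s x)) has_real_derivative D \<eta> x) (at 0 within {0..})" by (rule d)
    fix D' assume "((\<lambda>s. F (add_pt \<eta> s x)) has_real_derivative D') (at 0 within {0..})"
    then show "D' = D \<eta> x"
      using d vector_derivative_unique_within[OF nb] by (simp add: has_real_derivative_iff_has_vector_derivative)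
  qed
qed

lemma has_egrad_diff:
  assumes "has_egrad F D" "has_egrad F' D'"
  shows "has_egrad (\<lambda>\<eta>. F \<eta> - F' \<eta>) (\<lambda>\<eta> x. D \<eta> x - D' \<eta> x)"
  using assms unfolding has_egrad_def by (auto intro: DERIV_diff)

definition cyl_grad :: "nat \<Rightarrow> (nat \<Rightarrow> 'a set) \<Rightarrow> (nat \<Rightarrow> (nat \<Rightarrow> real) \<Rightarrow> real) \<Rightarrow> 'a measure \<Rightarrow> 'a \<Rightarrow> real" where
  "cyl_grad n A d \<eta> x = (\<Sum>i<n. indicator (A i) x * d i (cvec n A \<eta>))"

lemma sum_indicator_disjoint:
  fixes n :: nat
  assumes "disjoint_family_on A {..<n}" "i < n" "x \<in> A i"
  shows "(\<Sum>j<n. indicator (A j) x * (c j :: real)) = c i"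
proof -
  have "indicator (A j) x * c j = (if j = i then c i else 0)" if "j < n" for j
    using that assms by (auto simp: disjoint_family_on_def indicator_def)
  then have "(\<Sum>j<n. indicator (A j) x * c j) = (\<Sum>j<n. if j = i then c i else 0)"
    by (intro sum.cong) auto
  also have "\<dots> = c i" using assms(2) by (subst sum.delta) auto
  finally show ?thesis .
qed

text \<open>Every \<open>x\<close> lies in exactly one block \<open>A i\<close>, so adding mass
  \<open>s\<close> at \<open>x\<close> moves the coordinate \<open>i\<close> by \<open>s\<close> and
  leaves all others fixed. The extrinsic derivative is thus an ordinary partial derivative.\<close>

lemma has_egrad_cyl:
  fixes F :: "'a::t2_space measure \<Rightarrow> real"
  assumes g: "smooth_cyl n g d dd K" and A: "\<And>i. i < n \<Longrightarrow> A i \<in> sets borel"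
    "disjoint_family_on A {..<n}" "(\<Union>i<n. A i) = UNIV"
    and F: "\<And>\<eta>. \<eta> \<in> Mset \<Longrightarrow> F \<eta> = g (cvec n A \<eta>)"
  shows "has_egrad F (cyl_grad n A d)"
  unfolding has_egrad_def
proof (intro ballI allI)
  fix \<eta> :: "'a measure" and x assume \<eta>: "\<eta> \<in> Mset"
  obtain i where i: "i < n" "x \<in> A i" using A(3) by blast
  let ?y = "cvec n A \<eta>"
  have eq: "F (add_pt \<eta> s x) = g (?y(i := ?y i + s))" if "s \<ge> 0" for s
  proof -
    have "cvec n A (add_pt \<eta> s x) = ?y(i := ?y i + s)"
    proof
      fix j
      have "x \<notin> A j" if "j < n" "j \<noteq> i"
        using that i A(2) by (auto simp: disjoint_family_on_def)
      then show "cvec n A (add_pt \<eta> s x) j = (?y(i := ?y i + s)) j"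
        using add_pt(2)[OF \<eta> that, of "A j" x] i A(1) by (auto simp: cvec_def)
    qed
    then show ?thesis using F[OF add_pt(1)[OF \<eta> that]] by simp
  qed
  have "((\<lambda>s. g (?y(i := s + ?y i))) has_real_derivative d i (?y(i := 0 + ?y i))) (at 0)"
    using smooth_cylD(12)[OF g i(1), of ?y "0 + ?y i"] unfolding DERIV_shift .
  then have "((\<lambda>s. g (?y(i := ?y i + s))) has_real_derivative d i ?y) (at 0 within {0..})"
    by (simp add: add.commute has_field_derivative_at_within)
  moreover have "d i ?y = cyl_grad n A d \<eta> x"
    unfolding cyl_grad_def by (rule sum_indicator_disjoint[OF A(2) i, symmetric])
  ultimately have "((\<lambda>s. g (?y(i := ?y i + s))) has_real_derivative cyl_grad n A d \<eta> x) (at 0 within {0..})"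
    by simp
  then show "((\<lambda>s. F (add_pt \<eta> s x)) has_real_derivative cyl_grad n A d \<eta> x) (at 0 within {0..})"
    by (rule has_field_derivative_transform_within[OF _ zero_less_one]) (auto simp: eq)
qed

lemma cyl_grad_inner:
  fixes \<eta> :: "'a::topological_space measure"
  assumes \<eta>: "\<eta> \<in> Mset" and A: "\<And>i. i < n \<Longrightarrow> A i \<in> sets borel" and B: "\<And>i. i < m \<Longrightarrow> B i \<in> sets borel"
  shows "(\<integral>x. cyl_grad n A d \<eta> x * cyl_grad m B e \<eta> x \<partial>\<eta>) =
    (\<Sum>i<n. \<Sum>j<m. measure \<eta> (A i \<inter> B j) * (d i (cvec n A \<eta>) * e j (cvec m B \<eta>)))"
proof -
  have se: "sets \<eta> = sets borel" and fin: "finite_measure \<eta>" using \<eta> by (auto simp: Mset_def)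
  interpret finite_measure \<eta> by fact
  have I: "integrable \<eta> (\<lambda>x. indicator (A i \<inter> B j) x * (c :: real))" if "i < n" "j < m" for i j c
    using A[OF that(1)] B[OF that(2)] se by (intro integrable_mult_left) (auto simp: emeasure_eq_measure)
  have "(\<integral>x. cyl_grad n A d \<eta> x * cyl_grad m B e \<eta> x \<partial>\<eta>) =
     (\<integral>x. (\<Sum>i<n. \<Sum>j<m. indicator (A i \<inter> B j) x * (d i (cvec n A \<eta>) * e j (cvec m B \<eta>))) \<partial>\<eta>)"
  proof (intro Bochner_Integration.integral_cong refl)
    fix x
    show "cyl_grad n A d \<eta> x * cyl_grad m B e \<eta> x =
        (\<Sum>i<n. \<Sum>j<m. indicator (A i \<inter> B j) x * (d i (cvec n A \<eta>) * e j (cvec m B \<eta>)))"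
      unfolding cyl_grad_def sum_product indicator_inter_arith by (intro sum.cong refl) (simp only: mult_ac)
  qed
  also have "\<dots> = (\<Sum>i<n. \<integral>x. (\<Sum>j<m. indicator (A i \<inter> B j) x * (d i (cvec n A \<eta>) * e j (cvec m B \<eta>))) \<partial>\<eta>)"
    by (intro Bochner_Integration.integral_sum Bochner_Integration.integrable_sum I) auto
  also have "\<dots> = (\<Sum>i<n. \<Sum>j<m. (\<integral>x. indicator (A i \<inter> B j) x * (d i (cvec n A \<eta>) * e j (cvec m B \<eta>)) \<partial>\<eta>))"
    by (intro sum.cong refl Bochner_Integration.integral_sum I) auto
  also have "\<dots> = (\<Sum>i<n. \<Sum>j<m. measure \<eta> (A i \<inter> B j) * (d i (cvec n A \<eta>) * e j (cvec m B \<eta>)))"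
    using A B se by (intro sum.cong refl) (simp add: sets_eq_imp_space_eq[OF se])
  finally show ?thesis .
qed

lemma cyl_grad_measurable:
  fixes \<eta> :: "'a::topological_space measure"
  assumes "\<And>i. i < n \<Longrightarrow> A i \<in> sets borel"
  shows "cyl_grad n A d \<eta> \<in> borel_measurable borel"
  unfolding cyl_grad_def[abs_def] using assms by measurable

lemma cyl_grad_bound:
  assumes "disjoint_family_on A {..<n}" "(\<Union>i<n. A i) = UNIV" "smooth_cyl n g d dd K"
  shows "\<bar>cyl_grad n A d \<eta> x\<bar> \<le> K"
proof -
  obtain i where i: "i < n" "x \<in> A i" using assms(2) by blast
  show ?thesis unfolding cyl_grad_def sum_indicator_disjoint[OF assms(1) i]
    using smooth_cylD(8)[OF assms(3) i(1)] .
qed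

section \<open>The Gamma distribution on cylinder functions\<close>

locale gamma_process =
  fixes \<nu> :: "'a::t2_space measure" and G :: "'a measure measure"
  assumes \<nu>: "\<nu> \<in> Mset" and G: "is_gamma_dist \<nu> G"
begin

sublocale prob_space G using G by (simp add: is_gamma_dist_def)

lemma space_G: "space G = Mset" using G by (simp add: is_gamma_dist_def)

abbreviation glaw :: "(nat \<Rightarrow> 'a set) \<Rightarrow> nat \<Rightarrow> real measure" where
  "glaw A i \<equiv> gamma_law (measure \<nu> (A i))"

lemma prob_space_glaw: "prob_space (glaw A i)" by (simp add: prob_space_gamma_law)

lemma indep_measure:
  fixes A :: "nat \<Rightarrow> 'a set"
  assumes "\<And>i. i < n \<Longrightarrow> A i \<in> sets borel" "disjoint_family_on A {..<n}"
  shows "indep_vars (\<lambda>_. borel) (\<lambda>i \<eta>. measure \<eta> (A i)) {..<n}"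
    "i < n \<Longrightarrow> distr G borel (\<lambda>\<eta>. measure \<eta> (A i)) = gamma_law (measure \<nu> (A i))"
  using G assms unfolding is_gamma_dist_def by blast+

lemma measurable_measure [measurable]:
  assumes "A \<in> sets borel" shows "(\<lambda>\<eta>. measure \<eta> A) \<in> borel_measurable G"
proof -
  have "indep_vars (\<lambda>_. borel) (\<lambda>i \<eta>. measure \<eta> ((\<lambda>_. A) i)) {..<Suc 0}"
    by (rule indep_measure) (use assms in \<open>auto simp: disjoint_family_on_def\<close>)
  then show ?thesis by (auto simp: indep_vars_def)
qed

lemma distr_measure:
  assumes "A \<in> sets borel" shows "distr G borel (\<lambda>\<eta>. measure \<eta> A) = gamma_law (measure \<nu> A)"
  using indep_measure(2)[of "Suc 0" "\<lambda>_. A" 0] assms by (auto simp: disjoint_family_on_def)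

lemma measurable_cvec:
  assumes "\<And>i. i < n \<Longrightarrow> A i \<in> sets borel"
  shows "cvec n A \<in> borel_measurable G"
proof (rule measurable_coordinatewise_then_product)
  fix i show "(\<lambda>\<eta>. cvec n A \<eta> i) \<in> borel_measurable G"
    using assms by (cases "i < n") (auto simp: cvec_def)
qed

text \<open>Truncation maps the finite product measurably into the space of all sequences, and it is
  invisible to a function of the first \<open>n\<close> coordinates.\<close>

lemma measurable_PiM_if_depends:
  assumes u: "u \<in> borel_measurable borel" and dep: "depends_below n u" and M: "\<And>i. sets (M i) = sets borel"
  shows "u \<in> borel_measurable (Pi\<^sub>M {..<n} M)"
proof -
  have "trunc_vec n \<in> borel_measurable (Pi\<^sub>M {..<n} M)"
  proof (rule measurable_coordinatewise_then_product)
    fix i show "(\<lambda>y. trunc_vec n y i) \<in> borel_measurable (Pi\<^sub>M {..<n} M)"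
    proof (cases "i < n")
      case True
      have "(\<lambda>y. y i) \<in> borel_measurable (Pi\<^sub>M {..<n} M)"
        unfolding measurable_cong_sets[OF refl M[of i, symmetric]]
        by (rule measurable_component_singleton) (simp add: True)
      then show ?thesis using True by (simp add: trunc_vec_def)
    qed (simp add: trunc_vec_def)
  qed
  from measurable_compose[OF this u] have "(\<lambda>y. u (trunc_vec n y)) \<in> borel_measurable (Pi\<^sub>M {..<n} M)" .
  moreover have "u (trunc_vec n y) = u y" for y using dep by (auto simp: depends_below_def trunc_vec_def)
  ultimately show ?thesis by simp
qed

lemma integral_cvec:
  assumes n: "n \<ge> 1" and A: "\<And>i. i < n \<Longrightarrow> A i \<in> sets borel" "disjoint_family_on A {..<n}"
    and u: "u \<in> borel_measurable borel" and dep: "depends_below n u"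
  shows "(\<integral>\<eta>. u (cvec n A \<eta>) \<partial>G) = (\<integral>y. u y \<partial>Pi\<^sub>M {..<n} (glaw A))"
proof -
  have rv: "(\<lambda>\<eta>. measure \<eta> (A i)) \<in> borel_measurable G" if "i < n" for i using A that by auto
  have "{..<n} \<noteq> {}" using n by (auto simp: lessThan_empty_iff)
  from indep_vars_iff_distr_eq_PiM'[OF this, where M' = "\<lambda>_. borel" and X = "\<lambda>i \<eta>. measure \<eta> (A i)"] indep_measure(1)[OF A] rv
  have "distr G (Pi\<^sub>M {..<n} (\<lambda>_. borel)) (\<lambda>\<eta>. \<lambda>i\<in>{..<n}. measure \<eta> (A i))
      = Pi\<^sub>M {..<n} (\<lambda>i. distr G borel (\<lambda>\<eta>. measure \<eta> (A i)))" by auto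
  also have "\<dots> = Pi\<^sub>M {..<n} (glaw A)"
    using indep_measure(2)[OF A] by (intro PiM_cong) auto
  finally have D: "distr G (Pi\<^sub>M {..<n} (\<lambda>_. borel)) (\<lambda>\<eta>. \<lambda>i\<in>{..<n}. measure \<eta> (A i)) = Pi\<^sub>M {..<n} (glaw A)" .
  have um: "u \<in> borel_measurable (Pi\<^sub>M {..<n} (\<lambda>_. borel))"
    by (rule measurable_PiM_if_depends[OF u dep]) simp
  have "(\<integral>y. u y \<partial>Pi\<^sub>M {..<n} (glaw A)) = (\<integral>\<eta>. u (\<lambda>i\<in>{..<n}. measure \<eta> (A i)) \<partial>G)"
    unfolding D[symmetric] by (rule integral_distr[OF _ um]) (use rv in \<open>auto intro!: measurable_restrict\<close>)
  also have "\<dots> = (\<integral>\<eta>. u (cvec n A \<eta>) \<partial>G)"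
  proof (intro Bochner_Integration.integral_cong refl)
    fix \<eta> show "u (\<lambda>i\<in>{..<n}. measure \<eta> (A i)) = u (cvec n A \<eta>)"
      using dep[unfolded depends_below_def, rule_format, of "\<lambda>i\<in>{..<n}. measure \<eta> (A i)" "cvec n A \<eta>"]
      by (simp add: cvec_def)
  qed
  finally show ?thesis by simp
qed

end

lemma depends_below_component: "i < n \<Longrightarrow> depends_below n (\<lambda>y. y i)"
  and depends_below_comp: "depends_below n u \<Longrightarrow> depends_below n (\<lambda>y. f (u y))"
  and depends_below_comp2: "depends_below n u \<Longrightarrow> depends_below n v \<Longrightarrow> depends_below n (\<lambda>y. h (u y) (v y))"
  unfolding depends_below_def by metis+

lemma measurable_upd: "(\<lambda>t. y(i := t)) \<in> borel_measurable (borel :: real measure)"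
  for y :: "nat \<Rightarrow> real"
proof (rule measurable_coordinatewise_then_product)
  fix j show "(\<lambda>t. (y(i := t)) j) \<in> borel_measurable borel" by (cases "j = i") auto
qed

lemma measurable_component: "(\<lambda>y :: nat \<Rightarrow> real. y i) \<in> borel_measurable borel"
  by (intro borel_measurable_continuous_onI continuous_intros continuous_on_product_coordinates)

context gamma_process
begin

lemma measurable_comp_cvec:
  assumes "\<And>i. i < n \<Longrightarrow> A i \<in> sets borel" "u \<in> borel_measurable borel"
  shows "(\<lambda>\<eta>. u (cvec n A \<eta>)) \<in> borel_measurable G"
  using measurable_compose[OF measurable_cvec[OF assms(1)] assms(2)] by simp

lemma integrable_bounded_G:
  fixes f :: "'a measure \<Rightarrow> real"
  assumes "f \<in> borel_measurable G" "\<And>\<eta>. \<eta> \<in> Mset \<Longrightarrow> \<bar>f \<eta>\<bar> \<le> K"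
  shows "integrable G f"
  using assms by (intro integrable_const_bound[of _ K]) (auto simp: space_G)

lemma integral_cong_G: "(\<And>\<eta>. \<eta> \<in> Mset \<Longrightarrow> f \<eta> = h \<eta>) \<Longrightarrow> (\<integral>\<eta>. f \<eta> \<partial>G) = (\<integral>\<eta>. h \<eta> \<partial>G)"
  by (intro Bochner_Integration.integral_cong) (auto simp: space_G)

text \<open>Masses of disjoint sets are independent, so \<open>gap_PiM\<close> applies to their
  joint law. The one-dimensional integrals that the slice inequality leaves inside the full integral
  are removed by resampling. \<open>W i\<close> stands for the energy density in direction
  \<open>i\<close>; the same lemma serves variance and entropy.\<close>

lemma gap_cvec:
  assumes n: "n \<ge> 1" and A: "\<And>i. i < n \<Longrightarrow> A i \<in> sets borel" "disjoint_family_on A {..<n}"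
    and tf: "tensor_fun \<Phi> \<psi> l u B"
    and f: "f \<in> borel_measurable borel" "depends_below n f" "\<And>y. l \<le> f y \<and> f y \<le> u"
    and W: "\<And>i. i < n \<Longrightarrow> W i \<in> borel_measurable borel" "\<And>i. i < n \<Longrightarrow> depends_below n (W i)"
      "\<And>i y. i < n \<Longrightarrow> \<bar>W i y\<bar> \<le> L"
    and slice: "\<And>i y. i < n \<Longrightarrow> jensen_gap \<Phi> (glaw A i) (\<lambda>t. f (y(i := t))) \<le> (\<integral>t. W i (y(i := t)) \<partial>glaw A i)"
  shows "jensen_gap \<Phi> G (\<lambda>\<eta>. f (cvec n A \<eta>)) \<le> (\<Sum>i<n. \<integral>\<eta>. W i (cvec n A \<eta>) \<partial>G)"
proof -
  interpret tensor_fun \<Phi> \<psi> l u B by (rule tf)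
  let ?P = "Pi\<^sub>M {..<n} (glaw A)"
  interpret P: prob_space ?P by (rule prob_space_PiM) (rule prob_space_glaw)
  interpret L: prob_space "glaw A i" for i by (rule prob_space_glaw)
  have ms: "(\<lambda>(y, t). h (y(i := t))) \<in> borel_measurable (?P \<Otimes>\<^sub>M glaw A i)"
    if "i < n" "h \<in> borel_measurable ?P" for i and h :: "_ \<Rightarrow> real"
  proof -
    have ins: "insert i {..<n} = {..<n}" using that by auto
    show ?thesis
      using measurable_compose[OF measurable_add_dim[of i "{..<n}" "glaw A", unfolded ins] that(2)]
      by (simp add: case_prod_unfold fun_upd_def)
  qed
  have fP: "f \<in> borel_measurable ?P" by (rule measurable_PiM_if_depends[OF f(1,2)]) simp
  have WP: "W i \<in> borel_measurable ?P" if "i < n" for i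
    by (rule measurable_PiM_if_depends[OF W(1,2)[OF that]]) simp
  have \<Phi>f: "depends_below n (\<lambda>y. \<Phi> (f y))" by (rule depends_below_comp[OF f(2)])
  have "jensen_gap \<Phi> G (\<lambda>\<eta>. f (cvec n A \<eta>)) = jensen_gap \<Phi> ?P f"
    unfolding jensen_gap_def using f
    by (subst (1 2) integral_cvec[OF n A]) (auto intro: \<Phi>f)
  also have "\<dots> \<le> (\<Sum>i<n. \<integral>y. jensen_gap \<Phi> (glaw A i) (\<lambda>t. f (y(i := t))) \<partial>?P)"
    by (rule gap_PiM) (rule prob_space_glaw finite_lessThan fP f(3))+
  also have "\<dots> \<le> (\<Sum>i<n. \<integral>y. (\<integral>t. W i (y(i := t)) \<partial>glaw A i) \<partial>?P)"
  proof (rule sum_mono)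
    fix i assume "i \<in> {..<n}"
    then have i: "i < n" by simp
    have sl: "(\<lambda>t. h (y(i := t))) \<in> borel_measurable (glaw A i)" if "h \<in> borel_measurable borel" for h :: "_ \<Rightarrow> real" and y
      using measurable_compose[OF measurable_upd that] by (simp add: measurable_gamma_law)
    have b: "\<bar>\<integral>t. W i (y(i := t)) \<partial>glaw A i\<bar> \<le> L" for y
    proof -
      have "\<bar>\<integral>t. W i (y(i := t)) \<partial>glaw A i\<bar> \<le> (\<integral>t. \<bar>W i (y(i := t))\<bar> \<partial>glaw A i)" by (rule integral_abs_bound)
      also have "\<dots> \<le> L" using sl[OF W(1)[OF i]] W(3)[OF i]
        by (intro L.integral_le_const L.integrable_const_bound[where B = L]) auto
      finally show ?thesis .
    qed
    show "(\<integral>y. jensen_gap \<Phi> (glaw A i) (\<lambda>t. f (y(i := t))) \<partial>?P) \<le> (\<integral>y. (\<integral>t. W i (y(i := t)) \<partial>glaw A i) \<partial>?P)"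
    proof (rule integral_mono[OF _ _ slice[OF i]])
      show "integrable ?P (\<lambda>y. jensen_gap \<Phi> (glaw A i) (\<lambda>t. f (y(i := t))))"
        using gap_measurable[OF prob_space_glaw[of A i] ms[OF i fP]] gap_bound[OF prob_space_glaw[of A i] sl[OF f(1)] f(3)]
        by (intro P.integrable_const_bound[where B = "2 * B"]) auto
      show "integrable ?P (\<lambda>y. \<integral>t. W i (y(i := t)) \<partial>glaw A i)"
        using L.borel_measurable_lebesgue_integral[OF ms[OF i WP[OF i]]] b
        by (intro P.integrable_const_bound[where B = L]) auto
    qed
  qed
  also have "\<dots> = (\<Sum>i<n. \<integral>y. W i y \<partial>?P)"
    using WP W(3) by (intro sum.cong refl PiM_integral_resample[where K = L]  prob_space_glaw) auto
  also have "\<dots> = (\<Sum>i<n. \<integral>\<eta>. W i (cvec n A \<eta>) \<partial>G)"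
    using W by (intro sum.cong refl integral_cvec[symmetric, OF n A]) auto
  finally show ?thesis .
qed

definition EB :: "('a measure \<Rightarrow> real) \<Rightarrow> ('a measure \<Rightarrow> real) \<Rightarrow> real" where
  "EB F F' = (\<integral>\<eta>. (\<integral>x. grad_ext F \<eta> x * grad_ext F' \<eta> x \<partial>\<eta>) \<partial>G)"

lemma Eform_EB: "Eform G F = EB F F"
  by (simp add: Eform_def EB_def power2_eq_square)

text \<open>Disjointness of the blocks leaves only the diagonal of the double sum in
  \<open>cyl_grad_inner\<close>.\<close>

lemma Eform_cyl:
  assumes g: "smooth_cyl n g d dd K" and A: "\<And>i. i < n \<Longrightarrow> A i \<in> sets borel"
    "disjoint_family_on A {..<n}" "(\<Union>i<n. A i) = UNIV"
    and F: "\<And>\<eta>. \<eta> \<in> Mset \<Longrightarrow> F \<eta> = g (cvec n A \<eta>)"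
  shows "Eform G F = (\<Sum>i<n. \<integral>\<eta>. cvec n A \<eta> i * (d i (cvec n A \<eta>))\<^sup>2 \<partial>G)"
proof -
  have "Eform G F = (\<integral>\<eta>. (\<Sum>i<n. cvec n A \<eta> i * (d i (cvec n A \<eta>))\<^sup>2) \<partial>G)"
    unfolding Eform_EB EB_def
  proof (rule integral_cong_G)
    fix \<eta> :: "'a measure" assume \<eta>: "\<eta> \<in> Mset"
    have gr: "grad_ext F \<eta> x = cyl_grad n A d \<eta> x" for x
      by (rule grad_ext_eq[OF has_egrad_cyl[OF g A F] \<eta>])
    have "(\<integral>x. grad_ext F \<eta> x * grad_ext F \<eta> x \<partial>\<eta>) =
        (\<Sum>i<n. \<Sum>j<n. measure \<eta> (A i \<inter> A j) * (d i (cvec n A \<eta>) * d j (cvec n A \<eta>)))"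
      unfolding gr by (rule cyl_grad_inner[OF \<eta> A(1) A(1)])
    also have "\<dots> = (\<Sum>i<n. \<Sum>j<n. if j = i then cvec n A \<eta> i * (d i (cvec n A \<eta>))\<^sup>2 else 0)"
      using A(2) by (intro sum.cong refl) (auto simp: cvec_def power2_eq_square disjoint_family_on_def)
    also have "\<dots> = (\<Sum>i<n. cvec n A \<eta> i * (d i (cvec n A \<eta>))\<^sup>2)"
      by (intro sum.cong refl) (subst sum.delta, auto)
    finally show "(\<integral>x. grad_ext F \<eta> x * grad_ext F \<eta> x \<partial>\<eta>) = (\<Sum>i<n. cvec n A \<eta> i * (d i (cvec n A \<eta>))\<^sup>2)" .
  qed
  also have "\<dots> = (\<Sum>i<n. \<integral>\<eta>. cvec n A \<eta> i * (d i (cvec n A \<eta>))\<^sup>2 \<partial>G)"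
  proof (rule Bochner_Integration.integral_sum)
    fix i assume "i \<in> {..<n}"
    then have i: "i < n" by simp
    show "integrable G (\<lambda>\<eta>. cvec n A \<eta> i * (d i (cvec n A \<eta>))\<^sup>2)"
    proof (rule integrable_bounded_G)
      show "(\<lambda>\<eta>. cvec n A \<eta> i * (d i (cvec n A \<eta>))\<^sup>2) \<in> borel_measurable G"
        using measurable_comp_cvec[OF A(1) smooth_cylD(4)[OF g i]] measurable_comp_cvec[OF A(1) measurable_component] by simp
      have "\<bar>y i * d i y\<bar> * \<bar>d i y\<bar> \<le> K * K" for y
        using smooth_cylD(8,10)[OF g i, of y] by (intro mult_mono) auto
      then show "\<bar>cvec n A \<eta> i * (d i (cvec n A \<eta>))\<^sup>2\<bar> \<le> K * K" for \<eta>
        by (simp add: abs_mult power2_eq_square mult.assoc)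
    qed
  qed
  finally show ?thesis .
qed

lemma FC0_measurable: "F \<in> FC0 \<Longrightarrow> F \<in> borel_measurable G"
proof (elim FC0_smooth_cyl)
  fix n A g d dd K assume "smooth_cyl n g d dd K" "\<And>i. i < n \<Longrightarrow> A i \<in> sets (borel :: 'a measure)"
    and F: "\<And>\<eta>. \<eta> \<in> Mset \<Longrightarrow> F \<eta> = g (cvec n A \<eta>)"
  then have "(\<lambda>\<eta>. g (cvec n A \<eta>)) \<in> borel_measurable G" using smooth_cylD by (intro measurable_comp_cvec) blast+
  then show "F \<in> borel_measurable G" using F by (subst measurable_cong[of G]) (auto simp: space_G)
qed

lemma FC0_bounded: "F \<in> FC0 \<Longrightarrow> \<exists>K. \<forall>\<eta>\<in>Mset. \<bar>F \<eta>\<bar> \<le> K"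
  by (elim FC0_smooth_cyl) (metis smooth_cylD(3))

lemma slice_measurable: "h \<in> borel_measurable borel \<Longrightarrow> (\<lambda>t. h (y(i := t))) \<in> borel_measurable (borel :: real measure)"
  for h :: "(nat \<Rightarrow> real) \<Rightarrow> real"
  using measurable_compose[OF measurable_upd] by blast

lemma poincare_FC0:
  assumes "F \<in> FC0"
  shows "(\<integral>\<eta>. (F \<eta>)\<^sup>2 \<partial>G) - (\<integral>\<eta>. F \<eta> \<partial>G)\<^sup>2 \<le> Eform G F"
  using assms
proof (rule FC0_smooth_cyl)
  fix n g d dd K and A :: "nat \<Rightarrow> 'a set"
  assume n: "n \<ge> 1" and g: "smooth_cyl n g d dd K" and A: "\<And>i. i < n \<Longrightarrow> A i \<in> sets borel"
    "disjoint_family_on A {..<n}" "(\<Union>i<n. A i) = UNIV"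
    and F: "\<And>\<eta>. \<eta> \<in> Mset \<Longrightarrow> F \<eta> = g (cvec n A \<eta>)"
  have K: "K \<ge> 0" using smooth_cylD(3)[OF g, of undefined] by linarith
  have E: "Eform G F = (\<Sum>i<n. \<integral>\<eta>. cvec n A \<eta> i * (d i (cvec n A \<eta>))\<^sup>2 \<partial>G)"
    by (rule Eform_cyl[OF g A F])
  have KK: "- K \<le> K" using K by simp
  have "jensen_gap (\<lambda>x. x\<^sup>2) G (\<lambda>\<eta>. g (cvec n A \<eta>)) \<le> (\<Sum>i<n. \<integral>\<eta>. cvec n A \<eta> i * (d i (cvec n A \<eta>))\<^sup>2 \<partial>G)"
  proof (rule gap_cvec[OF n A(1,2) tensor_fun_square[OF KK], where L = "K * K" and W = "\<lambda>i y. y i * (d i y)\<^sup>2"])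
    show "g \<in> borel_measurable borel" "depends_below n g" using smooth_cylD[OF g] by auto
    show "- K \<le> g y \<and> g y \<le> K" for y using smooth_cylD(3)[OF g, of y] by (simp add: abs_le_iff minus_le_iff)
    fix i assume i: "i < n"
    show "(\<lambda>y. y i * (d i y)\<^sup>2) \<in> borel_measurable borel"
      using smooth_cylD(4)[OF g i] measurable_component by simp
    show "depends_below n (\<lambda>y. y i * (d i y)\<^sup>2)"
      by (rule depends_below_comp2[OF depends_below_component[OF i] smooth_cylD(6)[OF g i]])
    fix y
    have "\<bar>y i * d i y\<bar> * \<bar>d i y\<bar> \<le> K * K"
      using smooth_cylD(8,10)[OF g i, of y] K by (intro mult_mono) auto
    then show "\<bar>y i * (d i y)\<^sup>2\<bar> \<le> K * K"
      by (simp add: abs_mult power2_eq_square mult.assoc)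
    show "jensen_gap (\<lambda>x. x\<^sup>2) (glaw A i) (\<lambda>t. g (y(i := t)))
       \<le> (\<integral>t. (y(i := t)) i * (d i (y(i := t)))\<^sup>2 \<partial>glaw A i)"
      unfolding jensen_gap_def using smooth_cylD[OF g] i
      by (simp, intro gamma_poincare[where K = K] slice_measurable) auto
  qed
  then show ?thesis unfolding E jensen_gap_def
    using integral_cong_G[of F "\<lambda>\<eta>. g (cvec n A \<eta>)"] integral_cong_G[of "\<lambda>\<eta>. (F \<eta>)\<^sup>2" "\<lambda>\<eta>. (g (cvec n A \<eta>))\<^sup>2"] F
    by simp
qed

text \<open>The shift by \<open>\<epsilon>\<close> keeps the density away from 0, as
  \<open>gamma_lsi\<close> demands. On a slice with \<open>u\<close> and its derivative
  \<open>v\<close> the energy density is \<open>(2 * u * v)^2 / (u^2 + \<epsilon>)\<close>, at most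
  \<open>4 * v^2\<close>: this is the origin of the factor 4, and the bound is uniform in
  \<open>\<epsilon>\<close>.\<close>

lemma lsi_FC0:
  assumes "F \<in> FC0" and \<epsilon>: "\<epsilon> > 0" and C: "C > 0"
    and CA: "\<And>A. A \<in> sets borel \<Longrightarrow> measure \<nu> A = 0 \<or> 8 / min 1 (measure \<nu> A) \<le> C"
  shows "jensen_gap xlnx G (\<lambda>\<eta>. (F \<eta>)\<^sup>2 + \<epsilon>) \<le> 4 * C * Eform G F"
  using assms(1)
proof (rule FC0_smooth_cyl)
  fix n g d dd K and A :: "nat \<Rightarrow> 'a set"
  assume n: "n \<ge> 1" and g: "smooth_cyl n g d dd K" and A: "\<And>i. i < n \<Longrightarrow> A i \<in> sets borel"
    "disjoint_family_on A {..<n}" "(\<Union>i<n. A i) = UNIV"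
    and F: "\<And>\<eta>. \<eta> \<in> Mset \<Longrightarrow> F \<eta> = g (cvec n A \<eta>)"
  have K: "K \<ge> 0" using smooth_cylD(3)[OF g, of undefined] by linarith
  have E: "Eform G F = (\<Sum>i<n. \<integral>\<eta>. cvec n A \<eta> i * (d i (cvec n A \<eta>))\<^sup>2 \<partial>G)"
    by (rule Eform_cyl[OF g A F])
  have g2: "(g y)\<^sup>2 \<le> K\<^sup>2" for y using power_mono[OF smooth_cylD(3)[OF g, of y], of 2] by simp
  have KK: "\<epsilon> \<le> K\<^sup>2 + \<epsilon>" by simp
  define f where "f y = (g y)\<^sup>2 + \<epsilon>" for y
  have fb: "\<epsilon> \<le> f y \<and> f y \<le> K\<^sup>2 + \<epsilon>" for y using g2[of y] by (simp add: f_def)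
  have fm: "f \<in> borel_measurable borel" unfolding f_def using smooth_cylD(1)[OF g] by simp
  have "jensen_gap xlnx G (\<lambda>\<eta>. f (cvec n A \<eta>)) \<le> (\<Sum>i<n. \<integral>\<eta>. 4 * C * (cvec n A \<eta> i * (d i (cvec n A \<eta>))\<^sup>2) \<partial>G)"
  proof (rule gap_cvec[OF n A(1,2) tensor_fun_xlnx[OF \<epsilon> KK], where L = "4 * C * (K * K)" and W = "\<lambda>i y. 4 * C * (y i * (d i y)\<^sup>2)"])
    show "depends_below n f" unfolding f_def by (rule depends_below_comp[OF smooth_cylD(2)[OF g]])
    fix i assume i: "i < n"
    note gi = smooth_cylD(1)[OF g] smooth_cylD(4)[OF g i]
    show "(\<lambda>y. 4 * C * (y i * (d i y)\<^sup>2)) \<in> borel_measurable borel"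
      using gi measurable_component by simp
    show "depends_below n (\<lambda>y. 4 * C * (y i * (d i y)\<^sup>2))"
      by (rule depends_below_comp2[OF depends_below_component[OF i] smooth_cylD(6)[OF g i]])
    have b: "\<bar>y i * (d i y)\<^sup>2\<bar> \<le> K * K" for y
    proof -
      have "\<bar>y i * d i y\<bar> * \<bar>d i y\<bar> \<le> K * K"
        using smooth_cylD(8,10)[OF g i, of y] K by (intro mult_mono) auto
      then show ?thesis by (simp add: abs_mult power2_eq_square mult.assoc)
    qed
    then show "\<bar>4 * C * (y i * (d i y)\<^sup>2)\<bar> \<le> 4 * C * (K * K)" for y
      using C mult_left_mono[OF b[of y], of "4 * C"] by (simp add: abs_mult)
    fix y :: "nat \<Rightarrow> real"
    interpret L: prob_space "glaw A i" by (rule prob_space_glaw)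
    define u where "u t = g (y(i := t))" for t
    define v where "v t = d i (y(i := t))" for t
    have [measurable]: "u \<in> borel_measurable borel" "v \<in> borel_measurable borel"
      unfolding u_def v_def using gi by (auto intro: slice_measurable)
    have fu: "f (y(i := t)) = (u t)\<^sup>2 + \<epsilon>" for t by (simp add: f_def u_def)
    have uv: "(u has_real_derivative v t) (at t)" for t
      unfolding u_def v_def by (rule smooth_cylD(12)[OF g i])
    have uvb: "\<bar>2 * u t * v t\<bar> \<le> 2 * (K * K)" for t
      using smooth_cylD(3)[OF g, of "y(i := t)"] smooth_cylD(8)[OF g i, of "y(i := t)"] K
      by (auto simp: u_def v_def abs_mult intro!: mult_mono)
    have lsi: "gamma_lsi (measure \<nu> (A i)) C" by (rule gamma_lsi_nonneg[OF C CA[OF A(1)[OF i]]]) simp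
    have "jensen_gap xlnx (glaw A i) (\<lambda>t. (u t)\<^sup>2 + \<epsilon>)
       \<le> C * (\<integral>t. t * (2 * u t * v t)\<^sup>2 / ((u t)\<^sup>2 + \<epsilon>) \<partial>glaw A i)"
    proof (rule lsi[unfolded gamma_lsi_def, rule_format, of _ _ \<epsilon> "K\<^sup>2 + \<epsilon>" "2 * (K * K)"], intro conjI allI impI)
      show "((\<lambda>t. (u t)\<^sup>2 + \<epsilon>) has_real_derivative 2 * u t * v t) (at t)" for t
        using uv[of t] by (auto intro!: derivative_eq_intros)
      show "\<epsilon> \<le> (u t)\<^sup>2 + \<epsilon>" "(u t)\<^sup>2 + \<epsilon> \<le> K\<^sup>2 + \<epsilon>" for t
        using fb[of "y(i := t)"] by (simp_all add: fu)
    qed (use \<epsilon> uvb in auto)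
    also have "\<dots> \<le> C * (\<integral>t. 4 * (t * (v t)\<^sup>2) \<partial>glaw A i)"
    proof (intro mult_left_mono integral_mono_AE)
      have nn: "AE t in glaw A i. t \<ge> 0" by (rule AE_gamma_law_nonneg) simp
      have bv: "\<bar>t * (v t)\<^sup>2\<bar> \<le> K * K" for t using b[of "y(i := t)"] by (simp add: v_def)
      have le: "(2 * u t * v t)\<^sup>2 / ((u t)\<^sup>2 + \<epsilon>) \<le> 4 * (v t)\<^sup>2" for t
      proof -
        have "(u t)\<^sup>2 + \<epsilon> > 0" using \<epsilon> by (simp add: add_nonneg_pos)
        moreover have "(2 * u t * v t)\<^sup>2 \<le> 4 * (v t)\<^sup>2 * ((u t)\<^sup>2 + \<epsilon>)"
          using \<epsilon> by (simp add: power_mult_distrib algebra_simps)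
        ultimately show ?thesis by (simp add: pos_divide_le_eq)
      qed
      show *: "AE t in glaw A i. t * (2 * u t * v t)\<^sup>2 / ((u t)\<^sup>2 + \<epsilon>) \<le> 4 * (t * (v t)\<^sup>2)"
        using nn
      proof eventually_elim
        fix t :: real assume "0 \<le> t"
        then show "t * (2 * u t * v t)\<^sup>2 / ((u t)\<^sup>2 + \<epsilon>) \<le> 4 * (t * (v t)\<^sup>2)"
          using mult_left_mono[OF le[of t], of t] by (simp add: mult_ac)
      qed
      show I: "integrable (glaw A i) (\<lambda>t. 4 * (t * (v t)\<^sup>2))"
        using bv by (intro integrable_mult_right L.integrable_const_bound[of _ "K * K"]) (auto simp: measurable_gamma_law)
      show "integrable (glaw A i) (\<lambda>t. t * (2 * u t * v t)\<^sup>2 / ((u t)\<^sup>2 + \<epsilon>))"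
      proof (rule Bochner_Integration.integrable_bound[OF I])
        show "AE t in glaw A i. norm (t * (2 * u t * v t)\<^sup>2 / ((u t)\<^sup>2 + \<epsilon>)) \<le> norm (4 * (t * (v t)\<^sup>2))"
          using * nn
        proof eventually_elim
          fix t :: real assume "t * (2 * u t * v t)\<^sup>2 / ((u t)\<^sup>2 + \<epsilon>) \<le> 4 * (t * (v t)\<^sup>2)" "0 \<le> t"
          moreover have "0 \<le> t * (2 * u t * v t)\<^sup>2 / ((u t)\<^sup>2 + \<epsilon>)" using \<open>0 \<le> t\<close> \<epsilon> by simp
          ultimately show "norm (t * (2 * u t * v t)\<^sup>2 / ((u t)\<^sup>2 + \<epsilon>)) \<le> norm (4 * (t * (v t)\<^sup>2))"
            unfolding real_norm_def by linarith
        qed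
      qed (simp add: measurable_gamma_law)
    qed (use C in simp)
    also have "\<dots> = (\<integral>t. 4 * C * (t * (v t)\<^sup>2) \<partial>glaw A i)" by simp
    finally show "jensen_gap xlnx (glaw A i) (\<lambda>t. f (y(i := t)))
       \<le> (\<integral>t. 4 * C * ((y(i := t)) i * (d i (y(i := t)))\<^sup>2) \<partial>glaw A i)"
      by (simp add: fu v_def)
  qed (use fm fb in auto)
  also have "\<dots> = 4 * C * Eform G F"
    unfolding E by (simp add: sum_distrib_left)
  finally show ?thesis unfolding jensen_gap_def f_def
    using integral_cong_G[of "\<lambda>\<eta>. (F \<eta>)\<^sup>2 + \<epsilon>" "\<lambda>\<eta>. (g (cvec n A \<eta>))\<^sup>2 + \<epsilon>"]
      integral_cong_G[of "\<lambda>\<eta>. xlnx ((F \<eta>)\<^sup>2 + \<epsilon>)" "\<lambda>\<eta>. xlnx ((g (cvec n A \<eta>))\<^sup>2 + \<epsilon>)"] F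
    by simp
qed

end

section \<open>Integration by parts for the Dirichlet form\<close>

text \<open>With \<open>\<sigma>\<close> sending each of the \<open>N\<close> cells of a refinement to the block containing it, \<open>agg\<close> recovers the
  masses of the blocks from those of the cells. The common refinement of two partitions of sizes \<open>n\<close>
  and \<open>m\<close> has the cell \<open>A i \<inter> B j\<close> at index \<open>i * m + j\<close>.\<close>

definition agg :: "nat \<Rightarrow> (nat \<Rightarrow> nat) \<Rightarrow> nat \<Rightarrow> (nat \<Rightarrow> real) \<Rightarrow> nat \<Rightarrow> real" where
  "agg N \<sigma> n y = (\<lambda>i. if i < n then \<Sum>l | l < N \<and> \<sigma> l = i. y l else 0)"

text \<open>The offset \<open>agg N \<sigma> n y (\<sigma> k) - y k\<close> is the total of the
  other cells in the block and does not vary with \<open>y k\<close>; a block therefore moves with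
  its cell at unit speed.\<close>

lemma agg_upd:
  assumes "k < N" "\<sigma> k < n"
  shows "agg N \<sigma> n (y(k := t)) = (agg N \<sigma> n y)(\<sigma> k := t + (agg N \<sigma> n y (\<sigma> k) - y k))"
proof
  fix i
  show "agg N \<sigma> n (y(k := t)) i = ((agg N \<sigma> n y)(\<sigma> k := t + (agg N \<sigma> n y (\<sigma> k) - y k))) i"
  proof (cases "i = \<sigma> k")
    case True
    let ?S = "{l. l < N \<and> \<sigma> l = \<sigma> k}"
    have k: "k \<in> ?S" "finite ?S" using assms by auto
    have "sum (y(k := t)) ?S = t + sum (y(k := t)) (?S - {k})" using sum.remove[OF k(2,1), of "y(k := t)"] by simp
    also have "sum (y(k := t)) (?S - {k}) = sum y (?S - {k})" by (intro sum.cong) auto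
    also have "\<dots> = sum y ?S - y k" using sum.remove[OF k(2,1), of y] by simp
    finally show ?thesis using True assms by (simp add: agg_def)
  next
    case False
    have "(\<Sum>l | l < N \<and> \<sigma> l = i. (y(k := t)) l) = (\<Sum>l | l < N \<and> \<sigma> l = i. y l)"
      using False by (intro sum.cong) auto
    then show ?thesis using False by (simp add: agg_def)
  qed
qed

text \<open>Bounds on a block coordinate times a derivative thereby pass to every cell of the
  block.\<close>

lemma le_agg:
  assumes "k < N" "\<sigma> k < n" "\<And>l. 0 \<le> y l"
  shows "y k \<le> agg N \<sigma> n y (\<sigma> k)"
  using assms member_le_sum[of k "{l. l < N \<and> \<sigma> l = \<sigma> k}" y] by (simp add: agg_def)

lemma agg_measurable: "agg N \<sigma> n \<in> borel_measurable borel"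
proof (rule measurable_coordinatewise_then_product)
  fix i show "(\<lambda>y. agg N \<sigma> n y i) \<in> borel_measurable borel"
    unfolding agg_def by (cases "i < n") (auto intro: measurable_component)
qed

lemma agg_cong: "(\<And>l. l < N \<Longrightarrow> y l = z l) \<Longrightarrow> agg N \<sigma> n y = agg N \<sigma> n z"
  unfolding agg_def by (auto intro!: sum.cong)

lemma cvec_agg:
  fixes \<eta> :: "'a::topological_space measure"
  assumes \<eta>: "\<eta> \<in> Mset" and C: "\<And>l. l < N \<Longrightarrow> C l \<in> sets borel" "disjoint_family_on C {..<N}"
    and A: "\<And>i. i < n \<Longrightarrow> A i = (\<Union>l\<in>{l. l < N \<and> \<sigma> l = i}. C l)"
  shows "cvec n A \<eta> = agg N \<sigma> n (cvec N C \<eta>)"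
proof
  fix i
  have se: "sets \<eta> = sets borel" and fin: "finite_measure \<eta>" using \<eta> by (auto simp: Mset_def)
  interpret finite_measure \<eta> by fact
  show "cvec n A \<eta> i = agg N \<sigma> n (cvec N C \<eta>) i"
  proof (cases "i < n")
    case True
    let ?S = "{l. l < N \<and> \<sigma> l = i}"
    have "measure \<eta> (\<Union>l\<in>?S. C l) = (\<Sum>l\<in>?S. measure \<eta> (C l))"
    proof (rule finite_measure_finite_Union)
      show "C ` ?S \<subseteq> sets \<eta>" using C(1) se by auto
      show "disjoint_family_on C ?S" using C(2) by (rule disjoint_family_on_mono[rotated]) auto
    qed simp
    also have "\<dots> = (\<Sum>l\<in>?S. cvec N C \<eta> l)" by (intro sum.cong) (auto simp: cvec_def)
    finally show ?thesis using True A[OF True] by (simp add: agg_def cvec_def[of n])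
  qed (simp add: agg_def cvec_def)
qed

context gamma_process
begin

lemma ibp_cell:
  assumes C: "\<And>l. l < N \<Longrightarrow> C l \<in> sets borel" "disjoint_family_on C {..<N}"
    and k: "k < N" "\<sigma> k < n" "\<tau> k < m"
    and g: "smooth_cyl n g d dd K" and h: "smooth_cyl m h e ee L"
  defines "a \<equiv> \<lambda>\<eta>. agg N \<sigma> n (cvec N C \<eta>)" and "b \<equiv> \<lambda>\<eta>. agg N \<tau> m (cvec N C \<eta>)"
  shows "(\<integral>\<eta>. measure \<eta> (C k) * (d (\<sigma> k) (a \<eta>) * e (\<tau> k) (b \<eta>)) \<partial>G) =
    - (\<integral>\<eta>. h (b \<eta>) * (measure \<eta> (C k) * dd (\<sigma> k) (a \<eta>) + (measure \<nu> (C k) - measure \<eta> (C k)) * d (\<sigma> k) (a \<eta>)) \<partial>G)"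
proof -
  define i j r where "i = \<sigma> k" and "j = \<tau> k" and "r = measure \<nu> (C k)"
  have ij: "i < n" "j < m" using k by (auto simp: i_def j_def)
  have r: "r \<ge> 0" by (simp add: r_def)
  have N: "N \<ge> 1" using k by simp
  \<comment> \<open>Taking positive parts changes nothing on vectors of masses, but it makes
    \<open>p y k \<le> \<alpha> y i\<close> valid for every real vector. The integrands are then
    bounded everywhere and not merely on the support of the law.\<close>
  define p where "p y = (\<lambda>l. max 0 (y l))" for y :: "nat \<Rightarrow> real"
  have pm: "p \<in> borel_measurable borel"
    unfolding p_def by (intro measurable_coordinatewise_then_product borel_measurable_max borel_measurable_const measurable_component)
  define \<alpha> \<beta> where "\<alpha> y = agg N \<sigma> n (p y)" and "\<beta> y = agg N \<tau> m (p y)" for y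
  have \<alpha>m: "\<alpha> \<in> borel_measurable borel" and \<beta>m: "\<beta> \<in> borel_measurable borel"
    unfolding \<alpha>_def \<beta>_def using measurable_compose[OF pm agg_measurable] by auto
  define f1 where "f1 y = p y k * (d i (\<alpha> y) * e j (\<beta> y))" for y
  define f2 where "f2 y = h (\<beta> y) * (p y k * dd i (\<alpha> y) + (r - p y k) * d i (\<alpha> y))" for y
  have K: "K \<ge> 0" "L \<ge> 0" using smooth_cylD(3)[OF g, of undefined] smooth_cylD(3)[OF h, of undefined] by linarith+
  note gm = smooth_cylD(4,5)[OF g ij(1)] and hm = smooth_cylD(1,4)[OF h]
  have mm: "(\<lambda>y. d i (\<alpha> y)) \<in> borel_measurable borel" "(\<lambda>y. dd i (\<alpha> y)) \<in> borel_measurable borel"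
     "(\<lambda>y. e j (\<beta> y)) \<in> borel_measurable borel" "(\<lambda>y. h (\<beta> y)) \<in> borel_measurable borel"
     "(\<lambda>y. p y k) \<in> borel_measurable borel"
    using measurable_compose[OF \<alpha>m gm(1)] measurable_compose[OF \<alpha>m gm(2)]
      measurable_compose[OF \<beta>m hm(1)] measurable_compose[OF \<beta>m hm(2)[OF ij(2)]]
    by (auto simp: p_def intro: borel_measurable_max measurable_component)
  have fm: "f1 \<in> borel_measurable borel" "f2 \<in> borel_measurable borel"
    unfolding f1_def f2_def using mm by simp_all
  have dep: "depends_below N f1" "depends_below N f2"
  proof -
    have eq: "p y k = p z k \<and> \<alpha> y = \<alpha> z \<and> \<beta> y = \<beta> z" if "\<forall>l<N. y l = z l" for y z
      unfolding \<alpha>_def \<beta>_def using that k by (auto simp: p_def intro: agg_cong)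
    show "depends_below N f1" "depends_below N f2"
      unfolding depends_below_def f1_def f2_def by (intro allI impI, drule eq, simp)+
  qed
  have p0: "0 \<le> p y l" for y l by (simp add: p_def)
  have pk: "0 \<le> p y k" "p y k \<le> \<alpha> y i" for y
    using le_agg[of k N \<sigma> n "p y", OF k(1,2) p0] by (auto simp: p0 \<alpha>_def i_def)
  have b1: "\<bar>p y k * d i (\<alpha> y)\<bar> \<le> K" "\<bar>p y k * dd i (\<alpha> y)\<bar> \<le> K" for y
  proof -
    have "\<bar>p y k * q\<bar> \<le> \<bar>\<alpha> y i * q\<bar>" for q using pk[of y] by (auto simp: abs_mult intro!: mult_right_mono)
    then show "\<bar>p y k * d i (\<alpha> y)\<bar> \<le> K" "\<bar>p y k * dd i (\<alpha> y)\<bar> \<le> K"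
      using smooth_cylD(10,11)[OF g ij(1), of "\<alpha> y"] order_trans by blast+
  qed
  have f1b: "\<bar>f1 y\<bar> \<le> K * L" for y
  proof -
    have "\<bar>p y k * d i (\<alpha> y)\<bar> * \<bar>e j (\<beta> y)\<bar> \<le> K * L"
      using b1(1)[of y] smooth_cylD(8)[OF h ij(2), of "\<beta> y"] K by (intro mult_mono) auto
    then show ?thesis by (simp add: f1_def abs_mult mult.assoc)
  qed
  have f2b: "\<bar>f2 y\<bar> \<le> L * (K + (r * K + K))" for y
  proof -
    have "\<bar>r * d i (\<alpha> y)\<bar> \<le> r * K" unfolding abs_mult using smooth_cylD(8)[OF g ij(1), of "\<alpha> y"] r by (intro mult_mono) auto
    then have "\<bar>p y k * dd i (\<alpha> y) + (r - p y k) * d i (\<alpha> y)\<bar> \<le> K + (r * K + K)"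
      using b1[of y] by (simp add: left_diff_distrib)
    then show ?thesis unfolding f2_def abs_mult
      using smooth_cylD(3)[OF h, of "\<beta> y"] K by (intro mult_mono) auto
  qed
  let ?P = "Pi\<^sub>M {..<N} (glaw C)"
  have fP: "f1 \<in> borel_measurable ?P" "f2 \<in> borel_measurable ?P"
    by (rule measurable_PiM_if_depends[OF fm(1) dep(1)], simp, rule measurable_PiM_if_depends[OF fm(2) dep(2)], simp)
  have slice: "(\<integral>t. f1 (y(k := t)) \<partial>glaw C k) = - (\<integral>t. f2 (y(k := t)) \<partial>glaw C k)" for y
  proof -
    define u where "u t = d i ((\<alpha> y)(i := t + (\<alpha> y i - p y k)))" for t
    define u' where "u' t = dd i ((\<alpha> y)(i := t + (\<alpha> y i - p y k)))" for t
    define v where "v t = h ((\<beta> y)(j := t + (\<beta> y j - p y k)))" for t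
    define v' where "v' t = e j ((\<beta> y)(j := t + (\<beta> y j - p y k)))" for t
    have sm: "(\<lambda>t. w (z(l := t + c))) \<in> borel_measurable borel"
      if "w \<in> borel_measurable borel" for w :: "(nat \<Rightarrow> real) \<Rightarrow> real" and z l and c :: real
      by (rule measurable_compose[OF _ slice_measurable[OF that]]) simp
    have [measurable]: "u \<in> borel_measurable borel" "u' \<in> borel_measurable borel"
        "v \<in> borel_measurable borel" "v' \<in> borel_measurable borel"
      unfolding u_def u'_def v_def v'_def using gm hm ij by (auto intro: sm)
    have nn: "AE t in glaw C k. t \<ge> 0" by (rule AE_gamma_law_nonneg) simp
    have upd: "p (y(k := t)) k = t" "\<alpha> (y(k := t)) = (\<alpha> y)(i := t + (\<alpha> y i - p y k))"
      "\<beta> (y(k := t)) = (\<beta> y)(j := t + (\<beta> y j - p y k))" if "t \<ge> 0" for t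
    proof -
      have "p (y(k := t)) = (p y)(k := t)" using that by (auto simp: p_def)
      then show "p (y(k := t)) k = t" "\<alpha> (y(k := t)) = (\<alpha> y)(i := t + (\<alpha> y i - p y k))"
        "\<beta> (y(k := t)) = (\<beta> y)(j := t + (\<beta> y j - p y k))"
        unfolding \<alpha>_def \<beta>_def i_def j_def using agg_upd[of k N \<sigma> n] agg_upd[of k N \<tau> m] k by auto
    qed
    have sl: "(\<lambda>t. f1 (y(k := t))) \<in> borel_measurable (glaw C k)" "(\<lambda>t. f2 (y(k := t))) \<in> borel_measurable (glaw C k)"
      using slice_measurable[OF fm(1)] slice_measurable[OF fm(2)] by (simp_all add: measurable_gamma_law)
    have "(\<integral>t. f1 (y(k := t)) \<partial>glaw C k) = (\<integral>t. t * u t * v' t \<partial>glaw C k)"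
    proof (rule integral_cong_AE[OF sl(1)])
      show "AE t in glaw C k. f1 (y(k := t)) = t * u t * v' t"
        using nn by eventually_elim (simp add: f1_def upd u_def v'_def)
    qed (simp add: measurable_gamma_law)
    also have "\<dots> = - (\<integral>t. v t * (t * u' t + (r - t) * u t) \<partial>glaw C k)"
      unfolding r_def[symmetric]
    proof (rule gamma_ibp[where K = "max K L"])
      show "(u has_real_derivative u' t) (at t)" for t
        using smooth_cylD(13)[OF g ij(1), of "\<alpha> y" "t + (\<alpha> y i - p y k)"]
        unfolding DERIV_shift u_def u'_def .
      show "(v has_real_derivative v' t) (at t)" for t
        using smooth_cylD(12)[OF h ij(2), of "\<beta> y" "t + (\<beta> y j - p y k)"]
        unfolding DERIV_shift v_def v'_def .
      show "\<bar>u t\<bar> \<le> max K L" "\<bar>u' t\<bar> \<le> max K L" "\<bar>v t\<bar> \<le> max K L" "\<bar>v' t\<bar> \<le> max K L" for t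
        unfolding u_def u'_def v_def v'_def
        using smooth_cylD(8,9)[OF g ij(1)] smooth_cylD(3)[OF h] smooth_cylD(8)[OF h ij(2)] by (auto simp: le_max_iff_disj)
    qed (use r in auto)
    also have "(\<integral>t. v t * (t * u' t + (r - t) * u t) \<partial>glaw C k) = (\<integral>t. f2 (y(k := t)) \<partial>glaw C k)"
    proof (rule integral_cong_AE[OF _ sl(2)])
      show "AE t in glaw C k. v t * (t * u' t + (r - t) * u t) = f2 (y(k := t))"
        using nn by eventually_elim (simp add: f2_def upd u_def u'_def v_def)
    qed (simp add: measurable_gamma_law)
    finally show ?thesis .
  qed
  have cv: "p (cvec N C \<eta>) = cvec N C \<eta>" for \<eta> by (auto simp: p_def cvec_def)
  have c1: "f1 (cvec N C \<eta>) = measure \<eta> (C k) * (d (\<sigma> k) (a \<eta>) * e (\<tau> k) (b \<eta>))" for \<eta>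
    unfolding f1_def \<alpha>_def \<beta>_def cv a_def b_def i_def j_def using k by (simp add: cvec_def)
  have c2: "f2 (cvec N C \<eta>) = h (b \<eta>) * (measure \<eta> (C k) * dd (\<sigma> k) (a \<eta>) + (r - measure \<eta> (C k)) * d (\<sigma> k) (a \<eta>))" for \<eta>
    unfolding f2_def \<alpha>_def \<beta>_def cv a_def b_def i_def j_def using k by (simp add: cvec_def)
  have rs: "(\<integral>\<eta>. f (cvec N C \<eta>) \<partial>G) = (\<integral>y. (\<integral>t. f (y(k := t)) \<partial>glaw C k) \<partial>?P)"
    if "f \<in> borel_measurable borel" "depends_below N f" "f \<in> borel_measurable ?P" "\<And>y. \<bar>f y\<bar> \<le> B" for f B
  proof -
    have "(\<integral>\<eta>. f (cvec N C \<eta>) \<partial>G) = (\<integral>y. f y \<partial>?P)" by (rule integral_cvec[OF N C that(1,2)])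
    also have "\<dots> = (\<integral>y. (\<integral>t. f (y(k := t)) \<partial>glaw C k) \<partial>?P)"
      by (rule PiM_integral_resample[symmetric, where K = B]) (use that k prob_space_glaw in auto)
    finally show ?thesis .
  qed
  have "(\<integral>\<eta>. f1 (cvec N C \<eta>) \<partial>G) = - (\<integral>\<eta>. f2 (cvec N C \<eta>) \<partial>G)"
    unfolding rs[OF fm(1) dep(1) fP(1) f1b] rs[OF fm(2) dep(2) fP(2) f2b] slice by simp
  then show ?thesis unfolding c1 c2 r_def .
qed

text \<open>The generator on cylinder functions: a sum over the blocks of Laguerre operators
  \<open>x * f'' + (r - x) * f'\<close>, where \<open>r\<close> is the \<open>\<nu>\<close>-mass of
  the block.\<close>

definition cyl_gen :: "nat \<Rightarrow> (nat \<Rightarrow> 'a set) \<Rightarrow> (nat \<Rightarrow> (nat \<Rightarrow> real) \<Rightarrow> real) \<Rightarrow> (nat \<Rightarrow> (nat \<Rightarrow> real) \<Rightarrow> real)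
    \<Rightarrow> 'a measure \<Rightarrow> real" where
  "cyl_gen n A d dd \<eta> = (\<Sum>i<n. measure \<eta> (A i) * dd i (cvec n A \<eta>) + (measure \<nu> (A i) - measure \<eta> (A i)) * d i (cvec n A \<eta>))"

lemma cell_bound:
  assumes g: "smooth_cyl n g d dd K" and i: "i < n" and A: "A i \<in> sets borel" and B: "B \<in> sets borel" and \<eta>: "\<eta> \<in> Mset"
  shows "\<bar>measure \<eta> (A i \<inter> B) * d i (cvec n A \<eta>)\<bar> \<le> K" "\<bar>measure \<eta> (A i \<inter> B) * dd i (cvec n A \<eta>)\<bar> \<le> K"
proof -
  have se: "sets \<eta> = sets borel" and fin: "finite_measure \<eta>" using \<eta> by (auto simp: Mset_def)
  interpret finite_measure \<eta> by fact
  have "measure \<eta> (A i \<inter> B) \<le> measure \<eta> (A i)" using A B se by (intro finite_measure_mono) auto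
  then have "\<bar>measure \<eta> (A i \<inter> B) * q\<bar> \<le> \<bar>cvec n A \<eta> i * q\<bar>" for q
    using i by (auto simp: cvec_def abs_mult intro!: mult_right_mono)
  then show "\<bar>measure \<eta> (A i \<inter> B) * d i (cvec n A \<eta>)\<bar> \<le> K" "\<bar>measure \<eta> (A i \<inter> B) * dd i (cvec n A \<eta>)\<bar> \<le> K"
    using smooth_cylD(10,11)[OF g i, of "cvec n A \<eta>"] order_trans by blast+
qed

lemma refine_index: "i < n \<Longrightarrow> j < m \<Longrightarrow> i * m + j < n * (m :: nat)"
proof -
  assume "i < n" "j < m"
  then have "i * m + j < (i + 1) * m" by simp
  also have "\<dots> \<le> n * m" using \<open>i < n\<close> by (intro mult_right_mono) auto
  finally show ?thesis .
qed

lemma measure_inter_sum: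
  fixes \<eta> :: "'a measure" and m :: nat
  assumes \<eta>: "\<eta> \<in> Mset" and A: "A \<in> sets borel" and B: "\<And>j. j < m \<Longrightarrow> B j \<in> sets borel"
    "disjoint_family_on B {..<m}" "(\<Union>j<m. B j) = UNIV"
  shows "(\<Sum>j<m. measure \<eta> (A \<inter> B j)) = measure \<eta> A"
proof -
  have se: "sets \<eta> = sets borel" and fin: "finite_measure \<eta>" using \<eta> by (auto simp: Mset_def)
  interpret finite_measure \<eta> by fact
  have "measure \<eta> (\<Union>j<m. A \<inter> B j) = (\<Sum>j<m. measure \<eta> (A \<inter> B j))"
    by (rule finite_measure_finite_Union) (use A B se in \<open>auto simp: disjoint_family_on_def\<close>)
  moreover have "(\<Union>j<m. A \<inter> B j) = A" using B(3) by auto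
  ultimately show ?thesis by simp
qed

lemma inner_cyl:
  fixes F F' :: "'a measure \<Rightarrow> real"
  assumes g: "smooth_cyl n g d dd K" and A: "\<And>i. i < n \<Longrightarrow> A i \<in> sets borel"
    "disjoint_family_on A {..<n}" "(\<Union>i<n. A i) = UNIV"
    and F: "\<And>\<eta>. \<eta> \<in> Mset \<Longrightarrow> F \<eta> = g (cvec n A \<eta>)"
    and h: "smooth_cyl m h e ee L" and B: "\<And>j. j < m \<Longrightarrow> B j \<in> sets borel"
    "disjoint_family_on B {..<m}" "(\<Union>j<m. B j) = UNIV"
    and F': "\<And>\<eta>. \<eta> \<in> Mset \<Longrightarrow> F' \<eta> = h (cvec m B \<eta>)"
    and \<eta>: "\<eta> \<in> Mset"
  shows "(\<integral>x. grad_ext F \<eta> x * grad_ext F' \<eta> x \<partial>\<eta>) =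
    (\<Sum>i<n. \<Sum>j<m. measure \<eta> (A i \<inter> B j) * (d i (cvec n A \<eta>) * e j (cvec m B \<eta>)))"
proof -
  have gr: "grad_ext F \<eta> x = cyl_grad n A d \<eta> x" for x
    by (rule grad_ext_eq[OF has_egrad_cyl[OF g A F] \<eta>])
  have gr': "grad_ext F' \<eta> x = cyl_grad m B e \<eta> x" for x
    by (rule grad_ext_eq[OF has_egrad_cyl[OF h B F'] \<eta>])
  show ?thesis unfolding gr gr' by (rule cyl_grad_inner[OF \<eta> A(1) B(1)])
qed

lemma cell_integrable:
  assumes g: "smooth_cyl n g d dd K" and A: "\<And>i. i < n \<Longrightarrow> A i \<in> sets borel"
    and h: "smooth_cyl m h e ee L" and B: "\<And>j. j < m \<Longrightarrow> B j \<in> sets borel" and ij: "i < n" "j < m"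
  shows "integrable G (\<lambda>\<eta>. measure \<eta> (A i \<inter> B j) * (d i (cvec n A \<eta>) * e j (cvec m B \<eta>)))"
    "integrable G (\<lambda>\<eta>. h (cvec m B \<eta>) * (measure \<eta> (A i \<inter> B j) * dd i (cvec n A \<eta>)
       + (c - measure \<eta> (A i \<inter> B j)) * d i (cvec n A \<eta>)))"
proof -
  have K: "K \<ge> 0" "L \<ge> 0" using smooth_cylD(3)[OF g, of undefined] smooth_cylD(3)[OF h, of undefined] by linarith+
  note [measurable] = measurable_comp_cvec[OF A smooth_cylD(4)[OF g ij(1)]] measurable_comp_cvec[OF A smooth_cylD(5)[OF g ij(1)]]
    measurable_comp_cvec[OF B smooth_cylD(4)[OF h ij(2)]] measurable_comp_cvec[OF B smooth_cylD(1)[OF h]]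
  have [measurable]: "A i \<inter> B j \<in> sets borel" using A B ij by auto
  show "integrable G (\<lambda>\<eta>. measure \<eta> (A i \<inter> B j) * (d i (cvec n A \<eta>) * e j (cvec m B \<eta>)))"
  proof (rule integrable_bounded_G)
    fix \<eta> :: "'a measure" assume \<eta>: "\<eta> \<in> Mset"
    have "\<bar>measure \<eta> (A i \<inter> B j) * d i (cvec n A \<eta>)\<bar> * \<bar>e j (cvec m B \<eta>)\<bar> \<le> K * L"
      using cell_bound(1)[where A = A and i = i and d = d and dd = dd, OF g ij(1) A[OF ij(1)] B[OF ij(2)] \<eta>] smooth_cylD(8)[OF h ij(2)] K by (intro mult_mono) auto
    then show "\<bar>measure \<eta> (A i \<inter> B j) * (d i (cvec n A \<eta>) * e j (cvec m B \<eta>))\<bar> \<le> K * L"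
      by (simp add: abs_mult mult.assoc)
  qed measurable
  show "integrable G (\<lambda>\<eta>. h (cvec m B \<eta>) * (measure \<eta> (A i \<inter> B j) * dd i (cvec n A \<eta>)
       + (c - measure \<eta> (A i \<inter> B j)) * d i (cvec n A \<eta>)))"
  proof (rule integrable_bounded_G)
    fix \<eta> :: "'a measure" assume \<eta>: "\<eta> \<in> Mset"
    let ?x = "cvec n A \<eta>"
    have 1: "\<bar>c * d i ?x\<bar> \<le> \<bar>c\<bar> * K" unfolding abs_mult using smooth_cylD(8)[OF g ij(1), of ?x] by (intro mult_left_mono) auto
    have "\<bar>measure \<eta> (A i \<inter> B j) * dd i ?x + (c - measure \<eta> (A i \<inter> B j)) * d i ?x\<bar> \<le> K + (\<bar>c\<bar> * K + K)"
      using cell_bound[where A = A and i = i and d = d and dd = dd, OF g ij(1) A[OF ij(1)] B[OF ij(2)] \<eta>] 1 by (simp add: left_diff_distrib)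
    then show "\<bar>h (cvec m B \<eta>) * (measure \<eta> (A i \<inter> B j) * dd i ?x + (c - measure \<eta> (A i \<inter> B j)) * d i ?x)\<bar>
        \<le> L * (K + (\<bar>c\<bar> * K + K))"
      unfolding abs_mult using smooth_cylD(3)[OF h, of "cvec m B \<eta>"] K by (intro mult_mono) auto
  qed measurable
qed

text \<open>Sum \<open>ibp_cell\<close> over the common refinement. On the right the coefficients
  are additive in the cell and \<open>h\<close> is a common factor, so the sum over \<open>j\<close>
  restores the blocks \<open>A i\<close>. Hence the generator of \<open>F\<close> does not see the
  partition of \<open>F'\<close>.\<close>

lemma ibp_cyl:
  assumes g: "smooth_cyl n g d dd K" and A: "\<And>i. i < n \<Longrightarrow> A i \<in> sets borel"
    "disjoint_family_on A {..<n}" "(\<Union>i<n. A i) = UNIV"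
    and F: "\<And>\<eta>. \<eta> \<in> Mset \<Longrightarrow> F \<eta> = g (cvec n A \<eta>)"
    and h: "smooth_cyl m h e ee L" and B: "\<And>j. j < m \<Longrightarrow> B j \<in> sets borel"
    "disjoint_family_on B {..<m}" "(\<Union>j<m. B j) = UNIV"
    and F': "\<And>\<eta>. \<eta> \<in> Mset \<Longrightarrow> F' \<eta> = h (cvec m B \<eta>)"
  shows "EB F F' = - (\<integral>\<eta>. F' \<eta> * cyl_gen n A d dd \<eta> \<partial>G)"
proof -
  define N C where "N = n * m" and "C l = A (l div m) \<inter> B (l mod m)" for l
  have dm: "l div m < n" "l mod m < m" if "l < N" for l
  proof -
    have "m > 0" using that by (cases m) (auto simp: N_def)
    then show "l div m < n" "l mod m < m" using that by (auto simp: N_def less_mult_imp_div_less)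
  qed
  have C: "C l \<in> sets borel" if "l < N" for l unfolding C_def using A B dm[OF that] by auto
  have Cd: "disjoint_family_on C {..<N}"
    unfolding disjoint_family_on_def
  proof (intro ballI impI)
    fix k l assume kl: "k \<in> {..<N}" "l \<in> {..<N}" "k \<noteq> l"
    then have "k div m \<noteq> l div m \<or> k mod m \<noteq> l mod m" by (metis div_mult_mod_eq)
    then have "A (k div m) \<inter> A (l div m) = {} \<or> B (k mod m) \<inter> B (l mod m) = {}"
      using A(2) B(2) dm[of k] dm[of l] kl(1,2) unfolding disjoint_family_on_def by (meson lessThan_iff)
    then show "C k \<inter> C l = {}" unfolding C_def by blast
  qed
  have kl: "i * m + j < N" "(i * m + j) div m = i" "(i * m + j) mod m = j" if "i < n" "j < m" for i j
    using that refine_index[OF that] by (auto simp: N_def)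
  have UA: "A i = (\<Union>l\<in>{l. l < N \<and> l div m = i}. C l)" if i: "i < n" for i
  proof (intro set_eqI iffI)
    fix x assume x: "x \<in> A i"
    obtain j where j: "j < m" "x \<in> B j" using B(3) by blast
    show "x \<in> (\<Union>l\<in>{l. l < N \<and> l div m = i}. C l)"
      using x j kl[OF i j(1)] by (auto simp: C_def intro!: bexI[of _ "i * m + j"])
  qed (auto simp: C_def)
  have UB: "B j = (\<Union>l\<in>{l. l < N \<and> l mod m = j}. C l)" if j: "j < m" for j
  proof (intro set_eqI iffI)
    fix x assume x: "x \<in> B j"
    obtain i where i: "i < n" "x \<in> A i" using A(3) by blast
    show "x \<in> (\<Union>l\<in>{l. l < N \<and> l mod m = j}. C l)"
      using x i kl[OF i(1) j] by (auto simp: C_def intro!: bexI[of _ "i * m + j"])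
  qed (auto simp: C_def)
  have ca: "cvec n A \<eta> = agg N (\<lambda>l. l div m) n (cvec N C \<eta>)" and cb: "cvec m B \<eta> = agg N (\<lambda>l. l mod m) m (cvec N C \<eta>)"
    if "\<eta> \<in> Mset" for \<eta>
    by (rule cvec_agg[OF that C Cd UA], assumption+) (rule cvec_agg[OF that C Cd UB], assumption+)
  let ?J = "\<lambda>i j \<eta>. h (cvec m B \<eta>) * (measure \<eta> (A i \<inter> B j) * dd i (cvec n A \<eta>)
       + (measure \<nu> (A i \<inter> B j) - measure \<eta> (A i \<inter> B j)) * d i (cvec n A \<eta>))"
  let ?I = "\<lambda>i j \<eta>. measure \<eta> (A i \<inter> B j) * (d i (cvec n A \<eta>) * e j (cvec m B \<eta>))"
  have cell: "(\<integral>\<eta>. ?I i j \<eta> \<partial>G) = - (\<integral>\<eta>. ?J i j \<eta> \<partial>G)" if ij: "i < n" "j < m" for i j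
  proof -
    have Ck: "C (i * m + j) = A i \<inter> B j" using kl[OF ij] by (simp add: C_def)
    have "(\<integral>\<eta>. ?I i j \<eta> \<partial>G) = (\<integral>\<eta>. measure \<eta> (A i \<inter> B j) *
        (d i (agg N (\<lambda>l. l div m) n (cvec N C \<eta>)) * e j (agg N (\<lambda>l. l mod m) m (cvec N C \<eta>))) \<partial>G)"
      by (rule integral_cong_G) (simp add: ca cb)
    also have "\<dots> = - (\<integral>\<eta>. h (agg N (\<lambda>l. l mod m) m (cvec N C \<eta>)) * (measure \<eta> (A i \<inter> B j) * dd i (agg N (\<lambda>l. l div m) n (cvec N C \<eta>))
       + (measure \<nu> (A i \<inter> B j) - measure \<eta> (A i \<inter> B j)) * d i (agg N (\<lambda>l. l div m) n (cvec N C \<eta>))) \<partial>G)"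
      using ibp_cell[OF C Cd kl(1)[OF ij], of "\<lambda>l. l div m" n "\<lambda>l. l mod m" m, OF _ _ _ g h] ij
      unfolding Ck kl(2,3)[OF ij] by blast
    also have "(\<integral>\<eta>. h (agg N (\<lambda>l. l mod m) m (cvec N C \<eta>)) * (measure \<eta> (A i \<inter> B j) * dd i (agg N (\<lambda>l. l div m) n (cvec N C \<eta>))
       + (measure \<nu> (A i \<inter> B j) - measure \<eta> (A i \<inter> B j)) * d i (agg N (\<lambda>l. l div m) n (cvec N C \<eta>))) \<partial>G) = (\<integral>\<eta>. ?J i j \<eta> \<partial>G)"
      by (rule integral_cong_G) (simp add: ca cb)
    finally show ?thesis .
  qed
  have "EB F F' = (\<integral>\<eta>. (\<Sum>i<n. \<Sum>j<m. ?I i j \<eta>) \<partial>G)"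
    unfolding EB_def by (rule integral_cong_G) (rule inner_cyl[OF g A F h B F'])
  also have "\<dots> = (\<Sum>i<n. \<integral>\<eta>. (\<Sum>j<m. ?I i j \<eta>) \<partial>G)"
    by (intro Bochner_Integration.integral_sum Bochner_Integration.integrable_sum cell_integrable(1)[OF g A(1) h B(1)]) auto
  also have "\<dots> = (\<Sum>i<n. \<Sum>j<m. \<integral>\<eta>. ?I i j \<eta> \<partial>G)"
    by (intro sum.cong refl Bochner_Integration.integral_sum cell_integrable(1)[OF g A(1) h B(1)]) auto
  also have "\<dots> = - (\<Sum>i<n. \<Sum>j<m. \<integral>\<eta>. ?J i j \<eta> \<partial>G)"
    by (simp add: cell sum_negf)
  also have "(\<Sum>i<n. \<Sum>j<m. \<integral>\<eta>. ?J i j \<eta> \<partial>G) = (\<Sum>i<n. \<integral>\<eta>. (\<Sum>j<m. ?J i j \<eta>) \<partial>G)"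
    by (intro sum.cong refl Bochner_Integration.integral_sum[symmetric] cell_integrable(2)[OF g A(1) h B(1)]) auto
  also have "\<dots> = (\<integral>\<eta>. (\<Sum>i<n. \<Sum>j<m. ?J i j \<eta>) \<partial>G)"
    by (intro Bochner_Integration.integral_sum[symmetric] Bochner_Integration.integrable_sum cell_integrable(2)[OF g A(1) h B(1)]) auto
  also have "\<dots> = (\<integral>\<eta>. F' \<eta> * cyl_gen n A d dd \<eta> \<partial>G)"
  proof (rule integral_cong_G)
    fix \<eta> :: "'a measure" assume \<eta>: "\<eta> \<in> Mset"
    have "(\<Sum>j<m. ?J i j \<eta>) = h (cvec m B \<eta>) * (measure \<eta> (A i) * dd i (cvec n A \<eta>) + (measure \<nu> (A i) - measure \<eta> (A i)) * d i (cvec n A \<eta>))"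
      if "i < n" for i
      using measure_inter_sum[OF \<eta> A(1)[OF that] B] measure_inter_sum[OF \<nu> A(1)[OF that] B]
      by (simp add: sum_distrib_left[symmetric] sum.distrib sum_subtractf sum_distrib_right[symmetric] left_diff_distrib)
    then show "(\<Sum>i<n. \<Sum>j<m. ?J i j \<eta>) = F' \<eta> * cyl_gen n A d dd \<eta>"
      unfolding F'[OF \<eta>] cyl_gen_def by (simp add: sum_distrib_left)
  qed
  finally show ?thesis .
qed

end

section \<open>Closability and the closed form\<close>

text \<open>The best parameter is \<open>t = sqrt b / sqrt a\<close>. If \<open>a\<close> or
  \<open>b\<close> vanishes, a positive \<open>c\<close> is refuted by the large value
  \<open>t = (b + 1) / c\<close> or the small value \<open>t = c / (a + 1)\<close>.\<close>

lemma geometric_mean_bound: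
  fixes a b c :: real
  assumes "a \<ge> 0" "b \<ge> 0" and le: "\<And>t. t > 0 \<Longrightarrow> 2 * c \<le> t * a + b / t"
  shows "c \<le> sqrt a * sqrt b"
proof -
  consider "a = 0" | "b = 0" | "a > 0" "b > 0" using assms by linarith
  then show ?thesis
  proof cases
    case 1
    have "c \<le> 0"
    proof (rule ccontr)
      assume "\<not> c \<le> 0"
      then have c: "c > 0" by simp
      have "2 * c \<le> b / ((b + 1) / c)" using le[of "(b + 1) / c"] c assms 1 by simp
      also have "\<dots> = c * (b / (b + 1))" by simp
      also have "\<dots> \<le> c * 1" using c assms by (intro mult_left_mono) auto
      finally show False using c by simp
    qed
    then show ?thesis using 1 by simp
  next
    case 2
    have "c \<le> 0"
    proof (rule ccontr)
      assume "\<not> c \<le> 0"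
      then have c: "c > 0" by simp
      have "2 * c \<le> c / (a + 1) * a" using le[of "c / (a + 1)"] c assms 2 by simp
      also have "\<dots> = c * (a / (a + 1))" by simp
      also have "\<dots> \<le> c * 1" using c assms by (intro mult_left_mono) auto
      finally show False using c by simp
    qed
    then show ?thesis using 2 by simp
  next
    case 3
    define p q where "p = sqrt a" and "q = sqrt b"
    have pq: "p > 0" "q > 0" "a = p * p" "b = q * q" using 3 by (auto simp: p_def q_def)
    have "2 * c \<le> q / p * a + b / (q / p)" using pq by (intro le) auto
    also have "\<dots> = 2 * (p * q)" using pq by (simp add: field_simps)
    finally show ?thesis by (simp add: p_def q_def)
  qed
qed

lemma integral_Cauchy_Schwarz:
  fixes f h :: "'b \<Rightarrow> real"
  assumes [measurable]: "f \<in> borel_measurable M" "h \<in> borel_measurable M"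
    and f: "integrable M (\<lambda>x. (f x)\<^sup>2)" and h: "integrable M (\<lambda>x. (h x)\<^sup>2)"
  shows "integrable M (\<lambda>x. f x * h x)"
    "\<bar>\<integral>x. f x * h x \<partial>M\<bar> \<le> sqrt (\<integral>x. (f x)\<^sup>2 \<partial>M) * sqrt (\<integral>x. (h x)\<^sup>2 \<partial>M)"
proof -
  have young: "2 * \<bar>p * q\<bar> \<le> t * p\<^sup>2 + q\<^sup>2 / t" if "t > 0" for p q t :: real
  proof -
    have "0 \<le> (t * \<bar>p\<bar> - \<bar>q\<bar>)\<^sup>2 / t" using that by simp
    also have "\<dots> = t * p\<^sup>2 + q\<^sup>2 / t - 2 * \<bar>p * q\<bar>" using that by (simp add: power2_eq_square field_simps abs_mult)
    finally show ?thesis by simp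
  qed
  show I: "integrable M (\<lambda>x. f x * h x)"
  proof (rule Bochner_Integration.integrable_bound)
    show "integrable M (\<lambda>x. (f x)\<^sup>2 + (h x)\<^sup>2)" using f h by simp
    have "norm (f x * h x) \<le> norm ((f x)\<^sup>2 + (h x)\<^sup>2)" for x
    proof -
      have "2 * \<bar>f x * h x\<bar> \<le> (f x)\<^sup>2 + (h x)\<^sup>2" using young[of 1 "f x" "h x"] by simp
      moreover have "0 \<le> \<bar>f x * h x\<bar>" by simp
      ultimately show ?thesis unfolding real_norm_def by linarith
    qed
    then show "AE x in M. norm (f x * h x) \<le> norm ((f x)\<^sup>2 + (h x)\<^sup>2)" by simp
  qed measurable
  have "(\<integral>x. \<bar>f x * h x\<bar> \<partial>M) \<le> sqrt (\<integral>x. (f x)\<^sup>2 \<partial>M) * sqrt (\<integral>x. (h x)\<^sup>2 \<partial>M)"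
  proof (rule geometric_mean_bound)
    fix t :: real assume t: "t > 0"
    have "(\<integral>x. 2 * \<bar>f x * h x\<bar> \<partial>M) \<le> (\<integral>x. t * (f x)\<^sup>2 + (h x)\<^sup>2 / t \<partial>M)"
      using I f h young[OF t] by (intro integral_mono) auto
    then show "2 * (\<integral>x. \<bar>f x * h x\<bar> \<partial>M) \<le> t * (\<integral>x. (f x)\<^sup>2 \<partial>M) + (\<integral>x. (h x)\<^sup>2 \<partial>M) / t"
      using f h I by simp
  qed auto
  then show "\<bar>\<integral>x. f x * h x \<partial>M\<bar> \<le> sqrt (\<integral>x. (f x)\<^sup>2 \<partial>M) * sqrt (\<integral>x. (h x)\<^sup>2 \<partial>M)"
    using integral_abs_bound[of M "\<lambda>x. f x * h x"] by linarith
qed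

text \<open>Differences of functions in \<open>FC0\<close> live on different partitions, so \<open>FC0\<close> itself is not obviously
  closed under subtraction.\<close>

inductive FC_span :: "('a::topological_space measure \<Rightarrow> real) \<Rightarrow> bool" where
  base: "F \<in> FC0 \<Longrightarrow> FC_span F"
| diff: "FC_span F \<Longrightarrow> FC_span F' \<Longrightarrow> FC_span (\<lambda>\<eta>. F \<eta> - F' \<eta>)"

section \<open>The energy form as a semi-inner product\<close>

context gamma_process
begin

lemma has_egrad_grad_ext: "has_egrad F D \<Longrightarrow> has_egrad F (grad_ext F)"
  using grad_ext_eq[of F D] unfolding has_egrad_def by simp

lemma FC_span_measurable:
  assumes "FC_span F" shows "F \<in> borel_measurable G"
  using assms by induction (auto simp: FC0_measurable)

lemma FC_span_bounded:
  assumes "FC_span F" shows "\<exists>K. \<forall>\<eta>\<in>Mset. \<bar>F \<eta>\<bar> \<le> K"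
  using assms
proof induction
  case (base F) then show ?case by (rule FC0_bounded)
next
  case (diff F F')
  then obtain K L where "\<forall>\<eta>\<in>Mset. \<bar>F \<eta>\<bar> \<le> K" "\<forall>\<eta>\<in>Mset. \<bar>F' \<eta>\<bar> \<le> L" by blast
  then have "\<forall>\<eta>\<in>Mset. \<bar>F \<eta> - F' \<eta>\<bar> \<le> K + L" using abs_triangle_ineq4 by (smt (verit))
  then show ?case by blast
qed

lemma FC_span_integrable:
  assumes "FC_span F" shows "integrable G F" "integrable G (\<lambda>\<eta>. (F \<eta>)\<^sup>2)"
proof -
  obtain K where K: "\<And>\<eta>. \<eta> \<in> Mset \<Longrightarrow> \<bar>F \<eta>\<bar> \<le> K" using FC_span_bounded[OF assms] by blast
  note [measurable] = FC_span_measurable[OF assms]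
  show "integrable G F" by (rule integrable_bounded_G[OF _ K]) measurable
  show "integrable G (\<lambda>\<eta>. (F \<eta>)\<^sup>2)"
  proof (rule integrable_bounded_G)
    show "\<bar>(F \<eta>)\<^sup>2\<bar> \<le> K\<^sup>2" if "\<eta> \<in> Mset" for \<eta> using power_mono[OF K[OF that], of 2] by simp
  qed measurable
qed

text \<open>Existence is what makes \<open>grad_ext\<close> linear on the span; measurability and
  boundedness in \<open>x\<close> make products of gradients integrable against each finite measure
  \<open>\<eta>\<close>.\<close>

lemma FC_span_egrad:
  fixes F :: "'a measure \<Rightarrow> real"
  assumes "FC_span F"
  shows "has_egrad F (grad_ext F) \<and> (\<forall>\<eta>\<in>Mset. grad_ext F \<eta> \<in> borel_measurable borel) \<and>
    (\<exists>K. \<forall>\<eta>\<in>Mset. \<forall>x. \<bar>grad_ext F \<eta> x\<bar> \<le> K)"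
  using assms
proof induction
  case (base F)
  then show ?case
  proof (rule FC0_smooth_cyl)
    fix n g d dd K and A :: "nat \<Rightarrow> 'a set"
    assume g: "smooth_cyl n g d dd K" and A: "\<And>i. i < n \<Longrightarrow> A i \<in> sets borel"
      "disjoint_family_on A {..<n}" "(\<Union>i<n. A i) = UNIV"
      and F: "\<And>\<eta>. \<eta> \<in> Mset \<Longrightarrow> F \<eta> = g (cvec n A \<eta>)"
    have D: "has_egrad F (cyl_grad n A d)" by (rule has_egrad_cyl[OF g A F])
    have "grad_ext F \<eta> = cyl_grad n A d \<eta>" if "\<eta> \<in> Mset" for \<eta>
      using grad_ext_eq[OF D that] by blast
    then show ?thesis
      using has_egrad_grad_ext[OF D] cyl_grad_measurable[of n A d, OF A(1)] cyl_grad_bound[OF A(2,3) g]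
      by (intro conjI exI[of _ K]) auto
  qed
next
  case (diff F F')
  have D: "has_egrad (\<lambda>\<eta>. F \<eta> - F' \<eta>) (\<lambda>\<eta> x. grad_ext F \<eta> x - grad_ext F' \<eta> x)"
    using diff by (intro has_egrad_diff) auto
  have eq: "grad_ext (\<lambda>\<eta>. F \<eta> - F' \<eta>) \<eta> = (\<lambda>x. grad_ext F \<eta> x - grad_ext F' \<eta> x)" if "\<eta> \<in> Mset" for \<eta>
    using grad_ext_eq[OF D that] by blast
  obtain K L where "\<forall>\<eta>\<in>Mset. \<forall>x. \<bar>grad_ext F \<eta> x\<bar> \<le> K" "\<forall>\<eta>\<in>Mset. \<forall>x. \<bar>grad_ext F' \<eta> x\<bar> \<le> L"
    using diff by blast
  then have "\<forall>\<eta>\<in>Mset. \<forall>x. \<bar>grad_ext F \<eta> x - grad_ext F' \<eta> x\<bar> \<le> K + L"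
    using abs_triangle_ineq4 by (smt (verit))
  then have "\<exists>K. \<forall>\<eta>\<in>Mset. \<forall>x. \<bar>grad_ext (\<lambda>\<eta>. F \<eta> - F' \<eta>) \<eta> x\<bar> \<le> K" using eq by auto
  moreover have "grad_ext (\<lambda>\<eta>. F \<eta> - F' \<eta>) \<eta> \<in> borel_measurable borel" if "\<eta> \<in> Mset" for \<eta>
    unfolding eq[OF that] using diff.IH that by (intro borel_measurable_diff) auto
  ultimately show ?case using has_egrad_grad_ext[OF D] by blast
qed

lemma grad_ext_diff:
  fixes F F' :: "'a measure \<Rightarrow> real"
  assumes "FC_span F" "FC_span F'" "\<eta> \<in> Mset"
  shows "grad_ext (\<lambda>\<eta>. F \<eta> - F' \<eta>) \<eta> x = grad_ext F \<eta> x - grad_ext F' \<eta> x"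
  using has_egrad_diff[of F "grad_ext F" F' "grad_ext F'"] FC_span_egrad assms
  by (intro grad_ext_eq) auto

definition ip :: "('a measure \<Rightarrow> real) \<Rightarrow> ('a measure \<Rightarrow> real) \<Rightarrow> 'a measure \<Rightarrow> real" where
  "ip F F' \<eta> = (\<integral>x. grad_ext F \<eta> x * grad_ext F' \<eta> x \<partial>\<eta>)"

lemma EB_ip: "EB F F' = (\<integral>\<eta>. ip F F' \<eta> \<partial>G)"
  by (simp add: EB_def ip_def)

lemma ip_commute: "ip F F' = ip F' F"
  by (rule ext) (simp add: ip_def mult.commute)

lemma integrable_cong_G:
  assumes "integrable G h" "\<And>\<eta>. \<eta> \<in> Mset \<Longrightarrow> f \<eta> = h \<eta>"
  shows "integrable G f"
  using assms Bochner_Integration.integrable_cong[OF refl, of G f h] by (simp add: space_G)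

lemma ip_inner_integrable:
  fixes F F' :: "'a measure \<Rightarrow> real"
  assumes "FC_span F" "FC_span F'" "\<eta> \<in> Mset"
  shows "integrable \<eta> (\<lambda>x. grad_ext F \<eta> x * grad_ext F' \<eta> x)"
proof -
  have se: "sets \<eta> = sets borel" and fin: "finite_measure \<eta>" using assms by (auto simp: Mset_def)
  interpret finite_measure \<eta> by fact
  obtain K where K: "\<And>x. \<bar>grad_ext F \<eta> x\<bar> \<le> K" using FC_span_egrad[OF assms(1)] assms(3) by blast
  obtain L where L: "\<And>x. \<bar>grad_ext F' \<eta> x\<bar> \<le> L" using FC_span_egrad[OF assms(2)] assms(3) by blast
  have m: "grad_ext F \<eta> \<in> borel_measurable borel" "grad_ext F' \<eta> \<in> borel_measurable borel"
    using FC_span_egrad[OF assms(1)] FC_span_egrad[OF assms(2)] assms(3) by auto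
  have "(\<lambda>x. grad_ext F \<eta> x * grad_ext F' \<eta> x) \<in> borel_measurable \<eta>"
    unfolding measurable_cong_sets[OF se refl] using m by simp
  moreover have "norm (grad_ext F \<eta> x * grad_ext F' \<eta> x) \<le> K * L" for x
    unfolding real_norm_def abs_mult using K[of x] L[of x] by (intro mult_mono) auto
  ultimately show ?thesis by (intro integrable_const_bound[of _ "K * L"]) auto
qed

lemma ip_diff_left:
  assumes "FC_span F1" "FC_span F2" "FC_span F'" "\<eta> \<in> Mset"
  shows "ip (\<lambda>\<eta>. F1 \<eta> - F2 \<eta>) F' \<eta> = ip F1 F' \<eta> - ip F2 F' \<eta>"
  unfolding ip_def using assms
  by (simp add: grad_ext_diff left_diff_distrib ip_inner_integrable)

lemma ip_integrable_base:
  assumes "F \<in> FC0" "F' \<in> FC0"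
  shows "integrable G (ip F F')"
  using assms(1)
proof (rule FC0_smooth_cyl)
  fix n g d dd K and A :: "nat \<Rightarrow> 'a set"
  assume g: "smooth_cyl n g d dd K" and A: "\<And>i. i < n \<Longrightarrow> A i \<in> sets borel"
    "disjoint_family_on A {..<n}" "(\<Union>i<n. A i) = UNIV"
    and F: "\<And>\<eta>. \<eta> \<in> Mset \<Longrightarrow> F \<eta> = g (cvec n A \<eta>)"
  show ?thesis using assms(2)
  proof (rule FC0_smooth_cyl)
    fix m h e ee L and B :: "nat \<Rightarrow> 'a set"
    assume h: "smooth_cyl m h e ee L" and B: "\<And>i. i < m \<Longrightarrow> B i \<in> sets borel"
      "disjoint_family_on B {..<m}" "(\<Union>i<m. B i) = UNIV"
      and F': "\<And>\<eta>. \<eta> \<in> Mset \<Longrightarrow> F' \<eta> = h (cvec m B \<eta>)"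
    have "integrable G (\<lambda>\<eta>. \<Sum>i<n. \<Sum>j<m. measure \<eta> (A i \<inter> B j) * (d i (cvec n A \<eta>) * e j (cvec m B \<eta>)))"
      by (intro Bochner_Integration.integrable_sum cell_integrable(1)[OF g A(1) h B(1)]) auto
    moreover have "ip F F' \<eta> = (\<Sum>i<n. \<Sum>j<m. measure \<eta> (A i \<inter> B j) * (d i (cvec n A \<eta>) * e j (cvec m B \<eta>)))"
      if "\<eta> \<in> Mset" for \<eta>
      unfolding ip_def using that by (intro inner_cyl[OF g A F h B F'])
    ultimately show ?thesis by (rule integrable_cong_G)
  qed
qed

lemma ip_integrable_diff:
  assumes "FC_span F1" "FC_span F2" "FC_span F'" "integrable G (ip F1 F')" "integrable G (ip F2 F')"
  shows "integrable G (ip (\<lambda>\<eta>. F1 \<eta> - F2 \<eta>) F')"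
proof -
  have "integrable G (\<lambda>\<eta>. ip F1 F' \<eta> - ip F2 F' \<eta>)" using assms by simp
  moreover have "ip (\<lambda>\<eta>. F1 \<eta> - F2 \<eta>) F' \<eta> = ip F1 F' \<eta> - ip F2 F' \<eta>" if "\<eta> \<in> Mset" for \<eta>
    using ip_diff_left[OF assms(1-3) that] .
  ultimately show ?thesis by (rule integrable_cong_G)
qed

lemma ip_integrable:
  assumes "FC_span F" "FC_span F'" shows "integrable G (ip F F')"
  using assms(1)
proof induction
  case (base F)
  show ?case using assms(2)
  proof induction
    case (base F') then show ?case using ip_integrable_base \<open>F \<in> FC0\<close> by blast
  next
    case (diff F1 F2)
    then show ?case using ip_integrable_diff[of F1 F2 F] FC_span.base[OF \<open>F \<in> FC0\<close>] by (simp add: ip_commute)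
  qed
next
  case (diff F1 F2)
  then show ?case using assms(2) by (intro ip_integrable_diff)
qed

lemma EB_diff_left:
  assumes "FC_span F1" "FC_span F2" "FC_span F'"
  shows "EB (\<lambda>\<eta>. F1 \<eta> - F2 \<eta>) F' = EB F1 F' - EB F2 F'"
proof -
  have "EB (\<lambda>\<eta>. F1 \<eta> - F2 \<eta>) F' = (\<integral>\<eta>. ip F1 F' \<eta> - ip F2 F' \<eta> \<partial>G)"
    unfolding EB_ip by (rule integral_cong_G) (rule ip_diff_left[OF assms])
  then show ?thesis using ip_integrable assms by (simp add: EB_ip)
qed

lemma EB_commute: "EB F F' = EB F' F" by (simp add: EB_ip ip_commute)

lemma EB_diff_right:
  assumes "FC_span F1" "FC_span F2" "FC_span F'"
  shows "EB F' (\<lambda>\<eta>. F1 \<eta> - F2 \<eta>) = EB F' F1 - EB F' F2"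
  using EB_diff_left[OF assms] by (simp add: EB_commute)

lemma EB_nonneg: "EB F F \<ge> 0"
  unfolding EB_def by (intro Bochner_Integration.integral_nonneg) simp

text \<open>The inner products are taken in spaces that vary with \<open>\<eta>\<close>. Young's
  inequality with a fixed parameter is integrated over \<open>\<eta>\<close> and then over
  \<open>G\<close>, and the parameter is optimised only at the end.\<close>

lemma EB_Cauchy_Schwarz:
  assumes "FC_span F" "FC_span F'"
  shows "EB F F' \<le> sqrt (EB F F) * sqrt (EB F' F')"
proof (rule geometric_mean_bound[OF EB_nonneg EB_nonneg])
  fix t :: real assume t: "t > 0"
  have "(\<integral>\<eta>. 2 * ip F F' \<eta> \<partial>G) \<le> (\<integral>\<eta>. t * ip F F \<eta> + ip F' F' \<eta> / t \<partial>G)"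
  proof (rule integral_mono)
    fix \<eta> assume "\<eta> \<in> space G"
    then have \<eta>: "\<eta> \<in> Mset" by (simp add: space_G)
    have "2 * ip F F' \<eta> = (\<integral>x. 2 * (grad_ext F \<eta> x * grad_ext F' \<eta> x) \<partial>\<eta>)" by (simp add: ip_def)
    also have "\<dots> \<le> (\<integral>x. t * (grad_ext F \<eta> x * grad_ext F \<eta> x) + grad_ext F' \<eta> x * grad_ext F' \<eta> x / t \<partial>\<eta>)"
    proof (rule integral_mono)
      fix x
      let ?p = "grad_ext F \<eta> x" and ?q = "grad_ext F' \<eta> x"
      have "0 \<le> (t * ?p - ?q)\<^sup>2 / t" using t by simp
      also have "\<dots> = t * (?p * ?p) + ?q * ?q / t - 2 * (?p * ?q)" using t by (simp add: power2_eq_square field_simps)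
      finally show "2 * (?p * ?q) \<le> t * (?p * ?p) + ?q * ?q / t" by simp
    qed (use ip_inner_integrable[OF assms \<eta>] ip_inner_integrable[OF assms(1,1) \<eta>] ip_inner_integrable[OF assms(2,2) \<eta>] in auto)
    also have "\<dots> = t * ip F F \<eta> + ip F' F' \<eta> / t"
      using ip_inner_integrable[OF assms(1,1) \<eta>] ip_inner_integrable[OF assms(2,2) \<eta>] by (simp add: ip_def)
    finally show "2 * ip F F' \<eta> \<le> t * ip F F \<eta> + ip F' F' \<eta> / t" .
  qed (use ip_integrable assms in auto)
  then show "2 * EB F F' \<le> t * EB F F + EB F' F' / t"
    using ip_integrable assms by (simp add: EB_ip)
qed

definition enorm :: "('a measure \<Rightarrow> real) \<Rightarrow> real" where "enorm F = sqrt (EB F F)"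

lemma enorm_nonneg: "enorm F \<ge> 0" by (simp add: enorm_def EB_nonneg)

lemma enorm_square: "(enorm F)\<^sup>2 = EB F F" by (simp add: enorm_def EB_nonneg)

lemma EB_diff_diff:
  assumes "FC_span F" "FC_span F'"
  shows "EB (\<lambda>\<eta>. F \<eta> - F' \<eta>) (\<lambda>\<eta>. F \<eta> - F' \<eta>) = EB F F - 2 * EB F F' + EB F' F'"
  using assms FC_span.diff[OF assms] by (simp add: EB_diff_left EB_diff_right EB_commute[of F' F])

lemma enorm_diff_commute:
  assumes "FC_span F" "FC_span F'"
  shows "enorm (\<lambda>\<eta>. F \<eta> - F' \<eta>) = enorm (\<lambda>\<eta>. F' \<eta> - F \<eta>)"
  unfolding enorm_def EB_diff_diff[OF assms] EB_diff_diff[OF assms(2,1)] by (simp add: EB_commute[of F' F])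

text \<open>The span is generated by differences, so the triangle inequality takes this shape; it
  comes from expanding the energy of \<open>F = F' + (F - F')\<close>.\<close>

lemma enorm_triangle_diff:
  assumes "FC_span F" "FC_span F'"
  shows "enorm F \<le> enorm F' + enorm (\<lambda>\<eta>. F \<eta> - F' \<eta>)"
proof (rule power2_le_imp_le)
  let ?D = "\<lambda>\<eta>. F \<eta> - F' \<eta>"
  have D: "FC_span ?D" using assms by (rule FC_span.diff)
  have "EB F F = EB F' F' + 2 * EB F' ?D + EB ?D ?D"
    unfolding EB_diff_diff[OF assms] EB_diff_right[OF assms assms(2)] EB_commute[of F' F] by simp
  also have "\<dots> \<le> EB F' F' + 2 * (enorm F' * enorm ?D) + EB ?D ?D"
    using EB_Cauchy_Schwarz[OF assms(2) D] by (simp add: enorm_def)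
  also have "\<dots> = (enorm F' + enorm ?D)\<^sup>2" unfolding enorm_square[symmetric] by (simp add: power2_eq_square algebra_simps)
  finally show "(enorm F)\<^sup>2 \<le> (enorm F' + enorm ?D)\<^sup>2" by (simp add: enorm_square)
qed (simp add: enorm_nonneg)

lemma enorm_abs_diff:
  assumes "FC_span F" "FC_span F'"
  shows "\<bar>enorm F - enorm F'\<bar> \<le> enorm (\<lambda>\<eta>. F \<eta> - F' \<eta>)"
  using enorm_triangle_diff[OF assms] enorm_triangle_diff[OF assms(2,1)] enorm_diff_commute[OF assms] by linarith

lemma enorm_diff_le:
  assumes "FC_span F" "FC_span F'"
  shows "enorm (\<lambda>\<eta>. F \<eta> - F' \<eta>) \<le> enorm F + enorm F'"
proof -
  have D: "FC_span (\<lambda>\<eta>. F \<eta> - F' \<eta>)" using assms by (rule FC_span.diff)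
  have "enorm (\<lambda>\<eta>. F \<eta> - F' \<eta>) \<le> enorm F + enorm (\<lambda>\<eta>. F \<eta> - F' \<eta> - F \<eta>)"
    by (rule enorm_triangle_diff[OF D assms(1)])
  also have "enorm (\<lambda>\<eta>. F \<eta> - F' \<eta> - F \<eta>) = enorm F'"
  proof -
    have "EB (\<lambda>\<eta>. F \<eta> - F' \<eta> - F \<eta>) (\<lambda>\<eta>. F \<eta> - F' \<eta> - F \<eta>) = EB F' F'"
      unfolding EB_diff_diff[OF D assms(1)] EB_diff_diff[OF assms] EB_diff_left[OF assms assms(1)] EB_commute[of F' F]
      by simp
    then show ?thesis by (simp add: enorm_def)
  qed
  finally show ?thesis .
qed

text \<open>\<open>L\<close> plays the role of the generator applied to \<open>F\<close>. Its square
  integrability is the point: it makes \<open>F' \<mapsto> EB F F'\<close> continuous with respect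
  to convergence in the space of square integrable functions.\<close>

lemma FC_span_ibp:
  fixes F :: "'a measure \<Rightarrow> real"
  assumes "FC_span F"
  shows "\<exists>L. L \<in> borel_measurable G \<and> integrable G (\<lambda>\<eta>. (L \<eta>)\<^sup>2) \<and>
    (\<forall>F'. FC_span F' \<longrightarrow> EB F F' = - (\<integral>\<eta>. F' \<eta> * L \<eta> \<partial>G))"
  using assms
proof induction
  case (base F)
  then show ?case
  proof (rule FC0_smooth_cyl)
    fix n g d dd K and A :: "nat \<Rightarrow> 'a set"
    assume g: "smooth_cyl n g d dd K" and A: "\<And>i. i < n \<Longrightarrow> A i \<in> sets borel"
      "disjoint_family_on A {..<n}" "(\<Union>i<n. A i) = UNIV"
      and F: "\<And>\<eta>. \<eta> \<in> Mset \<Longrightarrow> F \<eta> = g (cvec n A \<eta>)"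
    let ?L = "cyl_gen n A d dd"
    have m: "?L \<in> borel_measurable G"
      unfolding cyl_gen_def[abs_def]
      using A measurable_comp_cvec[of n A, OF A(1)] smooth_cylD(4,5)[OF g]
      by (intro borel_measurable_sum borel_measurable_add borel_measurable_times borel_measurable_diff
          measurable_measure borel_measurable_const) auto
    have b: "\<bar>?L \<eta>\<bar> \<le> (\<Sum>i<n. K + (measure \<nu> (A i) * K + K))" for \<eta>
      unfolding cyl_gen_def
    proof (rule order_trans[OF sum_abs sum_mono])
      fix i assume "i \<in> {..<n}"
      then have i: "i < n" by simp
      let ?y = "cvec n A \<eta>"
      have "\<bar>measure \<nu> (A i) * d i ?y\<bar> \<le> measure \<nu> (A i) * K"
        unfolding abs_mult using smooth_cylD(8)[OF g i, of ?y] by (intro mult_mono) auto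
      moreover have "?y i = measure \<eta> (A i)" using i by (simp add: cvec_def)
      ultimately show "\<bar>measure \<eta> (A i) * dd i ?y + (measure \<nu> (A i) - measure \<eta> (A i)) * d i ?y\<bar> \<le> K + (measure \<nu> (A i) * K + K)"
        using smooth_cylD(10,11)[OF g i, of ?y] by (simp add: left_diff_distrib)
    qed
    have I2: "integrable G (\<lambda>\<eta>. (?L \<eta>)\<^sup>2)"
    proof (rule integrable_bounded_G)
      show "\<bar>(?L \<eta>)\<^sup>2\<bar> \<le> (\<Sum>i<n. K + (measure \<nu> (A i) * K + K))\<^sup>2" for \<eta>
        using power_mono[OF b[of \<eta>], of 2] by simp
    qed (use m in simp)
    have "EB F F' = - (\<integral>\<eta>. F' \<eta> * ?L \<eta> \<partial>G)" if "FC_span F'" for F'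
      using that
    proof induction
      case (base F')
      then show ?case
      proof (rule FC0_smooth_cyl)
        fix m h e ee L and B :: "nat \<Rightarrow> 'a set"
        assume h: "smooth_cyl m h e ee L" and B: "\<And>i. i < m \<Longrightarrow> B i \<in> sets borel"
          "disjoint_family_on B {..<m}" "(\<Union>i<m. B i) = UNIV"
          and F': "\<And>\<eta>. \<eta> \<in> Mset \<Longrightarrow> F' \<eta> = h (cvec m B \<eta>)"
        show ?thesis by (rule ibp_cyl[OF g A F h B F'])
      qed
    next
      case (diff F1 F2)
      have "integrable G (\<lambda>\<eta>. F1 \<eta> * ?L \<eta>)" "integrable G (\<lambda>\<eta>. F2 \<eta> * ?L \<eta>)"
        using integral_Cauchy_Schwarz(1)[OF FC_span_measurable m FC_span_integrable(2) I2] diff by auto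
      then show ?case using diff EB_diff_right[OF diff.hyps FC_span.base[OF \<open>F \<in> FC0\<close>]]
        by (simp add: left_diff_distrib)
    qed
    then show ?thesis using m I2 by blast
  qed
next
  case (diff F1 F2)
  then obtain L1 L2 where L [measurable]: "L1 \<in> borel_measurable G" "L2 \<in> borel_measurable G"
    and I: "integrable G (\<lambda>\<eta>. (L1 \<eta>)\<^sup>2)" "integrable G (\<lambda>\<eta>. (L2 \<eta>)\<^sup>2)"
    and E: "\<And>F'. FC_span F' \<Longrightarrow> EB F1 F' = - (\<integral>\<eta>. F' \<eta> * L1 \<eta> \<partial>G)" "\<And>F'. FC_span F' \<Longrightarrow> EB F2 F' = - (\<integral>\<eta>. F' \<eta> * L2 \<eta> \<partial>G)"
    by blast
  show ?case
  proof (intro exI[of _ "\<lambda>\<eta>. L1 \<eta> - L2 \<eta>"] conjI allI impI)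
    have "(\<lambda>\<eta>. (L1 \<eta> - L2 \<eta>)\<^sup>2) = (\<lambda>\<eta>. (L1 \<eta>)\<^sup>2 + (L2 \<eta>)\<^sup>2 - 2 * (L1 \<eta> * L2 \<eta>))"
      by (auto simp: power2_eq_square algebra_simps)
    then show "integrable G (\<lambda>\<eta>. (L1 \<eta> - L2 \<eta>)\<^sup>2)"
      using I integral_Cauchy_Schwarz(1)[OF L I] by simp
    fix F' :: "'a measure \<Rightarrow> real" assume F': "FC_span F'"
    have "integrable G (\<lambda>\<eta>. F' \<eta> * L1 \<eta>)" "integrable G (\<lambda>\<eta>. F' \<eta> * L2 \<eta>)"
      using integral_Cauchy_Schwarz(1)[OF FC_span_measurable[OF F'] L(1) FC_span_integrable(2)[OF F'] I(1)]
        integral_Cauchy_Schwarz(1)[OF FC_span_measurable[OF F'] L(2) FC_span_integrable(2)[OF F'] I(2)] by auto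
    then show "EB (\<lambda>\<eta>. F1 \<eta> - F2 \<eta>) F' = - (\<integral>\<eta>. F' \<eta> * (L1 \<eta> - L2 \<eta>) \<partial>G)"
      using E[OF F'] EB_diff_left[OF diff.hyps F'] by (simp add: right_diff_distrib)
  qed measurable
qed

text \<open>For fixed \<open>n\<close>, integration by parts shows that
  \<open>EB (H n) (H m)\<close> tends to 0 as \<open>m\<close> grows, although no convergence of the
  energies is known yet. The Cauchy property transfers this to
  \<open>EB (H n) (H n)\<close>.\<close>

lemma closable:
  assumes H: "\<And>n. FC_span (H n)" and lim: "(\<lambda>n. \<integral>\<eta>. (H n \<eta>)\<^sup>2 \<partial>G) \<longlonglongrightarrow> 0"
    and Cauchy: "\<And>e. e > 0 \<Longrightarrow> \<exists>N. \<forall>m\<ge>N. \<forall>n\<ge>N. enorm (\<lambda>\<eta>. H n \<eta> - H m \<eta>) < e"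
  shows "(\<lambda>n. enorm (H n)) \<longlonglongrightarrow> 0"
proof (rule LIMSEQ_I)
  fix e :: real assume e: "e > 0"
  obtain N where N: "\<And>m n. m \<ge> N \<Longrightarrow> n \<ge> N \<Longrightarrow> enorm (\<lambda>\<eta>. H n \<eta> - H m \<eta>) < e / 2"
    using Cauchy[of "e / 2"] e by auto
  have "enorm (H n) < e" if n: "n \<ge> N" for n
  proof -
    obtain L where L: "L \<in> borel_measurable G" "integrable G (\<lambda>\<eta>. (L \<eta>)\<^sup>2)"
      "\<And>F'. FC_span F' \<Longrightarrow> EB (H n) F' = - (\<integral>\<eta>. F' \<eta> * L \<eta> \<partial>G)"
      using FC_span_ibp[OF H] by blast
    have "\<bar>EB (H n) (H m)\<bar> \<le> sqrt (\<integral>\<eta>. (H m \<eta>)\<^sup>2 \<partial>G) * sqrt (\<integral>\<eta>. (L \<eta>)\<^sup>2 \<partial>G)" for m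
      using integral_Cauchy_Schwarz(2)[OF FC_span_measurable[OF H] L(1) FC_span_integrable(2)[OF H] L(2)]
      by (simp add: L(3)[OF H])
    moreover have "(\<lambda>m. sqrt (\<integral>\<eta>. (H m \<eta>)\<^sup>2 \<partial>G) * sqrt (\<integral>\<eta>. (L \<eta>)\<^sup>2 \<partial>G)) \<longlonglongrightarrow> sqrt 0 * sqrt (\<integral>\<eta>. (L \<eta>)\<^sup>2 \<partial>G)"
      by (intro tendsto_intros lim)
    ultimately have lim0: "(\<lambda>m. EB (H n) (H m)) \<longlonglongrightarrow> 0"
      by (intro Lim_null_comparison[of "\<lambda>m. EB (H n) (H m)"]) auto
    \<comment> \<open>Expand the energy of \<open>H n - H m\<close> and drop the nonnegative term
      \<open>EB (H m) (H m)\<close>.\<close>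
    have "EB (H n) (H n) \<le> (e / 2)\<^sup>2 + 2 * EB (H n) (H m)" if m: "m \<ge> N" for m
    proof -
      have "EB (\<lambda>\<eta>. H n \<eta> - H m \<eta>) (\<lambda>\<eta>. H n \<eta> - H m \<eta>) \<le> (e / 2)\<^sup>2"
        using N[OF m n] enorm_nonneg by (metis enorm_square less_imp_le power_mono)
      then show ?thesis unfolding EB_diff_diff[OF H H] using EB_nonneg[of "H m"] by linarith
    qed
    then have "EB (H n) (H n) \<le> (e / 2)\<^sup>2 + 2 * 0"
      by (intro LIMSEQ_le_const[of "\<lambda>m. (e / 2)\<^sup>2 + 2 * EB (H n) (H m)"] tendsto_intros lim0) auto
    then have "(enorm (H n))\<^sup>2 \<le> (e / 2)\<^sup>2" by (simp add: enorm_square)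
    then have "enorm (H n) \<le> e / 2" by (rule power2_le_imp_le) (use e in simp)
    then show ?thesis using e by simp
  qed
  then show "\<exists>N. \<forall>n\<ge>N. norm (enorm (H n) - 0) < e" using enorm_nonneg by auto
qed

text \<open>The definition bounds squared energy distances; passing to the seminorm makes the
  triangle inequality applicable.\<close>

lemma approx_seq_iff:
  "approx_seq G F Fn \<longleftrightarrow> (\<forall>n. Fn n \<in> FC0) \<and> (\<lambda>n. \<integral>\<eta>. (Fn n \<eta> - F \<eta>)\<^sup>2 \<partial>G) \<longlonglongrightarrow> 0 \<and>
     (\<forall>e>0. \<exists>N. \<forall>m\<ge>N. \<forall>n\<ge>N. enorm (\<lambda>\<eta>. Fn n \<eta> - Fn m \<eta>) < e)"
proof -
  have 1: "enorm F < e \<longleftrightarrow> Eform G F < e\<^sup>2" if "e > 0" for F e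
    unfolding Eform_EB enorm_square[symmetric]
    using that power_strict_mono[OF _ enorm_nonneg, of F e 2] power2_less_imp_less[of "enorm F" e] by auto
  have "(\<forall>e>0. \<exists>N. \<forall>m\<ge>N. \<forall>n\<ge>N. Eform G (\<lambda>\<eta>. Fn n \<eta> - Fn m \<eta>) < e) \<longleftrightarrow>
      (\<forall>e>0. \<exists>N. \<forall>m\<ge>N. \<forall>n\<ge>N. enorm (\<lambda>\<eta>. Fn n \<eta> - Fn m \<eta>) < e)" (is "?A \<longleftrightarrow> ?B")
  proof
    assume ?A
    show ?B
    proof (intro allI impI)
      fix e :: real assume e: "e > 0"
      then have "e\<^sup>2 > 0" by simp
      then show "\<exists>N. \<forall>m\<ge>N. \<forall>n\<ge>N. enorm (\<lambda>\<eta>. Fn n \<eta> - Fn m \<eta>) < e"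
        using \<open>?A\<close> unfolding 1[OF e] by blast
    qed
  next
    assume ?B
    show ?A
    proof (intro allI impI)
      fix e :: real assume e: "e > 0"
      then have "sqrt e > 0" "(sqrt e)\<^sup>2 = e" by auto
      then show "\<exists>N. \<forall>m\<ge>N. \<forall>n\<ge>N. Eform G (\<lambda>\<eta>. Fn n \<eta> - Fn m \<eta>) < e"
        using \<open>?B\<close> 1[of "sqrt e"] by metis
    qed
  qed
  then show ?thesis unfolding approx_seq_def by blast
qed

lemma square_diff_integrable:
  fixes F H :: "'a measure \<Rightarrow> real"
  assumes "F \<in> borel_measurable G" "integrable G (\<lambda>\<eta>. (F \<eta>)\<^sup>2)" "H \<in> borel_measurable G" "integrable G (\<lambda>\<eta>. (H \<eta>)\<^sup>2)"
  shows "integrable G (\<lambda>\<eta>. (F \<eta> - H \<eta>)\<^sup>2)"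
proof -
  have "(\<lambda>\<eta>. (F \<eta> - H \<eta>)\<^sup>2) = (\<lambda>\<eta>. (F \<eta>)\<^sup>2 + (H \<eta>)\<^sup>2 - 2 * (F \<eta> * H \<eta>))"
    by (auto simp: power2_eq_square algebra_simps)
  then show ?thesis using integral_Cauchy_Schwarz(1)[OF assms(1,3,2,4)] assms by simp
qed

text \<open>Two approximating sequences of the same function differ by a sequence that tends to 0 in
  mean square and is Cauchy in energy, so closability equates the limits of their energies. This
  gives the number described by \<open>Ebar\<close> both existence and uniqueness.\<close>

lemma approx_seq_limit:
  assumes F: "F \<in> borel_measurable G" "integrable G (\<lambda>\<eta>. (F \<eta>)\<^sup>2)" and Fn: "approx_seq G F Fn"
  shows "(\<lambda>n. Eform G (Fn n)) \<longlonglongrightarrow> Ebar G F"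
proof -
  have sp: "FC_span (Hn n)" if "approx_seq G F Hn" for Hn n
    using that by (auto simp: approx_seq_def intro: FC_span.base)
  have ca: "\<exists>N. \<forall>m\<ge>N. \<forall>n\<ge>N. enorm (\<lambda>\<eta>. Hn n \<eta> - Hn m \<eta>) < e" if "approx_seq G F Hn" "e > 0" for Hn e
    using that unfolding approx_seq_iff by blast
  have "Cauchy (\<lambda>n. enorm (Fn n))"
  proof (rule CauchyI)
    fix e :: real assume "e > 0"
    then obtain N where "\<forall>m\<ge>N. \<forall>n\<ge>N. enorm (\<lambda>\<eta>. Fn n \<eta> - Fn m \<eta>) < e" using ca[OF Fn] by blast
    then show "\<exists>M. \<forall>m\<ge>M. \<forall>n\<ge>M. norm (enorm (Fn m) - enorm (Fn n)) < e"
      using enorm_abs_diff[OF sp[OF Fn] sp[OF Fn]] by (metis le_less_trans real_norm_def)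
  qed
  then obtain a where a: "(\<lambda>n. enorm (Fn n)) \<longlonglongrightarrow> a" using Cauchy_convergent convergent_def by blast
  have lim: "(\<lambda>n. Eform G (Hn n)) \<longlonglongrightarrow> a\<^sup>2" if Hn: "approx_seq G F Hn" for Hn
  proof -
    define D where "D n \<eta> = Hn n \<eta> - Fn n \<eta>" for n \<eta>
    have Ds: "FC_span (D n)" for n unfolding D_def by (intro FC_span.diff sp Hn Fn)
    have "(\<lambda>n. enorm (D n)) \<longlonglongrightarrow> 0"
    proof (rule closable[OF Ds])
      have L: "(\<lambda>n. 2 * (\<integral>\<eta>. (Hn n \<eta> - F \<eta>)\<^sup>2 \<partial>G) + 2 * (\<integral>\<eta>. (Fn n \<eta> - F \<eta>)\<^sup>2 \<partial>G)) \<longlonglongrightarrow> 2 * 0 + 2 * 0"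
        using Hn Fn unfolding approx_seq_def by (intro tendsto_intros) auto
      have I: "integrable G (\<lambda>\<eta>. (Hn n \<eta> - F \<eta>)\<^sup>2)" if "approx_seq G F Hn" for Hn n
        by (rule square_diff_integrable[OF FC_span_measurable[OF sp[OF that]] FC_span_integrable(2)[OF sp[OF that]] F])
      have "(\<integral>\<eta>. (D n \<eta>)\<^sup>2 \<partial>G) \<le> 2 * (\<integral>\<eta>. (Hn n \<eta> - F \<eta>)\<^sup>2 \<partial>G) + 2 * (\<integral>\<eta>. (Fn n \<eta> - F \<eta>)\<^sup>2 \<partial>G)" for n
      proof -
        have "(\<integral>\<eta>. (D n \<eta>)\<^sup>2 \<partial>G) \<le> (\<integral>\<eta>. 2 * (Hn n \<eta> - F \<eta>)\<^sup>2 + 2 * (Fn n \<eta> - F \<eta>)\<^sup>2 \<partial>G)"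
        proof (rule integral_mono)
          fix \<eta>
          have "0 \<le> ((Hn n \<eta> - F \<eta>) + (Fn n \<eta> - F \<eta>))\<^sup>2" by simp
          then show "(D n \<eta>)\<^sup>2 \<le> 2 * (Hn n \<eta> - F \<eta>)\<^sup>2 + 2 * (Fn n \<eta> - F \<eta>)\<^sup>2"
            by (simp add: D_def power2_eq_square algebra_simps)
        qed (use FC_span_integrable(2)[OF Ds] I[OF Hn] I[OF Fn] in auto)
        then show ?thesis using I[OF Hn] I[OF Fn] by simp
      qed
      then show "(\<lambda>n. \<integral>\<eta>. (D n \<eta>)\<^sup>2 \<partial>G) \<longlonglongrightarrow> 0"
        using L by (intro Lim_null_comparison[of "\<lambda>n. \<integral>\<eta>. (D n \<eta>)\<^sup>2 \<partial>G"]) auto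
      fix e :: real assume e: "e > 0"
      have e2: "e / 2 > 0" using e by simp
      obtain N where N: "\<forall>m\<ge>N. \<forall>n\<ge>N. enorm (\<lambda>\<eta>. Hn n \<eta> - Hn m \<eta>) < e / 2"
        using ca[OF Hn e2] by (elim exE)
      obtain M where M: "\<forall>m\<ge>M. \<forall>n\<ge>M. enorm (\<lambda>\<eta>. Fn n \<eta> - Fn m \<eta>) < e / 2"
        using ca[OF Fn e2] by (elim exE)
      have "enorm (\<lambda>\<eta>. D n \<eta> - D m \<eta>) < e" if "m \<ge> max N M" "n \<ge> max N M" for m n
      proof -
        have "(\<lambda>\<eta>. D n \<eta> - D m \<eta>) = (\<lambda>\<eta>. (Hn n \<eta> - Hn m \<eta>) - (Fn n \<eta> - Fn m \<eta>))"
          by (auto simp: D_def)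
        then have "enorm (\<lambda>\<eta>. D n \<eta> - D m \<eta>) \<le> enorm (\<lambda>\<eta>. Hn n \<eta> - Hn m \<eta>) + enorm (\<lambda>\<eta>. Fn n \<eta> - Fn m \<eta>)"
          using enorm_diff_le[OF FC_span.diff[OF sp[OF Hn] sp[OF Hn]] FC_span.diff[OF sp[OF Fn] sp[OF Fn]]] by simp
        moreover have "enorm (\<lambda>\<eta>. Hn n \<eta> - Hn m \<eta>) < e / 2" "enorm (\<lambda>\<eta>. Fn n \<eta> - Fn m \<eta>) < e / 2"
          using N M that by simp_all
        ultimately show ?thesis by linarith
      qed
      then show "\<exists>N. \<forall>m\<ge>N. \<forall>n\<ge>N. enorm (\<lambda>\<eta>. D n \<eta> - D m \<eta>) < e" by blast
    qed
    then have "(\<lambda>n. enorm (Hn n) - enorm (Fn n)) \<longlonglongrightarrow> 0"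
      by (rule Lim_null_comparison[rotated])
        (rule always_eventually, use enorm_abs_diff[OF sp[OF Hn] sp[OF Fn]] in \<open>simp add: D_def[abs_def]\<close>)
    from tendsto_add[OF this a] have "(\<lambda>n. enorm (Hn n)) \<longlonglongrightarrow> a" by simp
    then have "(\<lambda>n. (enorm (Hn n))\<^sup>2) \<longlonglongrightarrow> a\<^sup>2" by (rule tendsto_power)
    then show ?thesis by (simp add: enorm_square Eform_EB)
  qed
  have "Ebar G F = a\<^sup>2"
    unfolding Ebar_def using lim LIMSEQ_unique[OF lim[OF Fn]] Fn by (intro the_equality) blast+
  then show ?thesis using lim[OF Fn] by simp
qed

text \<open>Mean square convergence passes to pairings with a fixed square integrable function.
  Testing with 1 gives the means, testing with \<open>F\<close> the second moments.\<close>

lemma approx_seq_moments: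
  assumes F: "F \<in> borel_measurable G" "integrable G (\<lambda>\<eta>. (F \<eta>)\<^sup>2)" and Fn: "approx_seq G F Fn"
  shows "(\<lambda>n. \<integral>\<eta>. (Fn n \<eta>)\<^sup>2 \<partial>G) \<longlonglongrightarrow> (\<integral>\<eta>. (F \<eta>)\<^sup>2 \<partial>G)"
    "(\<lambda>n. \<integral>\<eta>. Fn n \<eta> \<partial>G) \<longlonglongrightarrow> (\<integral>\<eta>. F \<eta> \<partial>G)" "integrable G F"
proof -
  have sp: "FC_span (Fn n)" for n using Fn by (auto simp: approx_seq_def intro: FC_span.base)
  note [measurable] = F(1) FC_span_measurable[OF sp]
  have lim: "(\<lambda>n. \<integral>\<eta>. (Fn n \<eta> - F \<eta>)\<^sup>2 \<partial>G) \<longlonglongrightarrow> 0" using Fn by (simp add: approx_seq_def)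
  have I: "integrable G (\<lambda>\<eta>. (Fn n \<eta> - F \<eta>)\<^sup>2)" for n
    by (rule square_diff_integrable[OF FC_span_measurable[OF sp] FC_span_integrable(2)[OF sp] F])
  have one: "integrable G (\<lambda>\<eta>. (1::real)\<^sup>2)" by simp
  show IF: "integrable G F" using integral_Cauchy_Schwarz(1)[OF F(1) borel_measurable_const F(2) one] by simp
  have conv: "(\<lambda>n. \<integral>\<eta>. (Fn n \<eta> - F \<eta>) * H \<eta> \<partial>G) \<longlonglongrightarrow> 0"
    if [measurable]: "H \<in> borel_measurable G" and H: "integrable G (\<lambda>\<eta>. (H \<eta>)\<^sup>2)" for H
  proof -
    have "\<bar>\<integral>\<eta>. (Fn n \<eta> - F \<eta>) * H \<eta> \<partial>G\<bar> \<le> sqrt (\<integral>\<eta>. (Fn n \<eta> - F \<eta>)\<^sup>2 \<partial>G) * sqrt (\<integral>\<eta>. (H \<eta>)\<^sup>2 \<partial>G)" for n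
      by (rule integral_Cauchy_Schwarz(2)[OF _ _ I H]) measurable
    moreover have "(\<lambda>n. sqrt (\<integral>\<eta>. (Fn n \<eta> - F \<eta>)\<^sup>2 \<partial>G) * sqrt (\<integral>\<eta>. (H \<eta>)\<^sup>2 \<partial>G)) \<longlonglongrightarrow> sqrt 0 * sqrt (\<integral>\<eta>. (H \<eta>)\<^sup>2 \<partial>G)"
      by (intro tendsto_intros lim)
    ultimately show ?thesis
      by (intro Lim_null_comparison[of "\<lambda>n. \<integral>\<eta>. (Fn n \<eta> - F \<eta>) * H \<eta> \<partial>G"]) auto
  qed
  have "(\<lambda>n. \<integral>\<eta>. Fn n \<eta> - F \<eta> \<partial>G) \<longlonglongrightarrow> 0" using conv[OF _ one] by simp
  then have "(\<lambda>n. (\<integral>\<eta>. Fn n \<eta> \<partial>G) - (\<integral>\<eta>. F \<eta> \<partial>G)) \<longlonglongrightarrow> 0" using IF FC_span_integrable(1)[OF sp] by simp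
  then show "(\<lambda>n. \<integral>\<eta>. Fn n \<eta> \<partial>G) \<longlonglongrightarrow> (\<integral>\<eta>. F \<eta> \<partial>G)" by (simp add: LIM_zero_iff)
  have "(\<integral>\<eta>. (Fn n \<eta>)\<^sup>2 \<partial>G) = (\<integral>\<eta>. (Fn n \<eta> - F \<eta>)\<^sup>2 \<partial>G) + 2 * (\<integral>\<eta>. (Fn n \<eta> - F \<eta>) * F \<eta> \<partial>G) + (\<integral>\<eta>. (F \<eta>)\<^sup>2 \<partial>G)" for n
  proof -
    have J: "integrable G (\<lambda>\<eta>. (Fn n \<eta> - F \<eta>) * F \<eta>)"
      by (rule integral_Cauchy_Schwarz(1)[OF _ _ I F(2)]) measurable
    have "(\<integral>\<eta>. (Fn n \<eta>)\<^sup>2 \<partial>G) = (\<integral>\<eta>. (Fn n \<eta> - F \<eta>)\<^sup>2 + 2 * ((Fn n \<eta> - F \<eta>) * F \<eta>) + (F \<eta>)\<^sup>2 \<partial>G)"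
      by (intro Bochner_Integration.integral_cong) (auto simp: power2_eq_square algebra_simps)
    then show ?thesis using I J F by simp
  qed
  moreover have "(\<lambda>n. (\<integral>\<eta>. (Fn n \<eta> - F \<eta>)\<^sup>2 \<partial>G) + 2 * (\<integral>\<eta>. (Fn n \<eta> - F \<eta>) * F \<eta> \<partial>G) + (\<integral>\<eta>. (F \<eta>)\<^sup>2 \<partial>G)) \<longlonglongrightarrow> 0 + 2 * 0 + (\<integral>\<eta>. (F \<eta>)\<^sup>2 \<partial>G)"
    by (intro tendsto_intros lim conv F)
  ultimately show "(\<lambda>n. \<integral>\<eta>. (Fn n \<eta>)\<^sup>2 \<partial>G) \<longlonglongrightarrow> (\<integral>\<eta>. (F \<eta>)\<^sup>2 \<partial>G)" by simp
qed

lemma Ebar_nonneg: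
  assumes "F \<in> dom_closure G" shows "Ebar G F \<ge> 0"
proof -
  obtain Fn where "approx_seq G F Fn" using assms by (auto simp: dom_closure_def)
  then have "(\<lambda>n. Eform G (Fn n)) \<longlonglongrightarrow> Ebar G F" using assms by (intro approx_seq_limit) (auto simp: dom_closure_def)
  then show ?thesis by (rule LIMSEQ_le_const) (auto simp: Eform_EB EB_nonneg)
qed

lemma poincare_dom:
  assumes "F \<in> dom_closure G"
  shows "(\<integral>\<eta>. (F \<eta>)\<^sup>2 \<partial>G) \<le> Ebar G F + (\<integral>\<eta>. F \<eta> \<partial>G)\<^sup>2"
proof -
  have F: "F \<in> borel_measurable G" "integrable G (\<lambda>\<eta>. (F \<eta>)\<^sup>2)" using assms by (auto simp: dom_closure_def)
  obtain Fn where Fn: "approx_seq G F Fn" using assms by (auto simp: dom_closure_def)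
  have "(\<lambda>n. Eform G (Fn n) + (\<integral>\<eta>. Fn n \<eta> \<partial>G)\<^sup>2) \<longlonglongrightarrow> Ebar G F + (\<integral>\<eta>. F \<eta> \<partial>G)\<^sup>2"
    by (intro tendsto_intros approx_seq_limit[OF F Fn] approx_seq_moments[OF F Fn])
  moreover have "(\<integral>\<eta>. (Fn n \<eta>)\<^sup>2 \<partial>G) \<le> Eform G (Fn n) + (\<integral>\<eta>. Fn n \<eta> \<partial>G)\<^sup>2" for n
    using poincare_FC0[of "Fn n"] Fn by (simp add: approx_seq_def)
  ultimately show ?thesis by (intro LIMSEQ_le[OF approx_seq_moments(1)[OF F Fn]]) auto
qed

text \<open>At \<open>x = 0\<close> the value \<open>0 * ln 0 = 0\<close> agrees with the limit of
  \<open>xlnx\<close> from the right.\<close>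

lemma tendsto_xlnx:
  assumes "X \<longlonglongrightarrow> x" "\<And>n. X n > 0"
  shows "(\<lambda>n. xlnx (X n)) \<longlonglongrightarrow> xlnx x"
proof (cases "x = 0")
  case True
  have lim: "((\<lambda>x::real. xlnx x) \<longlongrightarrow> 0) (at_right 0)" by real_asymp
  have "filterlim X (at_right 0) sequentially"
  proof -
    have "X n \<noteq> 0" for n using assms(2)[of n] by simp
    then show ?thesis using assms True by (auto simp: filterlim_at intro: always_eventually)
  qed
  from filterlim_compose[OF lim this] show ?thesis using True by simp
next
  case False
  then show ?thesis using assms by (intro tendsto_intros) auto
qed

text \<open>This makes \<open>xlnx x + 1\<close> nonnegative, as Fatou's lemma requires.\<close>

lemma xlnx_ge: "xlnx x \<ge> -1" if "x \<ge> 0" for x :: real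
proof (cases "x = 0")
  case False
  then have "ln (1 / x) \<le> 1 / x - 1" using that by (intro ln_le_minus_one) auto
  then have "x * (1 - 1 / x) \<le> xlnx x" using that False by (intro mult_left_mono) (auto simp: ln_div)
  then show ?thesis using that False by (simp add: algebra_simps)
qed simp

text \<open>Entropy is only lower semicontinuous here: along a subsequence converging almost
  everywhere, Fatou's lemma is applied to the nonnegative functions
  \<open>xlnx (X n \<eta>) + 1\<close>. The regularisation by \<open>\<epsilon> n\<close>, forced by
  the zeros of the approximants, disappears in the same limit.\<close>

lemma lsi_dom:
  assumes FD: "F \<in> dom_closure G" and one: "(\<integral>\<eta>. (F \<eta>)\<^sup>2 \<partial>G) = 1" and C: "C > 0"
    and CA: "\<And>A. A \<in> sets borel \<Longrightarrow> measure \<nu> A = 0 \<or> 8 / min 1 (measure \<nu> A) \<le> C"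
  shows "integrable G (\<lambda>\<eta>. xlnx ((F \<eta>)\<^sup>2))" "(\<integral>\<eta>. xlnx ((F \<eta>)\<^sup>2) \<partial>G) \<le> 4 * C * Ebar G F"
proof -
  have F: "F \<in> borel_measurable G" "integrable G (\<lambda>\<eta>. (F \<eta>)\<^sup>2)" using FD by (auto simp: dom_closure_def)
  obtain Fn where Fn: "approx_seq G F Fn" using FD by (auto simp: dom_closure_def)
  have FC: "Fn n \<in> FC0" for n using Fn by (simp add: approx_seq_def)
  have sp: "FC_span (Fn n)" for n using FC by (rule FC_span.base)
  note [measurable] = F(1) FC_span_measurable[OF sp]
  have I: "integrable G (\<lambda>\<eta>. (Fn n \<eta> - F \<eta>)\<^sup>2)" for n
    by (rule square_diff_integrable[OF FC_span_measurable[OF sp] FC_span_integrable(2)[OF sp] F])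
  have "\<exists>r. strict_mono r \<and> (AE \<eta> in G. (\<lambda>n. (Fn (r n) \<eta> - F \<eta>)\<^sup>2) \<longlonglongrightarrow> 0)"
    using Fn by (intro tendsto_L1_AE_subseq I) (simp add: approx_seq_def)
  then obtain r where r: "strict_mono r" "AE \<eta> in G. (\<lambda>n. (Fn (r n) \<eta> - F \<eta>)\<^sup>2) \<longlonglongrightarrow> 0" by blast
  define \<epsilon> where "\<epsilon> n = 1 / (real n + 1)" for n
  have \<epsilon>: "\<epsilon> n > 0" for n by (simp add: \<epsilon>_def)
  have \<epsilon>0: "\<epsilon> \<longlonglongrightarrow> 0" unfolding \<epsilon>_def by real_asymp
  define X where "X n \<eta> = (Fn (r n) \<eta>)\<^sup>2 + \<epsilon> n" for n \<eta>
  have Xpos: "X n \<eta> > 0" for n \<eta> unfolding X_def using \<epsilon>[of n] by (simp add: add_nonneg_pos)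
  have [measurable]: "X n \<in> borel_measurable G" for n unfolding X_def by measurable
  have IlX: "integrable G (\<lambda>\<eta>. xlnx (X n \<eta>))" for n
  proof -
    obtain K where K: "\<And>\<eta>. \<eta> \<in> Mset \<Longrightarrow> \<bar>Fn (r n) \<eta>\<bar> \<le> K" using FC_span_bounded[OF sp] by blast
    show ?thesis
    proof (rule integrable_bounded_G)
      fix \<eta> :: "'a measure" assume "\<eta> \<in> Mset"
      have "X n \<eta> \<le> K\<^sup>2 + \<epsilon> n" using power_mono[OF K[OF \<open>\<eta> \<in> Mset\<close>], of 2] by (simp add: X_def)
      moreover have "\<epsilon> n \<le> X n \<eta>" by (simp add: X_def)
      ultimately show "\<bar>xlnx (X n \<eta>)\<bar> \<le> (K\<^sup>2 + \<epsilon> n) * (\<bar>ln (\<epsilon> n)\<bar> + \<bar>ln (K\<^sup>2 + \<epsilon> n)\<bar>)"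
        using \<epsilon> by (intro abs_xlnx_le)
    qed measurable
  qed
  have AEX: "AE \<eta> in G. (\<lambda>n. xlnx (X n \<eta>)) \<longlonglongrightarrow> xlnx ((F \<eta>)\<^sup>2)"
    using r(2)
  proof eventually_elim
    fix \<eta> assume "(\<lambda>n. (Fn (r n) \<eta> - F \<eta>)\<^sup>2) \<longlonglongrightarrow> 0"
    then have "(\<lambda>n. sqrt ((Fn (r n) \<eta> - F \<eta>)\<^sup>2)) \<longlonglongrightarrow> sqrt 0" by (rule tendsto_real_sqrt)
    then have "(\<lambda>n. Fn (r n) \<eta> - F \<eta>) \<longlonglongrightarrow> 0" by (simp add: tendsto_rabs_zero_iff)
    then have "(\<lambda>n. Fn (r n) \<eta>) \<longlonglongrightarrow> F \<eta>" by (simp add: LIM_zero_iff)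
    then have "(\<lambda>n. X n \<eta>) \<longlonglongrightarrow> (F \<eta>)\<^sup>2 + 0" unfolding X_def by (intro tendsto_intros \<epsilon>0)
    then show "(\<lambda>n. xlnx (X n \<eta>)) \<longlonglongrightarrow> xlnx ((F \<eta>)\<^sup>2)" using Xpos by (intro tendsto_xlnx) auto
  qed
  define b where "b n = 4 * C * Eform G (Fn (r n)) + xlnx (\<integral>\<eta>. X n \<eta> \<partial>G) + 1" for n
  have le: "(\<integral>\<eta>. xlnx (X n \<eta>) + 1 \<partial>G) \<le> b n" for n
  proof -
    have "X n = (\<lambda>\<eta>. (Fn (r n) \<eta>)\<^sup>2 + \<epsilon> n)" by (auto simp: X_def)
    then have "jensen_gap xlnx G (X n) \<le> 4 * C * Eform G (Fn (r n))"
      using lsi_FC0[OF FC \<epsilon> C CA, of "r n" n] by simp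
    then show ?thesis using IlX[of n] by (simp add: b_def jensen_gap_def prob_space)
  qed
  have mlim: "(\<lambda>n. \<integral>\<eta>. X n \<eta> \<partial>G) \<longlonglongrightarrow> 1"
  proof -
    have "(\<integral>\<eta>. X n \<eta> \<partial>G) = (\<integral>\<eta>. (Fn (r n) \<eta>)\<^sup>2 \<partial>G) + \<epsilon> n" for n
      unfolding X_def using FC_span_integrable(2)[OF sp] by (simp add: prob_space)
    moreover have "(\<lambda>n. (\<integral>\<eta>. (Fn (r n) \<eta>)\<^sup>2 \<partial>G) + \<epsilon> n) \<longlonglongrightarrow> 1 + 0"
      using LIMSEQ_subseq_LIMSEQ[OF approx_seq_moments(1)[OF F Fn] r(1)] one
      by (intro tendsto_intros \<epsilon>0) (simp add: o_def)
    ultimately show ?thesis by simp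
  qed
  \<comment> \<open>The term coming from the mean vanishes because the second moments tend to 1 and
    \<open>1 * ln 1 = 0\<close>. The final 1 matches the shift inside the integral.\<close>
  have blim: "b \<longlonglongrightarrow> 4 * C * Ebar G F + 1 * ln 1 + 1"
    unfolding b_def using LIMSEQ_subseq_LIMSEQ[OF approx_seq_limit[OF F Fn] r(1)]
    by (intro tendsto_intros mlim) (auto simp: o_def)
  have nn: "0 \<le> xlnx (X n \<eta>) + 1" "0 \<le> xlnx ((F \<eta>)\<^sup>2) + 1" for n \<eta>
    using xlnx_ge[of "X n \<eta>"] xlnx_ge[of "(F \<eta>)\<^sup>2"] Xpos[of n \<eta>] by auto
  have "(\<integral>\<^sup>+\<eta>. ennreal (xlnx ((F \<eta>)\<^sup>2) + 1) \<partial>G) = (\<integral>\<^sup>+\<eta>. liminf (\<lambda>n. ennreal (xlnx (X n \<eta>) + 1)) \<partial>G)"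
  proof (rule nn_integral_cong_AE)
    show "AE \<eta> in G. ennreal (xlnx ((F \<eta>)\<^sup>2) + 1) = liminf (\<lambda>n. ennreal (xlnx (X n \<eta>) + 1))"
      using AEX
    proof eventually_elim
      fix \<eta> assume "(\<lambda>n. xlnx (X n \<eta>)) \<longlonglongrightarrow> xlnx ((F \<eta>)\<^sup>2)"
      then have "(\<lambda>n. ennreal (xlnx (X n \<eta>) + 1)) \<longlonglongrightarrow> ennreal (xlnx ((F \<eta>)\<^sup>2) + 1)"
        by (intro tendsto_ennrealI tendsto_add tendsto_const)
      then show "ennreal (xlnx ((F \<eta>)\<^sup>2) + 1) = liminf (\<lambda>n. ennreal (xlnx (X n \<eta>) + 1))"
        by (simp add: lim_imp_Liminf)
    qed
  qed
  also have "\<dots> \<le> liminf (\<lambda>n. \<integral>\<^sup>+\<eta>. ennreal (xlnx (X n \<eta>) + 1) \<partial>G)"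
    by (rule nn_integral_liminf) measurable
  also have "\<dots> \<le> liminf (\<lambda>n. ennreal (b n))"
  proof (intro Liminf_mono always_eventually allI)
    fix n
    have "(\<integral>\<^sup>+\<eta>. ennreal (xlnx (X n \<eta>) + 1) \<partial>G) = ennreal (\<integral>\<eta>. xlnx (X n \<eta>) + 1 \<partial>G)"
      using IlX nn by (intro nn_integral_eq_integral) auto
    then show "(\<integral>\<^sup>+\<eta>. ennreal (xlnx (X n \<eta>) + 1) \<partial>G) \<le> ennreal (b n)" using le by (simp add: ennreal_leI)
  qed
  also have "\<dots> = ennreal (4 * C * Ebar G F + 1)"
  proof -
    have "(\<lambda>n. ennreal (b n)) \<longlonglongrightarrow> ennreal (4 * C * Ebar G F + 1)" using blim by (intro tendsto_ennrealI) simp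
    then show ?thesis by (simp add: lim_imp_Liminf)
  qed
  finally have fin: "(\<integral>\<^sup>+\<eta>. ennreal (xlnx ((F \<eta>)\<^sup>2) + 1) \<partial>G) \<le> ennreal (4 * C * Ebar G F + 1)" .
  have I1: "integrable G (\<lambda>\<eta>. xlnx ((F \<eta>)\<^sup>2) + 1)"
  proof (rule integrableI_nonneg)
    show "(\<integral>\<^sup>+\<eta>. ennreal (xlnx ((F \<eta>)\<^sup>2) + 1) \<partial>G) < \<infinity>" using fin by (rule le_less_trans) simp
  qed (use nn in auto)
  from Bochner_Integration.integrable_diff[OF I1 integrable_const[of 1]]
  show I2: "integrable G (\<lambda>\<eta>. xlnx ((F \<eta>)\<^sup>2))" by simp
  have "ennreal (\<integral>\<eta>. xlnx ((F \<eta>)\<^sup>2) + 1 \<partial>G) \<le> ennreal (4 * C * Ebar G F + 1)"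
    using fin nn_integral_eq_integral[OF I1] nn by simp
  then have "(\<integral>\<eta>. xlnx ((F \<eta>)\<^sup>2) + 1 \<partial>G) \<le> 4 * C * Ebar G F + 1"
    using Ebar_nonneg[OF FD] C by (subst (asm) ennreal_le_iff) auto
  then show "(\<integral>\<eta>. xlnx ((F \<eta>)\<^sup>2) \<partial>G) \<le> 4 * C * Ebar G F" using I2 by (simp add: prob_space)
qed

end

section \<open>Smooth functions with compact support\<close>

text \<open>The polynomial parameter makes the family closed under differentiation;
  \<open>bump 1\<close> is the classical flat function \<open>exp (- 1 / t)\<close>.\<close>

definition bump :: "real poly \<Rightarrow> real \<Rightarrow> real" where
  "bump p t = (if t > 0 then poly p (1 / t) * exp (- (1 / t)) else 0)"

text \<open>The chain rule for \<open>t \<mapsto> 1 / t\<close> contributes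
  \<open>- 1 / t^2\<close>, encoded by the polynomial \<open>[:0, 0, 1:]\<close> at
  \<open>1 / t\<close> with the sign moved into the second factor; there \<open>p\<close> comes from
  the exponential and \<open>- pderiv p\<close> from the polynomial.\<close>

definition bump_deriv :: "real poly \<Rightarrow> real poly" where
  "bump_deriv p = [:0, 0, 1:] * (p - pderiv p)"

lemma poly_exp_at_top: "((\<lambda>x. poly p x * exp (- x)) \<longlongrightarrow> 0) at_top" for p :: "real poly"
proof -
  have "((\<lambda>x. \<Sum>i\<le>degree p. coeff p i * (x ^ i / exp x)) \<longlongrightarrow> (\<Sum>i\<le>degree p. coeff p i * 0)) at_top"
    by (intro tendsto_sum tendsto_mult tendsto_const tendsto_power_div_exp_0)
  moreover have "(\<Sum>i\<le>degree p. coeff p i * (x ^ i / exp x)) = poly p x * exp (- x)" for x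
    by (simp add: poly_altdef sum_distrib_right exp_minus divide_inverse mult.assoc)
  ultimately show ?thesis by simp
qed

text \<open>The critical point is 0. The difference quotient from the right is again a polynomial in
  \<open>1 / y\<close> times \<open>exp (- (1 / y))\<close>, hence tends to 0; from the left it is
  0.\<close>

lemma has_derivative_bump: "(bump p has_real_derivative bump (bump_deriv p) t) (at t)"
proof -
  consider "t > 0" | "t < 0" | "t = 0" by linarith
  then show ?thesis
  proof cases
    case 1
    have i: "((\<lambda>t. 1 / t) has_real_derivative - (1 / t\<^sup>2)) (at t)"
      using 1 by (auto intro!: derivative_eq_intros simp: power2_eq_square)
    have "((\<lambda>t. poly p (1 / t) * exp (- (1 / t))) has_real_derivative
        poly (pderiv p) (1 / t) * - (1 / t\<^sup>2) * exp (- (1 / t)) + exp (- (1 / t)) * - (- (1 / t\<^sup>2)) * poly p (1 / t)) (at t)"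
      by (intro DERIV_mult DERIV_chain2[OF poly_DERIV i] DERIV_chain2[OF DERIV_exp DERIV_minus[OF i]])
    also have "poly (pderiv p) (1 / t) * - (1 / t\<^sup>2) * exp (- (1 / t)) + exp (- (1 / t)) * - (- (1 / t\<^sup>2)) * poly p (1 / t)
        = bump (bump_deriv p) t"
      using 1 by (simp add: bump_def bump_deriv_def power2_eq_square algebra_simps)
    finally show ?thesis
      by (rule DERIV_cong_ev[THEN iffD1, rotated -1])
        (use 1 in \<open>auto simp: bump_def intro!: eventually_nhds_in_open[THEN eventually_mono, of "{0<..}"]\<close>)
  next
    case 2
    have "((\<lambda>_. 0) has_real_derivative bump (bump_deriv p) t) (at t)" using 2 by (simp add: bump_def)
    then show ?thesis
      by (rule DERIV_cong_ev[THEN iffD1, rotated -1])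
        (use 2 in \<open>auto simp: bump_def intro!: eventually_nhds_in_open[THEN eventually_mono, of "{..<0}"]\<close>)
  next
    case 3
    have "((\<lambda>y. (bump p y - bump p 0) / (y - 0)) \<longlongrightarrow> 0) (at 0)"
      unfolding filterlim_at_split
    proof
      have "\<forall>\<^sub>F y in at_left 0. (bump p y - bump p 0) / (y - 0) = 0"
        by (rule eventually_at_leftI[of "-1"]) (auto simp: bump_def)
      then show "((\<lambda>y. (bump p y - bump p 0) / (y - 0)) \<longlongrightarrow> 0) (at_left 0)" by (rule tendsto_eventually)
      have "((\<lambda>y. poly ([:0, 1:] * p) (1 / y) * exp (- (1 / y))) \<longlongrightarrow> 0) (at_right (0::real))"
      proof (rule filterlim_compose[OF poly_exp_at_top])
        show "filterlim (\<lambda>y. 1 / y) at_top (at_right (0::real))" by real_asymp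
      qed
      moreover have "\<forall>\<^sub>F y in at_right 0. poly ([:0, 1:] * p) (1 / y) * exp (- (1 / y)) = (bump p y - bump p 0) / (y - 0)"
        using eventually_at_right_less[of 0] by eventually_elim (simp add: bump_def)
      ultimately show "((\<lambda>y. (bump p y - bump p 0) / (y - 0)) \<longlongrightarrow> 0) (at_right 0)"
        by (rule Lim_transform_eventually)
    qed
    then show ?thesis using 3 by (simp add: has_field_derivative_iff bump_def)
  qed
qed

text \<open>A syntactic class closed under partial derivatives. \<open>C0_infty\<close> speaks about
  all iterated partials, and membership in this class turns that into an induction on the list of
  indices.\<close>

inductive smooth_expr :: "((nat \<Rightarrow> real) \<Rightarrow> real) \<Rightarrow> bool" where
  const: "smooth_expr (\<lambda>y. c)"
| coord: "smooth_expr (\<lambda>y. y i)"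
| bump: "smooth_expr (\<lambda>y. bump p (a + b * y i))"
| add: "smooth_expr f \<Longrightarrow> smooth_expr g \<Longrightarrow> smooth_expr (\<lambda>y. f y + g y)"
| mult: "smooth_expr f \<Longrightarrow> smooth_expr g \<Longrightarrow> smooth_expr (\<lambda>y. f y * g y)"

lemma smooth_expr_deriv:
  assumes "smooth_expr f"
  shows "\<exists>f'. smooth_expr f' \<and> (\<forall>y t. ((\<lambda>t. f (y(i := t))) has_real_derivative f' (y(i := t))) (at t))"
  using assms
proof induction
  case (const c)
  then show ?case by (intro exI[of _ "\<lambda>y. 0"]) (auto intro: smooth_expr.const)
next
  case (coord j)
  show ?case
    by (rule exI[of _ "\<lambda>y. if j = i then 1 else 0"])
      (cases "j = i"; auto intro!: smooth_expr.const derivative_eq_intros)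
next
  case (bump p a b j)
  show ?case
  proof (cases "j = i")
    case True
    have d: "((\<lambda>t. a + b * t) has_real_derivative b) (at t)" for t by (auto intro!: derivative_eq_intros)
    have "smooth_expr (\<lambda>y. bump (bump_deriv p) (a + b * y i) * b)"
      by (intro smooth_expr.mult smooth_expr.bump smooth_expr.const)
    then show ?thesis using True DERIV_chain2[OF has_derivative_bump d]
      by (intro exI[of _ "\<lambda>y. bump (bump_deriv p) (a + b * y i) * b"]) auto
  next
    case False
    then show ?thesis by (intro exI[of _ "\<lambda>y. 0"]) (auto intro: smooth_expr.const)
  qed
next
  case (add f g)
  then obtain f' g' where "smooth_expr f'" "smooth_expr g'"
    "\<And>y t. ((\<lambda>t. f (y(i := t))) has_real_derivative f' (y(i := t))) (at t)"
    "\<And>y t. ((\<lambda>t. g (y(i := t))) has_real_derivative g' (y(i := t))) (at t)" by blast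
  then show ?case
    by (intro exI[of _ "\<lambda>y. f' y + g' y"] conjI smooth_expr.add allI DERIV_add)
next
  case (mult f g)
  then obtain f' g' where f': "smooth_expr f'" "smooth_expr g'"
    "\<And>y t. ((\<lambda>t. f (y(i := t))) has_real_derivative f' (y(i := t))) (at t)"
    "\<And>y t. ((\<lambda>t. g (y(i := t))) has_real_derivative g' (y(i := t))) (at t)" by blast
  then show ?case using mult.hyps
    by (intro exI[of _ "\<lambda>y. f' y * g y + g' y * f y"] conjI smooth_expr.add smooth_expr.mult allI DERIV_mult)
qed

lemma smooth_expr_continuous: "smooth_expr f \<Longrightarrow> continuous_on UNIV f"
proof (induction rule: smooth_expr.induct)
  case (bump p a b i)
  have "continuous_on UNIV (bump p)"
    by (auto intro!: continuous_at_imp_continuous_on DERIV_isCont has_derivative_bump)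
  then show ?case
    by (rule continuous_on_compose2) (auto intro!: continuous_intros continuous_on_product_coordinates)
qed (auto intro!: continuous_intros continuous_on_product_coordinates)

lemma partial_d_eqI:
  assumes "\<And>y t. ((\<lambda>t. f (y(i := t))) has_real_derivative f' (y(i := t))) (at t)"
  shows "partial_d i f = f'"
proof
  fix y show "partial_d i f y = f' y"
    unfolding partial_d_def using DERIV_imp_deriv[OF assms[of y "y i"]] by simp
qed

lemma smooth_expr_iter: "smooth_expr f \<Longrightarrow> smooth_expr (iter_partial is f)"
proof (induction "is")
  case (Cons i "is")
  then obtain f' where "smooth_expr f'"
    "\<And>y t. ((\<lambda>t. iter_partial is f (y(i := t))) has_real_derivative f' (y(i := t))) (at t)"
    using smooth_expr_deriv by blast
  then show ?case using partial_d_eqI[of "iter_partial is f" i f'] by simp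
qed simp

lemma C0_infty_smooth_expr:
  assumes f: "smooth_expr f" and tr: "\<And>y. f (trunc_vec n y) = f y"
    and supp: "\<And>y i. i < n \<Longrightarrow> \<bar>y i\<bar> > B \<Longrightarrow> f y = 0"
  shows "C0_infty n f"
  unfolding C0_infty_def Let_def tr
proof (intro conjI allI impI)
  fix "is" i and y :: "nat \<Rightarrow> real"
  have s: "smooth_expr (iter_partial is f)" by (rule smooth_expr_iter[OF f])
  then show "continuous_on UNIV (iter_partial is f)" by (rule smooth_expr_continuous)
  obtain f' where "\<And>y t. ((\<lambda>t. iter_partial is f (y(i := t))) has_real_derivative f' (y(i := t))) (at t)"
    using smooth_expr_deriv[OF s] by blast
  then show "(\<lambda>t. iter_partial is f (y(i := t))) differentiable (at (y i))"
    using real_differentiable_def by blast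
next
  show "\<exists>B. \<forall>y. (\<exists>i<n. B < \<bar>y i\<bar>) \<longrightarrow> f y = 0" using supp by blast
qed

text \<open>At \<open>s = 0\<close> both bumps equal \<open>exp (- 1)\<close>, so the factor
  \<open>exp 2\<close> normalises the value there to 1. One bump vanishes for
  \<open>s \<ge> 1\<close>, the other for \<open>s \<le> - 1\<close>.\<close>

definition cutoff :: "real \<Rightarrow> real" where
  "cutoff s = exp 2 * (bump 1 (1 - s) * bump 1 (1 + s))"

definition cutoff' :: "real \<Rightarrow> real" where
  "cutoff' s = exp 2 * (- bump (bump_deriv 1) (1 - s) * bump 1 (1 + s) + bump (bump_deriv 1) (1 + s) * bump 1 (1 - s))"

lemma cutoff_deriv: "(cutoff has_real_derivative cutoff' s) (at s)"
proof -
  have "((\<lambda>s. 1 - s) has_real_derivative - 1) (at s)" "((\<lambda>s. 1 + s) has_real_derivative 1) (at s)"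
    by (auto intro!: derivative_eq_intros)
  from DERIV_chain2[OF has_derivative_bump this(1)] DERIV_chain2[OF has_derivative_bump this(2)]
  have "(cutoff has_real_derivative exp 2 * (bump (bump_deriv 1) (1 - s) * - 1 * bump 1 (1 + s) + bump (bump_deriv 1) (1 + s) * 1 * bump 1 (1 - s))) (at s)"
    unfolding cutoff_def[abs_def] by (intro DERIV_cmult DERIV_mult)
  then show ?thesis by (simp add: cutoff'_def)
qed

lemma cutoff_0: "cutoff 0 = 1"
  by (simp add: cutoff_def bump_def flip: exp_add)

lemma cutoff_support: "\<bar>s\<bar> > 1 \<Longrightarrow> cutoff s = 0" "\<bar>s\<bar> > 1 \<Longrightarrow> cutoff' s = 0"
  by (auto simp: cutoff_def cutoff'_def bump_def)

lemma cutoff_continuous: "continuous_on UNIV cutoff" "continuous_on UNIV cutoff'"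
proof -
  have b: "continuous_on UNIV (bump p)" for p
    by (auto intro!: continuous_at_imp_continuous_on DERIV_isCont has_derivative_bump)
  have c: "continuous_on UNIV (\<lambda>s. bump p (1 - s))" "continuous_on UNIV (\<lambda>s. bump p (1 + s))" for p
    by (rule continuous_on_compose2[OF b], auto intro!: continuous_intros)+
  show "continuous_on UNIV cutoff" "continuous_on UNIV cutoff'"
    unfolding cutoff_def[abs_def] cutoff'_def[abs_def] by (intro continuous_intros c)+
qed

lemma bounded_compact_support_real:
  fixes f :: "real \<Rightarrow> real"
  assumes "continuous_on UNIV f" "\<And>s. \<bar>s\<bar> > 1 \<Longrightarrow> f s = 0"
  shows "\<exists>K. \<forall>s. \<bar>f s\<bar> \<le> K"
proof -
  have "compact (f ` {-1..1})"
    by (intro compact_continuous_image continuous_on_subset[OF assms(1)]) auto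
  then have "bounded (f ` {-1..1})" by (rule compact_imp_bounded)
  then obtain K where K: "\<And>s. s \<in> {-1..1} \<Longrightarrow> \<bar>f s\<bar> \<le> K" unfolding bounded_iff real_norm_def by blast
  have "\<bar>f s\<bar> \<le> \<bar>K\<bar>" for s
  proof (cases "\<bar>s\<bar> > 1")
    case False
    then have "\<bar>f s\<bar> \<le> K" by (intro K) auto
    then show ?thesis by linarith
  qed (use assms(2) in simp)
  then show ?thesis by blast
qed

lemma cutoff_bounds:
  obtains K where "\<And>s. \<bar>cutoff s\<bar> \<le> K" "\<And>s. \<bar>cutoff' s\<bar> \<le> K" "\<And>s. \<bar>s * cutoff s\<bar> \<le> K" "\<And>s. \<bar>s * cutoff' s\<bar> \<le> K"
    "K \<ge> 1"
proof -
  obtain K1 K2 K3 K4 where K: "\<And>s. \<bar>cutoff s\<bar> \<le> K1" "\<And>s. \<bar>cutoff' s\<bar> \<le> K2" "\<And>s. \<bar>s * cutoff s\<bar> \<le> K3" "\<And>s. \<bar>s * cutoff' s\<bar> \<le> K4"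
    using bounded_compact_support_real[of cutoff] bounded_compact_support_real[of cutoff']
      bounded_compact_support_real[of "\<lambda>s. s * cutoff s"] bounded_compact_support_real[of "\<lambda>s. s * cutoff' s"]
      cutoff_continuous cutoff_support by (auto simp: continuous_on_mult continuous_on_id)
  show thesis
    using K by (intro that[of "max 1 (max (max K1 K2) (max K3 K4))"]) (auto simp: le_max_iff_disj)
qed

section \<open>The masses of measurable sets as test functions\<close>

text \<open>The coordinate \<open>y 0\<close> cut off in both variables: compact support in the
  plane of the two masses requires a bound on the mass of the complement as well. As
  \<open>c\<close> tends to 0 the function tends to \<open>y 0\<close>.\<close>

definition tf :: "real \<Rightarrow> (nat \<Rightarrow> real) \<Rightarrow> real" where
  "tf c y = y 0 * (cutoff (c * y 0) * cutoff (c * y 1))"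

definition tf' :: "real \<Rightarrow> nat \<Rightarrow> (nat \<Rightarrow> real) \<Rightarrow> real" where
  "tf' c i y = (if i = 0 then (cutoff (c * y 0) + (c * y 0) * cutoff' (c * y 0)) * cutoff (c * y 1)
     else (c * y 0) * cutoff (c * y 0) * cutoff' (c * y 1))"

lemma smooth_expr_tf: "smooth_expr (tf c)"
proof -
  have b: "smooth_expr (\<lambda>y. bump 1 (1 - c * y i))" "smooth_expr (\<lambda>y. bump 1 (1 + c * y i))" for i
    using smooth_expr.bump[of 1 1 "- c" i] smooth_expr.bump[of 1 1 c i] by simp_all
  show ?thesis unfolding tf_def[abs_def] cutoff_def by (intro smooth_expr.intros b)
qed

lemma tf_partial:
  assumes "i < 2" shows "partial_d i (tf c) = tf' c i"
proof (rule partial_d_eqI)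
  fix y t
  have d: "((\<lambda>t. cutoff (c * t)) has_real_derivative cutoff' (c * t) * c) (at t)"
    by (rule DERIV_chain2[OF cutoff_deriv]) (auto intro!: derivative_eq_intros)
  consider "i = 0" | "i = 1" using assms by linarith
  then show "((\<lambda>t. tf c (y(i := t))) has_real_derivative tf' c i (y(i := t))) (at t)"
  proof cases
    case 1
    have "((\<lambda>t. t * (cutoff (c * t) * cutoff (c * y 1))) has_real_derivative
       1 * (cutoff (c * t) * cutoff (c * y 1)) + (cutoff' (c * t) * c * cutoff (c * y 1)) * t) (at t)"
      by (intro DERIV_mult DERIV_ident DERIV_cmult_right d)
    then show ?thesis using 1 by (simp add: tf_def tf'_def algebra_simps)
  next
    case 2
    have "((\<lambda>t. y 0 * (cutoff (c * y 0) * cutoff (c * t))) has_real_derivative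
       y 0 * (cutoff (c * y 0) * (cutoff' (c * t) * c))) (at t)"
      by (intro DERIV_cmult d)
    then show ?thesis using 2 by (simp add: tf_def tf'_def algebra_simps)
  qed
qed

lemma tf_trunc: "tf c (trunc_vec 2 y) = tf c y"
  by (simp add: tf_def trunc_vec_def)

lemma tf_support:
  assumes "c > 0" "i < 2" "\<bar>y i\<bar> > 1 / c" shows "tf c y = 0"
proof -
  have "\<bar>c * y i\<bar> > 1" using assms by (simp add: abs_mult field_simps)
  then have "cutoff (c * y i) = 0" by (rule cutoff_support)
  moreover have "i = 0 \<or> i = 1" using assms by auto
  ultimately show ?thesis by (auto simp: tf_def)
qed

context gamma_process
begin

lemma mass_moments:
  assumes "A \<in> sets borel"
  shows "integrable G (\<lambda>\<eta>. measure \<eta> A)" "(\<integral>\<eta>. measure \<eta> A \<partial>G) = measure \<nu> A"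
    "integrable G (\<lambda>\<eta>. (measure \<eta> A)\<^sup>2)" "(\<integral>\<eta>. (measure \<eta> A)\<^sup>2 \<partial>G) = measure \<nu> A * (measure \<nu> A + 1)"
proof -
  note m [measurable] = measurable_measure[OF assms]
  note d = distr_measure[OF assms]
  note gm = gamma_law_moments[of "measure \<nu> A", folded d, simplified]
  show "integrable G (\<lambda>\<eta>. measure \<eta> A)" "(\<integral>\<eta>. measure \<eta> A \<partial>G) = measure \<nu> A"
    "integrable G (\<lambda>\<eta>. (measure \<eta> A)\<^sup>2)" "(\<integral>\<eta>. (measure \<eta> A)\<^sup>2 \<partial>G) = measure \<nu> A * (measure \<nu> A + 1)"
    using gm by (simp_all add: integrable_distr_eq integral_distr)
qed

text \<open>The approximants are \<open>tf (c k)\<close> on the partition into \<open>A\<close> and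
  its complement, with \<open>c k\<close> tending to 0. Their partial derivatives are bounded
  uniformly in \<open>k\<close> and converge to 1 and 0, so dominated convergence, with the masses
  and the squared mass as integrable weights, gives both the mean square limit and the limit of the
  energies.\<close>

lemma mass_in_dom_closure:
  assumes A: "A \<in> sets borel"
  shows "(\<lambda>\<eta>. measure \<eta> A) \<in> dom_closure G" "Ebar G (\<lambda>\<eta>. measure \<eta> A) = measure \<nu> A"
proof -
  define A2 where "A2 i = (if i = 0 then A else - A)" for i :: nat
  have A2: "\<And>i. i < 2 \<Longrightarrow> A2 i \<in> sets borel" "disjoint_family_on A2 {..<2}" "(\<Union>i<2. A2 i) = UNIV"
    using A by (auto simp: A2_def disjoint_family_on_def lessThan_nat_numeral lessThan_Suc)
  let ?a = "\<lambda>\<eta>. measure \<eta> A" and ?b = "\<lambda>\<eta>. measure \<eta> (- A)"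
  have Ac: "- A \<in> sets borel" using A by auto
  have cv: "cvec 2 A2 \<eta> 0 = ?a \<eta>" "cvec 2 A2 \<eta> 1 = ?b \<eta>" for \<eta> by (auto simp: cvec_def A2_def)
  have [measurable]: "cutoff \<in> borel_measurable borel" "cutoff' \<in> borel_measurable borel"
    using cutoff_continuous by (auto intro: borel_measurable_continuous_onI)
  note [measurable] = measurable_measure[OF A] measurable_measure[OF Ac]
  define c where "c k = 1 / (real k + 1)" for k
  have c: "c k > 0" for k by (simp add: c_def)
  have c0: "c \<longlonglongrightarrow> 0" unfolding c_def by real_asymp
  define F where "F k \<eta> = tf (c k) (cvec 2 A2 \<eta>)" for k \<eta>
  have FC0I: "(\<lambda>\<eta>. f (cvec 2 A2 \<eta>)) \<in> FC0"
    "Eform G (\<lambda>\<eta>. f (cvec 2 A2 \<eta>)) = (\<integral>\<eta>. ?a \<eta> * (partial_d 0 f (cvec 2 A2 \<eta>))\<^sup>2 \<partial>G) + (\<integral>\<eta>. ?b \<eta> * (partial_d 1 f (cvec 2 A2 \<eta>))\<^sup>2 \<partial>G)"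
    if f: "smooth_expr f" "\<And>y. f (trunc_vec 2 y) = f y" "\<And>y i. i < 2 \<Longrightarrow> \<bar>y i\<bar> > B \<Longrightarrow> f y = 0" for f B
  proof -
    have C0: "C0_infty 2 f" using f by (rule C0_infty_smooth_expr)
    then show "(\<lambda>\<eta>. f (cvec 2 A2 \<eta>)) \<in> FC0"
      unfolding FC0_def cvec_def using A2 by (intro CollectI exI[of _ 2]) auto
    obtain K where "smooth_cyl 2 f (\<lambda>i. partial_d i f) (\<lambda>i. partial_d i (partial_d i f)) K"
      using C0_infty_smooth_cyl[OF C0] unfolding f(2) by blast
    from Eform_cyl[OF this A2 refl]
    show "Eform G (\<lambda>\<eta>. f (cvec 2 A2 \<eta>)) = (\<integral>\<eta>. ?a \<eta> * (partial_d 0 f (cvec 2 A2 \<eta>))\<^sup>2 \<partial>G) + (\<integral>\<eta>. ?b \<eta> * (partial_d 1 f (cvec 2 A2 \<eta>))\<^sup>2 \<partial>G)"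
      by (simp add: lessThan_nat_numeral lessThan_Suc cv[unfolded One_nat_def] power2_eq_square)
  qed
  obtain K where K: "\<And>s. \<bar>cutoff s\<bar> \<le> K" "\<And>s. \<bar>cutoff' s\<bar> \<le> K" "\<And>s. \<bar>s * cutoff s\<bar> \<le> K" "\<And>s. \<bar>s * cutoff' s\<bar> \<le> K"
    "K \<ge> 1" using cutoff_bounds by blast
  define p q where "p k \<eta> = tf' (c k) 0 (cvec 2 A2 \<eta>)" and "q k \<eta> = tf' (c k) 1 (cvec 2 A2 \<eta>)" for k \<eta>
  have pq_eq: "p k \<eta> = (cutoff (c k * ?a \<eta>) + (c k * ?a \<eta>) * cutoff' (c k * ?a \<eta>)) * cutoff (c k * ?b \<eta>)"
    "q k \<eta> = (c k * ?a \<eta>) * cutoff (c k * ?a \<eta>) * cutoff' (c k * ?b \<eta>)" for k \<eta>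
    by (auto simp: p_def q_def tf'_def cv[simplified])
  have [measurable]: "p k \<in> borel_measurable G" "q k \<in> borel_measurable G" for k
    unfolding pq_eq[abs_def] by measurable
  \<comment> \<open>The unbounded mass occurs only as \<open>c k * ?a \<eta>\<close> times
    \<open>cutoff\<close> or \<open>cutoff'\<close> of that same argument, which makes the bounds
    independent of \<open>k\<close>.\<close>
  have pb: "\<bar>p k \<eta>\<bar> \<le> (K + K) * K" "\<bar>q k \<eta>\<bar> \<le> K * K" for k \<eta>
  proof -
    have "\<bar>cutoff s + s * cutoff' s\<bar> \<le> K + K" for s using K(1,4)[of s] by linarith
    then show "\<bar>p k \<eta>\<bar> \<le> (K + K) * K" unfolding pq_eq abs_mult[of "cutoff _ + _"]
      using K by (intro mult_mono) auto
    show "\<bar>q k \<eta>\<bar> \<le> K * K" unfolding pq_eq abs_mult[of "_ * cutoff _"] using K by (intro mult_mono) auto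
  qed
  have cut: "(\<lambda>k. cutoff (c k * z)) \<longlonglongrightarrow> 1" "(\<lambda>k. cutoff' (c k * z)) \<longlonglongrightarrow> cutoff' 0" "(\<lambda>k. c k * z) \<longlonglongrightarrow> 0" for z
  proof -
    show z: "(\<lambda>k. c k * z) \<longlonglongrightarrow> 0" using tendsto_mult_right[OF c0, of z] by simp
    show "(\<lambda>k. cutoff (c k * z)) \<longlonglongrightarrow> 1" "(\<lambda>k. cutoff' (c k * z)) \<longlonglongrightarrow> cutoff' 0"
      using continuous_on_tendsto_compose[OF cutoff_continuous(1) z] continuous_on_tendsto_compose[OF cutoff_continuous(2) z]
      by (auto simp: cutoff_0)
  qed
  have plim: "(\<lambda>k. p k \<eta>) \<longlonglongrightarrow> 1" "(\<lambda>k. q k \<eta>) \<longlonglongrightarrow> 0" for \<eta>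
  proof -
    have "(\<lambda>k. p k \<eta>) \<longlonglongrightarrow> (1 + 0 * cutoff' 0) * 1" unfolding pq_eq by (intro tendsto_intros cut)
    then show "(\<lambda>k. p k \<eta>) \<longlonglongrightarrow> 1" by simp
    have "(\<lambda>k. q k \<eta>) \<longlonglongrightarrow> 0 * 1 * cutoff' 0" unfolding pq_eq by (intro tendsto_intros cut)
    then show "(\<lambda>k. q k \<eta>) \<longlonglongrightarrow> 0" by simp
  qed
  have dom: "(\<lambda>k. \<integral>\<eta>. w \<eta> * (r k \<eta>)\<^sup>2 \<partial>G) \<longlonglongrightarrow> (\<integral>\<eta>. w \<eta> * r0\<^sup>2 \<partial>G)" "\<And>k. integrable G (\<lambda>\<eta>. w \<eta> * (r k \<eta>)\<^sup>2)"
    if w: "integrable G w" and r [measurable]: "\<And>k. r k \<in> borel_measurable G" and b: "\<And>k \<eta>. \<bar>r k \<eta>\<bar> \<le> L"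
      and l: "\<And>\<eta>. (\<lambda>k. r k \<eta>) \<longlonglongrightarrow> r0" for w r r0 and L :: real
  proof -
    note [measurable] = borel_measurable_integrable[OF w]
    have bb: "norm (w \<eta> * (r k \<eta>)\<^sup>2) \<le> \<bar>w \<eta>\<bar> * L\<^sup>2" for k \<eta>
      using power_mono[OF b[of k \<eta>], of 2] by (auto simp: abs_mult intro!: mult_left_mono)
    have wi: "integrable G (\<lambda>\<eta>. \<bar>w \<eta>\<bar> * L\<^sup>2)" using w by simp
    show "(\<lambda>k. \<integral>\<eta>. w \<eta> * (r k \<eta>)\<^sup>2 \<partial>G) \<longlonglongrightarrow> (\<integral>\<eta>. w \<eta> * r0\<^sup>2 \<partial>G)"
      by (rule integral_dominated_convergence[OF _ _ wi]) (use bb in \<open>auto intro!: tendsto_intros l\<close>)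
    show "integrable G (\<lambda>\<eta>. w \<eta> * (r k \<eta>)\<^sup>2)" for k
      by (rule Bochner_Integration.integrable_bound[OF wi]) (use bb[of _ k] in \<open>auto intro: order_trans\<close>)
  qed
  have p1: "\<bar>p k \<eta> - 1\<bar> \<le> (K + K) * K + 1" for k \<eta> using pb(1)[of k \<eta>] by linarith
  have p1lim: "(\<lambda>k. p k \<eta> - 1) \<longlonglongrightarrow> 0" for \<eta> using tendsto_diff[OF plim(1) tendsto_const[of 1]] by simp
  have Ia: "integrable G ?a" "integrable G ?b" by (rule mass_moments(1)[OF A], rule mass_moments(1)[OF Ac])
  have F_FC0: "F k \<in> FC0" for k
    unfolding F_def[abs_def] by (rule FC0I(1)[OF smooth_expr_tf tf_trunc tf_support[OF c]])
  have EF: "Eform G (F k) = (\<integral>\<eta>. ?a \<eta> * (p k \<eta>)\<^sup>2 \<partial>G) + (\<integral>\<eta>. ?b \<eta> * (q k \<eta>)\<^sup>2 \<partial>G)" for k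
  proof -
    have "Eform G (F k) = (\<integral>\<eta>. ?a \<eta> * (partial_d 0 (tf (c k)) (cvec 2 A2 \<eta>))\<^sup>2 \<partial>G)
        + (\<integral>\<eta>. ?b \<eta> * (partial_d 1 (tf (c k)) (cvec 2 A2 \<eta>))\<^sup>2 \<partial>G)"
      unfolding F_def[abs_def] by (rule FC0I(2)[OF smooth_expr_tf tf_trunc tf_support[OF c]])
    then show ?thesis by (simp add: tf_partial p_def q_def)
  qed
  have EF_lim: "(\<lambda>k. Eform G (F k)) \<longlonglongrightarrow> measure \<nu> A"
  proof -
    have "(\<lambda>k. Eform G (F k)) \<longlonglongrightarrow> (\<integral>\<eta>. ?a \<eta> * 1\<^sup>2 \<partial>G) + (\<integral>\<eta>. ?b \<eta> * 0\<^sup>2 \<partial>G)"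
      unfolding EF by (intro tendsto_add dom(1)[OF Ia(1) _ pb(1) plim(1)] dom(1)[OF Ia(2) _ pb(2) plim(2)]) measurable
    then show ?thesis using mass_moments(2)[OF A] by simp
  qed
  \<comment> \<open>The squared distance of the gradient of \<open>F k\<close> from its expected
    limit \<open>(1, 0)\<close>. Comparing through this limit proves the Cauchy property without
    applying the form to the mass itself.\<close>
  define e where "e k = (\<integral>\<eta>. ?a \<eta> * (p k \<eta> - 1)\<^sup>2 \<partial>G) + (\<integral>\<eta>. ?b \<eta> * (q k \<eta>)\<^sup>2 \<partial>G)" for k
  have e0: "e \<longlonglongrightarrow> 0"
  proof -
    have "e \<longlonglongrightarrow> (\<integral>\<eta>. ?a \<eta> * 0\<^sup>2 \<partial>G) + (\<integral>\<eta>. ?b \<eta> * 0\<^sup>2 \<partial>G)"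
      unfolding e_def by (intro tendsto_add dom(1)[OF Ia(1) _ p1 p1lim] dom(1)[OF Ia(2) _ pb(2) plim(2)]) measurable
    then show ?thesis by simp
  qed
  have Ediff: "Eform G (\<lambda>\<eta>. F k \<eta> - F l \<eta>) \<le> 2 * e k + 2 * e l" for k l
  proof -
    \<comment> \<open>Both functions live on the same partition, so their difference is again a
      smooth cylinder function. The factor \<open>- 1\<close> replaces a subtraction because
      \<open>smooth_expr\<close> is generated by sums and products.\<close>
    define f where "f y = tf (c k) y + (- 1) * tf (c l) y" for y
    have sf: "smooth_expr f" unfolding f_def[abs_def] by (intro smooth_expr.intros smooth_expr_tf)
    have pd: "partial_d i f = (\<lambda>y. tf' (c k) i y + (- 1) * tf' (c l) i y)" if "i < 2" for i
    proof (rule partial_d_eqI)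
      fix y t
      have td: "((\<lambda>t. tf d (y(i := t))) has_real_derivative tf' d i (y(i := t))) (at t)" for d
      proof -
        obtain g where g: "\<And>y t. ((\<lambda>t. tf d (y(i := t))) has_real_derivative g (y(i := t))) (at t)"
          using smooth_expr_deriv[OF smooth_expr_tf] by blast
        then have "g = tf' d i" using partial_d_eqI[of "tf d" i g] tf_partial[OF that] by simp
        then show ?thesis using g by simp
      qed
      show "((\<lambda>t. f (y(i := t))) has_real_derivative tf' (c k) i (y(i := t)) + (- 1) * tf' (c l) i (y(i := t))) (at t)"
        unfolding f_def by (intro DERIV_add DERIV_cmult td)
    qed
    have sup: "f y = 0" if "i < 2" "\<bar>y i\<bar> > max (1 / c k) (1 / c l)" for y i
      using tf_support[OF c that(1), of k y] tf_support[OF c that(1), of l y] that by (simp add: f_def)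
    have tr: "f (trunc_vec 2 y) = f y" for y by (simp add: f_def tf_trunc)
    have "Eform G (\<lambda>\<eta>. f (cvec 2 A2 \<eta>)) = (\<integral>\<eta>. ?a \<eta> * (p k \<eta> - p l \<eta>)\<^sup>2 \<partial>G) + (\<integral>\<eta>. ?b \<eta> * (q k \<eta> - q l \<eta>)\<^sup>2 \<partial>G)"
    proof -
      have "Eform G (\<lambda>\<eta>. f (cvec 2 A2 \<eta>)) = (\<integral>\<eta>. ?a \<eta> * (partial_d 0 f (cvec 2 A2 \<eta>))\<^sup>2 \<partial>G)
          + (\<integral>\<eta>. ?b \<eta> * (partial_d 1 f (cvec 2 A2 \<eta>))\<^sup>2 \<partial>G)"
        by (rule FC0I(2)[OF sf tr sup])
      then show ?thesis by (simp add: pd p_def q_def)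
    qed
    also have "\<dots> \<le> (\<integral>\<eta>. 2 * (?a \<eta> * (p k \<eta> - 1)\<^sup>2) + 2 * (?a \<eta> * (p l \<eta> - 1)\<^sup>2) \<partial>G)
        + (\<integral>\<eta>. 2 * (?b \<eta> * (q k \<eta>)\<^sup>2) + 2 * (?b \<eta> * (q l \<eta>)\<^sup>2) \<partial>G)"
    proof (intro add_mono integral_mono)
      have sq: "w * (x - y)\<^sup>2 \<le> 2 * (w * (x - z)\<^sup>2) + 2 * (w * (y - z)\<^sup>2)" if "w \<ge> 0" for w x y z :: real
      proof -
        have "0 \<le> w * ((x - z) + (y - z))\<^sup>2" using that by simp
        then show ?thesis by (simp add: power2_eq_square algebra_simps)
      qed
      show "?a \<eta> * (p k \<eta> - p l \<eta>)\<^sup>2 \<le> 2 * (?a \<eta> * (p k \<eta> - 1)\<^sup>2) + 2 * (?a \<eta> * (p l \<eta> - 1)\<^sup>2)" for \<eta>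
        by (rule sq) simp
      show "?b \<eta> * (q k \<eta> - q l \<eta>)\<^sup>2 \<le> 2 * (?b \<eta> * (q k \<eta>)\<^sup>2) + 2 * (?b \<eta> * (q l \<eta>)\<^sup>2)" for \<eta>
        using sq[of "?b \<eta>" "q k \<eta>" "q l \<eta>" 0] by simp
      have d1: "\<bar>p k \<eta> - p l \<eta>\<bar> \<le> (K + K) * K + (K + K) * K" for \<eta> using pb(1)[of k \<eta>] pb(1)[of l \<eta>] by linarith
      have d2: "\<bar>q k \<eta> - q l \<eta>\<bar> \<le> K * K + K * K" for \<eta> using pb(2)[of k \<eta>] pb(2)[of l \<eta>] by linarith
      have bi: "integrable G (\<lambda>\<eta>. w \<eta> * (r \<eta>)\<^sup>2)"
        if w: "integrable G w" and r: "r \<in> borel_measurable G" and b: "\<And>\<eta>. \<bar>r \<eta>\<bar> \<le> L" for w r and L :: real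
      proof (rule Bochner_Integration.integrable_bound)
        show "(\<lambda>\<eta>. w \<eta> * (r \<eta>)\<^sup>2) \<in> borel_measurable G"
          by (intro borel_measurable_times borel_measurable_power borel_measurable_integrable[OF w] r)
        show "integrable G (\<lambda>\<eta>. \<bar>w \<eta>\<bar> * L\<^sup>2)" using w by simp
        have "norm (w \<eta> * (r \<eta>)\<^sup>2) \<le> norm (\<bar>w \<eta>\<bar> * L\<^sup>2)" for \<eta>
          using power_mono[OF b[of \<eta>], of 2] by (auto simp: abs_mult intro!: mult_left_mono)
        then show "AE \<eta> in G. norm (w \<eta> * (r \<eta>)\<^sup>2) \<le> norm (\<bar>w \<eta>\<bar> * L\<^sup>2)" by simp
      qed
      show "integrable G (\<lambda>\<eta>. ?a \<eta> * (p k \<eta> - p l \<eta>)\<^sup>2)" "integrable G (\<lambda>\<eta>. ?b \<eta> * (q k \<eta> - q l \<eta>)\<^sup>2)"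
        by (rule bi[OF Ia(1) _ d1], measurable, rule bi[OF Ia(2) _ d2], measurable)
    qed (intro Bochner_Integration.integrable_add integrable_mult_right dom(2)[OF Ia(1) _ p1 p1lim] dom(2)[OF Ia(2) _ pb(2) plim(2)]; measurable)+
    also have "\<dots> = 2 * e k + 2 * e l"
    proof -
      have "integrable G (\<lambda>\<eta>. ?a \<eta> * (p j \<eta> - 1)\<^sup>2)" "integrable G (\<lambda>\<eta>. ?b \<eta> * (q j \<eta>)\<^sup>2)" for j
        by (rule dom(2)[OF Ia(1) _ p1 p1lim], measurable, rule dom(2)[OF Ia(2) _ pb(2) plim(2)], measurable)
      then show ?thesis by (simp add: e_def)
    qed
    finally show ?thesis by (simp add: F_def f_def)
  qed
  have L2: "(\<lambda>k. \<integral>\<eta>. (F k \<eta> - ?a \<eta>)\<^sup>2 \<partial>G) \<longlonglongrightarrow> 0"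
  proof -
    define r where "r k \<eta> = cutoff (c k * ?a \<eta>) * cutoff (c k * ?b \<eta>) - 1" for k \<eta>
    have rm: "r k \<in> borel_measurable G" for k unfolding r_def by measurable
    have rb: "\<bar>r k \<eta>\<bar> \<le> K * K + 1" for k \<eta>
    proof -
      have "\<bar>cutoff (c k * ?a \<eta>) * cutoff (c k * ?b \<eta>)\<bar> \<le> K * K" unfolding abs_mult using K by (intro mult_mono) auto
      then show ?thesis unfolding r_def by linarith
    qed
    have rl: "(\<lambda>k. r k \<eta>) \<longlonglongrightarrow> 0" for \<eta>
      using tendsto_diff[OF tendsto_mult[OF cut(1)[of "?a \<eta>"] cut(1)[of "?b \<eta>"]] tendsto_const[of 1]] by (simp add: r_def)
    have "(F k \<eta> - ?a \<eta>)\<^sup>2 = (?a \<eta>)\<^sup>2 * (r k \<eta>)\<^sup>2" for k \<eta>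
      by (simp add: F_def tf_def cv[simplified] r_def power_mult_distrib[symmetric] right_diff_distrib)
    then show ?thesis using dom(1)[OF mass_moments(3)[OF A] rm rb rl] by simp
  qed
  have ap: "approx_seq G ?a F"
    unfolding approx_seq_def
  proof (intro conjI allI impI F_FC0 L2)
    fix \<epsilon> :: real assume "\<epsilon> > 0"
    then have "\<forall>\<^sub>F k in sequentially. e k < \<epsilon> / 4" by (intro order_tendstoD(2)[OF e0]) simp
    then obtain N where N: "\<And>k. k \<ge> N \<Longrightarrow> e k < \<epsilon> / 4" by (auto simp: eventually_sequentially)
    have "Eform G (\<lambda>\<eta>. F n \<eta> - F m \<eta>) < \<epsilon>" if "m \<ge> N" "n \<ge> N" for m n
      using Ediff[of n m] N[OF that(1)] N[OF that(2)] by linarith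
    then show "\<exists>N. \<forall>m\<ge>N. \<forall>n\<ge>N. Eform G (\<lambda>\<eta>. F n \<eta> - F m \<eta>) < \<epsilon>" by blast
  qed
  show "?a \<in> dom_closure G"
    unfolding dom_closure_def using ap mass_moments(3)[OF A] by auto
  show "Ebar G ?a = measure \<nu> A"
    using approx_seq_limit[OF _ mass_moments(3)[OF A] ap] EF_lim LIMSEQ_unique by force
qed

lemma spectral_gap_eq_1:
  assumes "measure \<nu> UNIV > 0"
  shows "spectral_gap G = 1"
proof -
  have p: "poincare G lam" if "0 < lam" "lam \<le> 1" for lam
    unfolding poincare_def
  proof
    fix F assume F: "F \<in> dom_closure G"
    have "Ebar G F \<le> Ebar G F / lam" using mult_right_mono[OF that(2) Ebar_nonneg[OF F]] that(1) by (simp add: field_simps)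
    then show "(\<integral>\<eta>. (F \<eta>)\<^sup>2 \<partial>G) \<le> Ebar G F / lam + (\<integral>\<eta>. F \<eta> \<partial>G)\<^sup>2" using poincare_dom[OF F] by linarith
  qed
  have np: "lam \<le> 1" if "lam > 0" "poincare G lam" for lam
  proof -
    have U: "UNIV \<in> sets (borel :: 'a measure)" by simp
    let ?v = "measure \<nu> UNIV"
    have "?v * (?v + 1) \<le> ?v / lam + ?v\<^sup>2"
      using that(2) mass_in_dom_closure[OF U] mass_moments[OF U] unfolding poincare_def by fastforce
    then have "?v \<le> ?v / lam" by (simp add: power2_eq_square algebra_simps)
    then show ?thesis using assms that(1) by (simp add: field_simps)
  qed
  have "Sup {lam. lam > 0 \<and> poincare G lam} = 1"
    using p[of 1] np by (intro cSup_eq_maximum) auto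
  then show ?thesis using p[of 1] by (auto simp: spectral_gap_def intro!: exI[of _ 1])
qed

lemma not_super_poincare:
  assumes small: "\<And>\<epsilon>. \<epsilon> > 0 \<Longrightarrow> \<exists>A\<in>sets borel. 0 < measure \<nu> A \<and> measure \<nu> A < \<epsilon>"
  shows "\<not> super_poincare G"
proof
  assume "super_poincare G"
  then obtain \<beta> :: "real \<Rightarrow> real" where \<beta>: "\<And>r. r > 0 \<Longrightarrow> \<beta> r > 0"
    and sp: "\<And>r F. r > 0 \<Longrightarrow> F \<in> dom_closure G \<Longrightarrow>
        (\<integral>\<eta>. (F \<eta>)\<^sup>2 \<partial>G) \<le> r * Ebar G F + \<beta> r * (\<integral>\<eta>. \<bar>F \<eta>\<bar> \<partial>G)\<^sup>2"
    unfolding super_poincare_def by blast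
  have b: "\<beta> (1/2) > 0" by (rule \<beta>) simp
  \<comment> \<open>Any \<open>r < 1\<close> would serve. With \<open>r = 1/2\<close> the inequality
    for a set of measure \<open>v > 0\<close> reduces to
    \<open>v + 1/2 \<le> \<beta> (1/2) * v\<close>, which fails once \<open>v\<close> is below
    \<open>1 / (2 * \<beta> (1/2))\<close>.\<close>
  obtain A where A: "A \<in> sets borel" "0 < measure \<nu> A" "measure \<nu> A < 1 / (2 * \<beta> (1/2))"
    using small[of "1 / (2 * \<beta> (1/2))"] b by auto
  let ?v = "measure \<nu> A"
  have "?v * (?v + 1) \<le> 1/2 * ?v + \<beta> (1/2) * ?v\<^sup>2"
    using sp[OF _ mass_in_dom_closure(1)[OF A(1)], of "1/2"] mass_in_dom_closure(2)[OF A(1)] mass_moments[OF A(1)] by simp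
  then have "?v * (?v + 1/2) \<le> ?v * (\<beta> (1/2) * ?v)" by (simp add: power2_eq_square algebra_simps)
  then have "?v + 1/2 \<le> \<beta> (1/2) * ?v" using A(2) by (simp only: mult_le_cancel_left_pos)
  moreover have "\<beta> (1/2) * ?v < 1/2" using A(3) b by (simp add: field_simps)
  ultimately show False using A(2) by linarith
qed

end

section \<open>Supports and the main theorem\<close>

text \<open>Disjoint balls around points of the support have positive measure. If each had measure
  at least \<open>\<epsilon>\<close>, more than \<open>measure \<nu> UNIV / \<epsilon>\<close> of
  them would exceed the total mass.\<close>

lemma small_sets_if_infinite_supp:
  fixes \<nu> :: "'a::metric_space measure"
  assumes \<nu>: "\<nu> \<in> Mset" and inf: "infinite (supp \<nu>)" and \<epsilon>: "\<epsilon> > 0"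
  shows "\<exists>A\<in>sets borel. 0 < measure \<nu> A \<and> measure \<nu> A < \<epsilon>"
proof (rule ccontr)
  assume neg: "\<not> ?thesis"
  have se: "sets \<nu> = sets borel" and fin: "finite_measure \<nu>" using \<nu> by (auto simp: Mset_def)
  interpret finite_measure \<nu> by fact
  obtain n :: nat where n: "measure \<nu> UNIV / \<epsilon> < real n" using reals_Archimedean2 by blast
  obtain T where T: "T \<subseteq> supp \<nu>" "finite T" "card T = n" using infinite_arbitrarily_large[OF inf] by blast
  have "\<exists>d>0. \<forall>y\<in>T. y \<noteq> x \<longrightarrow> d \<le> dist x y" for x using finite_set_avoid[OF T(2), of x] .
  then obtain d where d: "\<And>x. d x > 0" "\<And>x y. y \<in> T \<Longrightarrow> y \<noteq> x \<Longrightarrow> d x \<le> dist x y" by metis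
  \<comment> \<open>\<open>d x\<close> is a lower bound for the distance from \<open>x\<close> to
    the other points of \<open>T\<close>; halving it makes the balls pairwise disjoint.\<close>
  define U where "U x = ball x (d x / 2)" for x
  have disj: "disjoint_family_on U T"
    unfolding disjoint_family_on_def
  proof (intro ballI impI)
    fix x y assume xy: "x \<in> T" "y \<in> T" "x \<noteq> y"
    show "U x \<inter> U y = {}"
    proof (rule ccontr)
      assume "U x \<inter> U y \<noteq> {}"
      then obtain z where "dist x z < d x / 2" "dist y z < d y / 2" by (auto simp: U_def)
      moreover have "dist x y \<le> dist x z + dist y z" by (rule dist_triangle2)
      moreover have "d x \<le> dist x y" "d y \<le> dist x y" using d(2)[of y x] d(2)[of x y] xy by (auto simp: dist_commute)
      ultimately show False by linarith
    qed
  qed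
  have Um: "U x \<in> sets borel" for x by (simp add: U_def)
  have big: "\<epsilon> \<le> measure \<nu> (U x)" if "x \<in> T" for x
  proof -
    have "emeasure \<nu> (U x) > 0" using T(1) that d(1)[of x] by (auto simp: supp_def U_def)
    then have "measure \<nu> (U x) > 0" by (simp add: emeasure_eq_measure)
    then show ?thesis using neg Um[of x] by (meson not_less)
  qed
  have "real n * \<epsilon> = (\<Sum>x\<in>T. \<epsilon>)" using T by simp
  also have "\<dots> \<le> (\<Sum>x\<in>T. measure \<nu> (U x))" using big by (intro sum_mono)
  also have "\<dots> = measure \<nu> (\<Union>x\<in>T. U x)"
    using disj T(2) Um se by (intro finite_measure_finite_Union[symmetric]) auto
  also have "\<dots> \<le> measure \<nu> UNIV" using Um se T(2) sets_eq_imp_space_eq[OF se] by (intro finite_measure_mono) auto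
  finally show False using n \<epsilon> by (simp add: field_simps)
qed

text \<open>The complement of the support is the union of all open null sets, and by the Lindelof
  property countably many of them suffice.\<close>

lemma null_complement_supp:
  fixes \<nu> :: "'a::second_countable_topology measure"
  assumes "\<nu> \<in> Mset"
  shows "- supp \<nu> \<in> null_sets \<nu>"
proof -
  have se: "sets \<nu> = sets borel" using assms by (auto simp: Mset_def)
  define \<F> where "\<F> = {U. open U \<and> emeasure \<nu> U = 0}"
  obtain \<F>' where F: "\<F>' \<subseteq> \<F>" "countable \<F>'" "\<Union>\<F>' = \<Union>\<F>"
    using Lindelof[of \<F>] by (auto simp: \<F>_def)
  have "\<Union>\<F>' \<in> null_sets \<nu>"
    using F(1,2) se by (intro null_sets_UN'[of \<F>' "\<lambda>x. x", simplified]) (auto simp: \<F>_def null_sets_def)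
  moreover have "\<Union>\<F> = - supp \<nu>" by (auto simp: \<F>_def supp_def not_gr_zero)
  ultimately show ?thesis using F(3) by simp
qed

text \<open>A Borel set either misses the support, hence is null, or contains one of its atoms.
  Consequently the block masses of every partition are 0 or at least \<open>\<delta>\<close>, and
  the one-dimensional constants are bounded uniformly over all partitions.\<close>

lemma finite_supp_atoms:
  fixes \<nu> :: "'a::{second_countable_topology, t1_space} measure"
  assumes \<nu>: "\<nu> \<in> Mset" and fin: "finite (supp \<nu>)" and pos: "emeasure \<nu> UNIV > 0"
  defines "\<delta> \<equiv> Min ((\<lambda>x. measure \<nu> {x}) ` supp \<nu>)"
  shows "\<delta> > 0" "A \<in> sets borel \<Longrightarrow> measure \<nu> A = 0 \<or> \<delta> \<le> measure \<nu> A"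
proof -
  have se: "sets \<nu> = sets borel" and fm: "finite_measure \<nu>" using \<nu> by (auto simp: Mset_def)
  interpret finite_measure \<nu> by fact
  note null = null_complement_supp[OF \<nu>]
  have ne: "supp \<nu> \<noteq> {}" using null pos by (auto simp: null_sets_def)
  have atom: "measure \<nu> {x} > 0" if x: "x \<in> supp \<nu>" for x
  proof -
    \<comment> \<open>Removing the other, finitely many, points of the support leaves an open
      neighbourhood of \<open>x\<close> that differs from \<open>{x}\<close> only by a null
      set.\<close>
    let ?U = "- (supp \<nu> - {x})"
    have "open ?U" using fin by (intro open_Compl finite_imp_closed) auto
    then have "0 < emeasure \<nu> ?U" using x unfolding supp_def by blast
    also have "?U = {x} \<union> - supp \<nu>" using x by auto
    also have "emeasure \<nu> ({x} \<union> - supp \<nu>) = emeasure \<nu> {x}"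
      using null se by (intro emeasure_Un_null_set) auto
    finally show ?thesis by (simp add: emeasure_eq_measure)
  qed
  show "\<delta> > 0" unfolding \<delta>_def using fin ne atom by (subst Min_gr_iff) auto
  show "measure \<nu> A = 0 \<or> \<delta> \<le> measure \<nu> A" if A: "A \<in> sets borel"
  proof (cases "A \<inter> supp \<nu> = {}")
    case True
    then have "A \<subseteq> - supp \<nu>" by auto
    then have "A \<in> null_sets \<nu>" using null A se by (intro null_sets_subset[OF null]) auto
    then show ?thesis by (simp add: measure_def null_sets_def)
  next
    case False
    then obtain x where x: "x \<in> A" "x \<in> supp \<nu>" by auto
    have "\<delta> \<le> measure \<nu> {x}" unfolding \<delta>_def using fin x by (intro Min_le) auto
    also have "\<dots> \<le> measure \<nu> A" using x A se by (intro finite_measure_mono) auto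
    finally show ?thesis by simp
  qed
qed

theorem theorem2p1:
  fixes E_type :: "'a::polish_space itself"
  assumes "locally_compact_space (euclidean :: 'a topology)"
  shows
    "(\<forall>(\<nu>::'a measure) G. \<nu> \<in> Mset \<and> emeasure \<nu> UNIV > 0 \<and> is_gamma_dist \<nu> G \<longrightarrow>
        spectral_gap G = 1)
   \<and> (\<forall>(\<nu>::'a measure) G. \<nu> \<in> Mset \<and> emeasure \<nu> UNIV > 0 \<and> is_gamma_dist \<nu> G \<and>
        infinite (supp \<nu>) \<longrightarrow> \<not> super_poincare G)
   \<and> (\<exists>c0>0. \<forall>(\<nu>::'a measure) G. \<nu> \<in> Mset \<and> emeasure \<nu> UNIV > 0 \<and> is_gamma_dist \<nu> G \<and>
        finite (supp \<nu>) \<longrightarrow>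
        (let \<delta> = Min ((\<lambda>x. measure \<nu> {x}) ` supp \<nu>) in
          \<forall>F\<in>dom_closure G. (\<integral>\<eta>. (F \<eta>)\<^sup>2 \<partial>G) = 1 \<longrightarrow>
            integrable G (\<lambda>\<eta>. (F \<eta>)\<^sup>2 * ln ((F \<eta>)\<^sup>2)) \<and>
            (\<integral>\<eta>. (F \<eta>)\<^sup>2 * ln ((F \<eta>)\<^sup>2) \<partial>G) \<le> c0 / min 1 \<delta> * Ebar G F))"
proof (intro conjI allI impI exI[of _ 32])
  fix \<nu> :: "'a measure" and G
  assume "\<nu> \<in> Mset \<and> emeasure \<nu> UNIV > 0 \<and> is_gamma_dist \<nu> G"
  then have *: "\<nu> \<in> Mset" "emeasure \<nu> UNIV > 0" "is_gamma_dist \<nu> G" by auto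
  interpret gamma_process \<nu> G by unfold_locales (use * in auto)
  interpret \<nu>: finite_measure \<nu> using *(1) by (simp add: Mset_def)
  show "spectral_gap G = 1"
    using *(2) by (intro spectral_gap_eq_1) (simp add: \<nu>.emeasure_eq_measure)
next
  fix \<nu> :: "'a measure" and G
  assume "\<nu> \<in> Mset \<and> emeasure \<nu> UNIV > 0 \<and> is_gamma_dist \<nu> G \<and> infinite (supp \<nu>)"
  then have *: "\<nu> \<in> Mset" "is_gamma_dist \<nu> G" "infinite (supp \<nu>)" by auto
  interpret gamma_process \<nu> G by unfold_locales (use * in auto)
  show "\<not> super_poincare G"
    by (rule not_super_poincare) (rule small_sets_if_infinite_supp[OF *(1,3)])
next
  fix \<nu> :: "'a measure" and G
  assume "\<nu> \<in> Mset \<and> emeasure \<nu> UNIV > 0 \<and> is_gamma_dist \<nu> G \<and> finite (supp \<nu>)"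
  then have *: "\<nu> \<in> Mset" "emeasure \<nu> UNIV > 0" "is_gamma_dist \<nu> G" "finite (supp \<nu>)" by auto
  interpret gamma_process \<nu> G by unfold_locales (use * in auto)
  define \<delta> where "\<delta> = Min ((\<lambda>x. measure \<nu> {x}) ` supp \<nu>)"
  have \<delta>: "\<delta> > 0" "\<And>A. A \<in> sets borel \<Longrightarrow> measure \<nu> A = 0 \<or> \<delta> \<le> measure \<nu> A"
    using finite_supp_atoms[OF *(1,4,2)] by (auto simp: \<delta>_def)
  \<comment> \<open>The worst one-dimensional constant over all blocks. \<open>lsi_dom\<close>
    multiplies it by 4, which produces the 32.\<close>
  have C: "8 / min 1 \<delta> > 0" using \<delta>(1) by simp
  have CA: "measure \<nu> A = 0 \<or> 8 / min 1 (measure \<nu> A) \<le> 8 / min 1 \<delta>" if "A \<in> sets borel" for A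
    using \<delta>(2)[OF that] \<delta>(1) by (auto intro!: divide_left_mono simp: min_le_iff_disj)
  have "integrable G (\<lambda>\<eta>. (F \<eta>)\<^sup>2 * ln ((F \<eta>)\<^sup>2)) \<and>
      (\<integral>\<eta>. (F \<eta>)\<^sup>2 * ln ((F \<eta>)\<^sup>2) \<partial>G) \<le> 32 / min 1 \<delta> * Ebar G F"
    if "F \<in> dom_closure G" "(\<integral>\<eta>. (F \<eta>)\<^sup>2 \<partial>G) = 1" for F
    using lsi_dom[OF that C CA] by simp
  then show "let \<delta> = Min ((\<lambda>x. measure \<nu> {x}) ` supp \<nu>) in
          \<forall>F\<in>dom_closure G. (\<integral>\<eta>. (F \<eta>)\<^sup>2 \<partial>G) = 1 \<longrightarrow>
            integrable G (\<lambda>\<eta>. (F \<eta>)\<^sup>2 * ln ((F \<eta>)\<^sup>2)) \<and>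
            (\<integral>\<eta>. (F \<eta>)\<^sup>2 * ln ((F \<eta>)\<^sup>2) \<partial>G) \<le> 32 / min 1 \<delta> * Ebar G F"
    unfolding Let_def \<delta>_def[symmetric] by blast
qed simp

end
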